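(* Let $u\ge 0$ be an integer and $k$ a positive even integer. Let $a_1,\dots,a_u\in\{1,2,4,8\}$ and $c_1,\dots,c_k\in\{1,2,3,4,6\}$, and put ${\bf h}=c_1+\cdots+c_k$. Assume ${\bf h}\equiv 0\pmod 8$. Define $$\psi_{l,t}(\tau)=\prod_{i=1}^u\mathcal F(a_i\tau)\prod_{j=1}^k\Psi(c_j\tau),$$ where $\mathcal F(\tau)=\sum_{m,n\in\mathbb Z}q^{m^2+mn+n^2}$, $\Psi(\tau)=\sum_{n\ge0}q^{n(n+1)/2}$, $q=e^{2\pi i\tau}$. Let $L=\mathrm{lcm}\big[3\,\mathrm{lcm}(a_1,\dots,a_u),\,2\,\mathrm{lcm}(c_1,\dots,c_k)\big]$ and $\chi=\left(\frac{(-1)^{k/2}4c_1c_2\cdots c_k}{\cdot}\right)$. Then $q^{{\bf h}/8}\psi_{l,t}(\tau)$ is a modular form in $M_{u+k/2}(\Gamma_0(L),\chi')$, where $\chi'=\chi$ if $u$ is even and $\chi'=\left(\frac{\cdot}{3}\right)\chi$ if $u$ is odd.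
   Context: $\psi_{l,t}$ is the generating function of the number of representations of $n$ by the mixed form $\sum_{i=1}^u a_i(x_{2i-1}^2+x_{2i-1}x_{2i}+x_{2i}^2)+\sum_{i=1}^k c_i\,z_i(z_i+1)/2$ with $x_i\in\mathbb Z$, $z_i\in\mathbb Z_{\ge 0}$. $M_w(\Gamma_0(L),\chi')$ denotes the space of holomorphic modular forms of weight $w$ on $\Gamma_0(L)$ with character $\chi'$; $\left(\frac{m}{\cdot}\right)$ and $\left(\frac{\cdot}{3}\right)$ are Kronecker/Legendre symbols. When $u=0$, $\mathrm{lcm}(a_1,\dots,a_u)$ is taken to be $1$. *)

theory Defs
  imports "HOL-Complex_Analysis.Complex_Analysis" "HOL-Number_Theory.Number_Theory"
begin

definition kronecker_prime :: "int \<Rightarrow> int \<Rightarrow> int" where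
  "kronecker_prime m p =
     (if p = 2
      then (if even m then 0 else if m mod 8 \<in> {1, 7} then 1 else - 1)
      else Legendre m p)"

text \<open>The Kronecker symbol \<open>(m / n)\<close>. For negative \<open>n\<close>, \<open>prime_factors n\<close> consists of the
  positive primes dividing \<open>n\<close>; the sign factor is \<open>(m / -1)\<close>.\<close>

definition kronecker :: "int \<Rightarrow> int \<Rightarrow> int" where
  "kronecker m n =
     (if n = 0 then (if \<bar>m\<bar> = 1 then 1 else 0)
      else (if n < 0 \<and> m < 0 then - 1 else 1) *
           (\<Prod>p\<in>prime_factors n. kronecker_prime m p ^ multiplicity p n))"

definition upper_half_plane :: "complex set" where
  "upper_half_plane = {\<tau>. Im \<tau> > 0}"

definition slash ::
    "int \<Rightarrow> int \<Rightarrow> int \<Rightarrow> int \<Rightarrow> int \<Rightarrow> (complex \<Rightarrow> complex) \<Rightarrow> complex \<Rightarrow> complex" where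
  "slash w a b c d f \<tau> =
     (of_int c * \<tau> + of_int d) powi (- w) *
     f ((of_int a * \<tau> + of_int b) / (of_int c * \<tau> + of_int d))"

text \<open>\<open>f\<close> is a holomorphic function of \<open>exp (2 \<pi> i \<tau> / N)\<close> on the whole unit disc, centre
  included; equivalently it has a Fourier expansion in nonnegative powers of that parameter.\<close>

definition holomorphic_at_infinity :: "(complex \<Rightarrow> complex) \<Rightarrow> bool" where
  "holomorphic_at_infinity f \<longleftrightarrow>
     (\<exists>N::nat. N > 0 \<and> (\<exists>g. g holomorphic_on ball 0 1 \<and>
        (\<forall>\<tau>\<in>upper_half_plane. f \<tau> = g (exp (2 * of_real pi * \<i> * \<tau> / of_nat N)))))"

text \<open>A character of the unit group modulo \<open>L\<close>, given as a function on the integers. Its values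
  at integers not coprime to \<open>L\<close> are irrelevant.\<close>

definition character_mod :: "nat \<Rightarrow> (int \<Rightarrow> complex) \<Rightarrow> bool" where
  "character_mod L chi \<longleftrightarrow>
     chi 1 = 1 \<and>
     (\<forall>m n. coprime m (int L) \<longrightarrow> [m = n] (mod int L) \<longrightarrow> chi m = chi n) \<and>
     (\<forall>m n. coprime m (int L) \<longrightarrow> coprime n (int L) \<longrightarrow> chi (m * n) = chi m * chi n)"

text \<open>The space \<open>M\<^sub>w(\<Gamma>\<^sub>0(L), chi)\<close>. The values of \<open>f\<close> outside the upper half plane are irrelevant.
  Holomorphy at all cusps is imposed by letting \<open>(a b; c d)\<close> run over \<open>SL\<^sub>2(\<int>)\<close>.\<close>

definition modular_forms :: "int \<Rightarrow> nat \<Rightarrow> (int \<Rightarrow> complex) \<Rightarrow> (complex \<Rightarrow> complex) set" where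
  "modular_forms w L chi = {f.
     character_mod L chi \<and>
     f holomorphic_on upper_half_plane \<and>
     (\<forall>a b c d. a * d - b * c = 1 \<longrightarrow> int L dvd c \<longrightarrow>
        (\<forall>\<tau>\<in>upper_half_plane. slash w a b c d f \<tau> = chi d * f \<tau>)) \<and>
     (\<forall>a b c d. a * d - b * c = 1 \<longrightarrow> holomorphic_at_infinity (slash w a b c d f))}"

definition nome :: "complex \<Rightarrow> complex" where
  "nome \<tau> = exp (2 * of_real pi * \<i> * \<tau>)"

definition F_theta :: "complex \<Rightarrow> complex" where
  "F_theta \<tau> = (\<Sum>\<^sub>\<infinity>(m, n)\<in>(UNIV :: (int \<times> int) set). nome \<tau> powi (m\<^sup>2 + m * n + n\<^sup>2))"

definition Psi_theta :: "complex \<Rightarrow> complex" where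
  "Psi_theta \<tau> = (\<Sum>n. nome \<tau> ^ (n * (n + 1) div 2))"

definition psi :: "nat \<Rightarrow> nat \<Rightarrow> (nat \<Rightarrow> nat) \<Rightarrow> (nat \<Rightarrow> nat) \<Rightarrow> complex \<Rightarrow> complex" where
  "psi u k a c \<tau> =
     (\<Prod>i\<in>{1..u}. F_theta (of_nat (a i) * \<tau>)) * (\<Prod>j\<in>{1..k}. Psi_theta (of_nat (c j) * \<tau>))"

end

theory Submission
  imports Defs "HOL-Probability.Characteristic_Functions"
begin

text \<open>
  Up to the constant \<open>2\<^sup>k\<close>, the function is a product of the null values \<open>\<theta>\<^sub>2(c\<^sub>j \<tau>)\<close> and of
  \<open>F(a\<^sub>i \<tau>)\<close>, where \<open>F(\<tau>) = \<theta>\<^sub>3(2\<tau>)\<theta>\<^sub>3(6\<tau>) + \<theta>\<^sub>2(2\<tau>)\<theta>\<^sub>2(6\<tau>)\<close>. Everything rests on the inversion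
  formula for \<open>\<Sum>\<^sub>n exp(\<pi>\<i>(n+r)\<^sup>2\<tau>)\<close>: on the imaginary axis it is Poisson summation for the Gaussian,
  and it extends to the half plane by analytic continuation. For rational \<open>r\<close> it shows that polynomials
  in such theta series, with rescaled arguments, are stable under the slash action of
  \<open>SL\<^sub>2(\<int>)\<close>, whence holomorphy at all cusps.

  The group \<open>\<Gamma>\<^sub>0(3)\<close> is generated by \<open>-I\<close> and two parabolic elements, under which \<open>F\<close> is easily seen to be
  covariant. For \<open>\<theta>\<^sub>2(c\<tau>)\<close> and \<open>(A B; C D)\<close> with \<open>2c | C\<close> and \<open>D > 0\<close>, two inversions produce a factor
  \<open>exp(\<pi>\<i>cBD/4)\<close> times the Gauss sum \<open>G(2cB, D) = (2cB / D) G(1, D)\<close> times a square root of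
  \<open>(C\<tau> + D) / D\<close> that does not depend on \<open>c\<close>. In the product the exponentials cancel because \<open>8 | h\<close>, and as
  \<open>k\<close> is even only \<open>G(1, D)\<^sup>2 = (-1 / D) D\<close> is needed.
\<close>

section \<open>Uniqueness of Fourier coefficients\<close>

text \<open>The obstacle is half-integral weight: a single theta value transforms with a square root
  whose branch would have to be followed through the group. Square roots therefore occur only as
  \<open>csqrt (- \<i> * z)\<close> with Im z > 0, away from the branch cut, and are combined only
  in even powers. This is why \<open>theta_poly m\<close> counts theta factors: in degree 2w and
  weight w all roots collapse into integral powers of c\<tau> + d.

  Rational characteristics and scales turn a theta series into a power series in a root of the nome,
  which yields holomorphy in the half plane and at infinity in one stroke.

  Gauss sums are used with positive odd modulus only; matrices with D < 0 are reduced to D > 0 by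
  -I, and the parity of the character has to agree with the weight for this. That the character has
  period L is part of the claim. It is read off from the form itself, which does not vanish at
  \<open>\<i>\<close> because all theta values on the imaginary axis are positive.\<close>

definition unit_exp :: "real \<Rightarrow> complex" where
  "unit_exp x = cis (2 * pi * x)"

lemma unit_exp_add: "unit_exp (x + y) = unit_exp x * unit_exp y"
  by (simp add: unit_exp_def cis_mult distrib_left)

lemma unit_exp_of_int [simp]: "unit_exp (of_int n) = 1"
  by (simp add: unit_exp_def cis_multiple_2pi)

lemma unit_exp_0 [simp]: "unit_exp 0 = 1"
  by (simp add: unit_exp_def)

lemma unit_exp_add_of_int [simp]: "unit_exp (x + of_int n) = unit_exp x"
  by (simp add: unit_exp_add)

lemma norm_unit_exp [simp]: "norm (unit_exp x) = 1"
  by (simp add: unit_exp_def)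

lemma unit_exp_half: "unit_exp (of_int n / 2) = (if even n then 1 else - 1)"
proof (cases "even n")
  case True
  then obtain m where "n = 2 * m" by blast
  then show ?thesis by simp
next
  case False
  then obtain m where "n = 2 * m + 1" by (elim oddE)
  then have *: "of_int n / 2 = 1/2 + (of_int m :: real)"
    by simp
  have "unit_exp (of_int n / 2) = unit_exp (1/2)"
    unfolding * by simp
  also have "\<dots> = -1"
    by (simp add: unit_exp_def)
  finally show ?thesis using False by simp
qed

lemma continuous_on_unit_exp [continuous_intros]:
  "continuous_on A f \<Longrightarrow> continuous_on A (\<lambda>x. unit_exp (f x))"
  unfolding unit_exp_def by (intro continuous_intros)

lemma unit_exp_eq_exp: "unit_exp x = exp (2 * of_real pi * \<i> * of_real x)"
  by (simp add: unit_exp_def cis_conv_exp mult_ac)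

lemma unit_exp_eq_iff: "unit_exp x = unit_exp y \<longleftrightarrow> (\<exists>n::int. x = y + of_int n)"
proof -
  have "unit_exp x = unit_exp y \<longleftrightarrow>
      (\<exists>n::int. 2 * of_real pi * \<i> * complex_of_real x = 2 * of_real pi * \<i> * complex_of_real y + (of_int (2 * n) * pi) * \<i>)"
    unfolding unit_exp_eq_exp by (rule exp_eq)
  also have "\<dots> \<longleftrightarrow> (\<exists>n::int. x = y + of_int n)"
  proof (intro ex_cong1)
    fix n :: int
    have "(2 * of_real pi * \<i> * complex_of_real x = 2 * of_real pi * \<i> * complex_of_real y + (of_int (2 * n) * pi) * \<i>)
       \<longleftrightarrow> (2 * of_real pi * \<i>) * complex_of_real x = (2 * of_real pi * \<i>) * (complex_of_real (y + of_int n))"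
      by (simp add: algebra_simps)
    also have "\<dots> \<longleftrightarrow> complex_of_real x = complex_of_real (y + of_int n)"
      by (subst mult_cancel_left) auto
    also have "\<dots> \<longleftrightarrow> x = y + of_int n"
      by (rule of_real_eq_iff)
    finally show "(2 * of_real pi * \<i> * complex_of_real x = 2 * of_real pi * \<i> * complex_of_real y + (of_int (2 * n) * pi) * \<i>) = (x = y + of_int n)" .
  qed
  finally show ?thesis .
qed

text \<open>With compactness of [0,1] this makes \<open>unit_exp\<close> a quotient map onto the
  circle, through which functions of period 1 descend continuously.\<close>

lemma unit_exp_image: "unit_exp ` {0..1} = sphere 0 1"
proof (intro equalityI subsetI)
  fix z :: complex assume "z \<in> sphere 0 1"
  then have "norm z = 1" by simp
  then have "exp (\<i> * of_real (Arg2pi z)) = z"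
    by (simp add: complex_norm_eq_1_exp)
  then have "z = unit_exp (Arg2pi z / (2 * pi))"
    by (simp add: unit_exp_eq_exp)
  moreover have "Arg2pi z / (2 * pi) \<in> {0..1}"
    using Arg2pi[of z] by auto
  ultimately show "z \<in> unit_exp ` {0..1}" by blast
qed auto

text \<open>Generated by characters and sums only, so that orthogonality to all characters extends
  to the whole class by induction.\<close>

inductive trig_poly :: "(real \<Rightarrow> complex) \<Rightarrow> bool" where
  mono: "trig_poly (\<lambda>x. c * unit_exp (of_int k * x))"
| add: "trig_poly f \<Longrightarrow> trig_poly g \<Longrightarrow> trig_poly (\<lambda>x. f x + g x)"

lemma trig_poly_const: "trig_poly (\<lambda>x. c)"
  using trig_poly.mono[of c 0] by simp

lemma trig_poly_mult: "trig_poly f \<Longrightarrow> trig_poly g \<Longrightarrow> trig_poly (\<lambda>x. f x * g x)"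
proof (induction rule: trig_poly.induct)
  case (mono c k)
  from mono show ?case
  proof (induction rule: trig_poly.induct)
    case (mono c' k')
    have "(\<lambda>x. c * unit_exp (of_int k * x) * (c' * unit_exp (of_int k' * x))) =
        (\<lambda>x. (c * c') * unit_exp (of_int (k + k') * x))"
      by (simp add: unit_exp_add ring_distribs mult_ac)
    then show ?case using trig_poly.mono[of "c * c'" "k + k'"] by simp
  next
    case (add f g)
    then show ?case using trig_poly.add by (fastforce simp: ring_distribs)
  qed
next
  case (add f h)
  then have "trig_poly (\<lambda>x. f x * g x + h x * g x)"
    by (intro trig_poly.add) auto
  then show ?case by (simp add: ring_distribs)
qed

text \<open>Stone-Weierstrass delivers real polynomials on the plane. On the circle a real-linear
  form is a combination of z and its conjugate, the characters of frequency 1 and -1; sums and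
  products stay in the class.\<close>

lemma trig_poly_real_polynomial_function:
  fixes p :: "complex \<Rightarrow> real"
  assumes "real_polynomial_function p"
  shows "trig_poly (\<lambda>x. of_real (p (unit_exp x)))"
  using assms
proof (induction rule: real_polynomial_function.induct)
  case (linear f)
  have "of_real (f (unit_exp x)) =
      (of_real (f 1) / 2 + of_real (f \<i>) / (2 * \<i>)) * unit_exp (of_int 1 * x) +
      (of_real (f 1) / 2 - of_real (f \<i>) / (2 * \<i>)) * unit_exp (of_int (-1) * x)" for x
  proof -
    interpret bounded_linear f by fact
    have "unit_exp x = cos (2*pi*x) *\<^sub>R 1 + sin (2*pi*x) *\<^sub>R \<i>"
      by (simp add: complex_eq_iff unit_exp_def)
    then have "f (unit_exp x) = cos (2*pi*x) * f 1 + sin (2*pi*x) * f \<i>"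
      by (simp only: add scaleR) simp
    then show ?thesis
      by (simp add: complex_eq_iff unit_exp_def field_simps)
  qed
  moreover have "trig_poly (\<lambda>x. (of_real (f 1) / 2 + of_real (f \<i>) / (2 * \<i>)) * unit_exp (of_int 1 * x) +
      (of_real (f 1) / 2 - of_real (f \<i>) / (2 * \<i>)) * unit_exp (of_int (-1) * x))"
    by (intro trig_poly.intros)
  ultimately show ?case by presburger
qed (auto intro: trig_poly_const trig_poly.add trig_poly_mult)

lemma periodic_of_int:
  fixes u :: "real \<Rightarrow> 'a"
  assumes "\<And>x. u (x + 1) = u x"
  shows "u (x + of_int n) = u x"
proof (induction n rule: int_induct[where k = 0])
  case (step1 i)
  then show ?case using assms[of "x + of_int i"] by (simp add: add_ac)
next
  case (step2 i)
  then show ?case using assms[of "x + of_int (i - 1)"] by (simp add: add_ac)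
qed simp

text \<open>Stone-Weierstrass needs a compact domain on which the approximants are automatically
  periodic: the circle in place of the line.\<close>

lemma periodic_factor_circle:
  fixes u :: "real \<Rightarrow> real"
  assumes cont: "continuous_on UNIV u" and per: "\<And>x. u (x + 1) = u x"
  obtains d where "continuous_on (sphere (0::complex) 1) d" "\<And>x. d (unit_exp x) = u x"
proof
  define d where "d = (\<lambda>z. u (SOME x. unit_exp x = z))"
  show d: "d (unit_exp x) = u x" for x
  proof -
    have "unit_exp (SOME y. unit_exp y = unit_exp x) = unit_exp x"
      by (rule someI[of _ x]) auto
    then obtain n :: int where "(SOME y. unit_exp y = unit_exp x) = x + of_int n"
      unfolding unit_exp_eq_iff by blast
    then show ?thesis
      unfolding d_def using periodic_of_int[of u, OF per] by simp
  qed
  show "continuous_on (sphere (0::complex) 1) d"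
  proof (subst continuous_on_open_gen[where T = UNIV]; (intro allI impI)?)
    fix U assume "openin (top_of_set (UNIV::real set)) U"
    then have U: "open U" by simp
    \<comment> \<open>A continuous map of a compact space onto a Hausdorff space is a quotient map,
      so openness may be tested after pulling back to [0,1].\<close>
    have "openin (top_of_set (sphere 0 1)) (sphere 0 1 \<inter> d -` U) \<longleftrightarrow>
        openin (top_of_set {0..1}) ({0..1} \<inter> unit_exp -` (sphere 0 1 \<inter> d -` U))"
      by (subst Abstract_Topology_2.continuous_imp_quotient_map[OF _ unit_exp_image])
         (auto intro!: continuous_intros)
    also have "{0..1} \<inter> unit_exp -` (sphere 0 1 \<inter> d -` U) = {0..1} \<inter> u -` U"
      using d by auto
    also have "openin (top_of_set {0..1}) ({0..1} \<inter> u -` U)"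
      using cont U by (meson continuous_on_subset continuous_openin_preimage_gen subset_UNIV)
    finally show "openin (top_of_set (sphere 0 1)) (sphere 0 1 \<inter> d -` U)" by simp
  qed auto
qed

text \<open>Let p be a trigonometric polynomial uniformly within e of u. Since u is orthogonal to p,
  the integral of u^2 equals that of u(u - p), which is at most M e; hence it is 0, and continuity
  gives u = 0.\<close>

lemma fourier_coefficients_zero_real:
  fixes u :: "real \<Rightarrow> real"
  assumes cont: "continuous_on UNIV u" and per: "\<And>x. u (x + 1) = u x"
    and zero: "\<And>k::int. integral {0..1} (\<lambda>x. of_real (u x) * unit_exp (of_int k * x)) = 0"
  shows "u x = 0"
proof -
  have contu [continuous_intros]: "continuous_on A (\<lambda>x. u (g x))" if "continuous_on A g" for A g
    using continuous_on_compose2[OF cont that] by auto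
  have orth: "((\<lambda>x. of_real (u x) * f x) has_integral 0) {0..1}" if "trig_poly f" for f
    using that
  proof (induction rule: trig_poly.induct)
    case (mono c k)
    have "(\<lambda>x. of_real (u x) * unit_exp (of_int k * x)) integrable_on {0..1}"
      by (intro integrable_continuous_real continuous_intros)
    then have "((\<lambda>x. of_real (u x) * unit_exp (of_int k * x)) has_integral 0) {0..1}"
      using zero[of k] by (metis has_integral_integral)
    from has_integral_mult_right[OF this, of c] show ?case
      by (simp add: mult_ac)
  next
    case (add f g)
    from has_integral_add[OF add.IH] show ?case by (simp add: ring_distribs)
  qed
  obtain d where d: "continuous_on (sphere (0::complex) 1) d" "\<And>x. d (unit_exp x) = u x"
    using periodic_factor_circle[of u, OF cont per] by blast
  obtain M where M: "M > 0" "\<And>x. x \<in> {0..1} \<Longrightarrow> \<bar>u x\<bar> \<le> M"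
  proof -
    have "compact (u ` {0..1})"
      by (intro compact_continuous_image) (auto intro!: continuous_intros)
    then have "bounded (u ` {0..1})" by (rule compact_imp_bounded)
    then show ?thesis using that by (auto simp: bounded_pos)
  qed
  have int: "(\<lambda>x. (u x)\<^sup>2) integrable_on {0..1}"
    by (intro integrable_continuous_real continuous_intros)
  have le: "integral {0..1} (\<lambda>x. (u x)\<^sup>2) \<le> M * e" if "e > 0" for e
  proof -
    obtain p where p: "real_polynomial_function p" "\<And>z. z \<in> sphere (0::complex) 1 \<Longrightarrow> \<bar>d z - p z\<bar> < e"
      using Stone_Weierstrass_real_polynomial_function[OF compact_sphere d(1) \<open>e > 0\<close>] by metis
    have "((\<lambda>x. complex_of_real (u x) * of_real (p (unit_exp x))) has_integral 0) {0..1}"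
      by (intro orth trig_poly_real_polynomial_function p)
    from has_integral_linear[OF this bounded_linear_Re]
    have 1: "((\<lambda>x. u x * p (unit_exp x)) has_integral 0) {0..1}"
      by (simp add: o_def)
    have 2: "((\<lambda>x. (u x)\<^sup>2 - u x * p (unit_exp x)) has_integral integral {0..1} (\<lambda>x. (u x)\<^sup>2)) {0..1}"
      using has_integral_diff[OF integrable_integral[OF int] 1] by simp
    have "(u x)\<^sup>2 - u x * p (unit_exp x) \<le> M * e" if "x \<in> {0..1}" for x
    proof -
      have "(u x)\<^sup>2 - u x * p (unit_exp x) = u x * (d (unit_exp x) - p (unit_exp x))"
        by (simp add: d power2_eq_square algebra_simps)
      also have "\<dots> \<le> \<bar>u x\<bar> * \<bar>d (unit_exp x) - p (unit_exp x)\<bar>"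
        by (metis abs_ge_self abs_mult)
      also have "\<dots> \<le> M * e"
        using M p(2)[of "unit_exp x"] that by (intro mult_mono) (auto simp: less_imp_le)
      finally show ?thesis .
    qed
    then have "integral {0..1} (\<lambda>x. (u x)\<^sup>2) \<le> M * e * (1 - 0)"
      using has_integral_le[OF 2, of "\<lambda>_. M * e" "M * e"] has_integral_const_real[of "M * e" 0 1]
      by simp
    then show ?thesis by simp
  qed
  have "integral {0..1} (\<lambda>x. (u x)\<^sup>2) \<le> 0"
  proof (rule ccontr)
    assume "\<not> ?thesis"
    then have pos: "integral {0..1} (\<lambda>x. (u x)\<^sup>2) > 0" (is "?I > 0") by simp
    from le[of "?I / (2 * M)"] pos M(1) show False by (simp add: field_simps)
  qed
  moreover have "integral {0..1} (\<lambda>x. (u x)\<^sup>2) \<ge> 0"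
    by (intro integral_nonneg int) auto
  ultimately have *: "((\<lambda>x. (u x)\<^sup>2) has_integral 0) (cbox 0 1)"
    using int by (metis antisym has_integral_integral cbox_interval)
  have z: "u y = 0" if "y \<in> {0..1}" for y
  proof -
    have "continuous_on (cbox 0 1) (\<lambda>x. (u x)\<^sup>2)"
      by (intro continuous_intros)
    from has_integral_0_cbox_imp_0[OF this _ *, of y] that show ?thesis by auto
  qed
  have "u x = u (frac x + of_int \<lfloor>x\<rfloor>)"
    by (simp add: frac_def)
  also have "\<dots> = u (frac x)"
    by (rule periodic_of_int[of u, OF per])
  also have "\<dots> = 0"
    by (intro z) (auto simp: frac_lt_1 less_imp_le)
  finally show ?thesis .
qed

text \<open>The coefficients of the conjugate function are the conjugates at the opposite frequency,
  so they vanish too, and with them those of the real and imaginary parts.\<close>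

lemma fourier_coefficients_zero:
  fixes D :: "real \<Rightarrow> complex"
  assumes cont: "continuous_on UNIV D" and per: "\<And>x. D (x + 1) = D x"
    and zero: "\<And>k::int. integral {0..1} (\<lambda>x. D x * unit_exp (of_int k * x)) = 0"
  shows "D x = 0"
proof -
  have contD [continuous_intros]: "continuous_on A (\<lambda>x. D (g x))" if "continuous_on A g" for A g
    using continuous_on_compose2[OF cont that] by auto
  have hi: "((\<lambda>x. D x * unit_exp (of_int k * x)) has_integral 0) {0..1}" for k
  proof -
    have "(\<lambda>x. D x * unit_exp (of_int k * x)) integrable_on {0..1}"
      by (intro integrable_continuous_real continuous_intros)
    then show ?thesis using zero[of k] by (metis has_integral_integral)
  qed
  have hc: "((\<lambda>x. cnj (D x) * unit_exp (of_int k * x)) has_integral 0) {0..1}" for k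
  proof -
    from has_integral_linear[OF hi[of "-k"] bounded_linear_cnj]
    show ?thesis by (simp add: o_def unit_exp_def cis_cnj)
  qed
  have "Re (D x) = 0"
  proof (rule fourier_coefficients_zero_real[of "\<lambda>x. Re (D x)"])
    fix k :: int
    have "((\<lambda>x. (D x * unit_exp (of_int k * x) + cnj (D x) * unit_exp (of_int k * x)) / 2) has_integral (0 + 0) / 2) {0..1}"
      by (intro has_integral_divide has_integral_add hi hc)
    moreover have "(D x * unit_exp (of_int k * x) + cnj (D x) * unit_exp (of_int k * x)) / 2 =
        of_real (Re (D x)) * unit_exp (of_int k * x)" for x
      by (simp add: distrib_right[symmetric] complex_add_cnj)
    ultimately show "integral {0..1} (\<lambda>x. of_real (Re (D x)) * unit_exp (of_int k * x)) = 0"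
      by (simp add: integral_unique)
  qed (auto intro!: continuous_intros simp: per)
  moreover have "Im (D x) = 0"
  proof (rule fourier_coefficients_zero_real[of "\<lambda>x. Im (D x)"])
    fix k :: int
    have "((\<lambda>x. (D x * unit_exp (of_int k * x) - cnj (D x) * unit_exp (of_int k * x)) / (2 * \<i>)) has_integral (0 - 0) / (2 * \<i>)) {0..1}"
      by (intro has_integral_divide has_integral_diff hi hc)
    moreover have "(D x * unit_exp (of_int k * x) - cnj (D x) * unit_exp (of_int k * x)) / (2 * \<i>) =
        of_real (Im (D x)) * unit_exp (of_int k * x)" for x
      by (simp add: left_diff_distrib[symmetric] complex_diff_cnj divide_eq_eq mult_ac)
    ultimately show "integral {0..1} (\<lambda>x. of_real (Im (D x)) * unit_exp (of_int k * x)) = 0"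
      by (simp add: integral_unique)
  qed (auto intro!: continuous_intros simp: per)
  ultimately show ?thesis by (simp add: complex_eq_iff)
qed

section \<open>Poisson summation for the Gaussian\<close>

lemma summable_on_power_nat_abs:
  fixes q :: real
  assumes "0 \<le> q" "q < 1"
  shows "(\<lambda>n::int. q ^ nat \<bar>n\<bar>) summable_on UNIV"
proof -
  have geo: "(\<lambda>n. q ^ n) summable_on (UNIV :: nat set)"
    using assms by (intro norm_summable_imp_summable_on) (simp add: summable_geometric)
  have "(\<lambda>n::int. q ^ nat \<bar>n\<bar>) summable_on range int"
    using geo by (subst summable_on_reindex) (auto simp: o_def)
  moreover have "(\<lambda>n::int. q ^ nat \<bar>n\<bar>) summable_on range (\<lambda>n. - int n)"
    using geo by (subst summable_on_reindex) (auto simp: o_def inj_on_def)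
  ultimately have "(\<lambda>n::int. q ^ nat \<bar>n\<bar>) summable_on (range int \<union> range (\<lambda>n. - int n))"
    by (rule summable_on_union)
  also have "range int \<union> range (\<lambda>n. - int n) = UNIV"
  proof -
    have "x \<in> range int \<union> range (\<lambda>n. - int n)" for x
      by (cases x rule: int_cases2) auto
    then show ?thesis by blast
  qed
  finally show ?thesis .
qed

text \<open>From (|y| - 1/2)^2 >= 0 follows y^2 >= |y| - 1/4. The resulting geometric majorant is
  uniform in the shift r on bounded sets, as the M-test demands.\<close>

lemma exp_neg_square_le:
  fixes t R r :: real and n :: int
  assumes "t > 0" "\<bar>r\<bar> \<le> R"
  shows "exp (- (t * (of_int n + r)\<^sup>2)) \<le> exp (t * (R + 1/4)) * exp (- t) ^ nat \<bar>n\<bar>"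
proof -
  have "\<bar>of_int n + r\<bar> - 1/4 \<le> (of_int n + r)\<^sup>2"
    using zero_le_power2[of "\<bar>of_int n + r\<bar> - 1/2"] by (simp add: power2_eq_square algebra_simps)
  then have "\<bar>of_int n\<bar> - (R + 1/4) \<le> (of_int n + r)\<^sup>2"
    using assms by linarith
  then have "t * (\<bar>of_int n\<bar> - (R + 1/4)) \<le> t * (of_int n + r)\<^sup>2"
    using assms by (intro mult_left_mono) auto
  then have "exp (- (t * (of_int n + r)\<^sup>2)) \<le> exp (t * (R + 1/4) + of_nat (nat \<bar>n\<bar>) * (- t))"
    by (simp add: algebra_simps)
  also have "\<dots> = exp (t * (R + 1/4)) * exp (- t) ^ nat \<bar>n\<bar>"
    by (simp only: exp_add exp_of_nat_mult)
  finally show ?thesis .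
qed

lemma summable_on_exp_bound:
  fixes t :: real
  assumes "t > 0"
  shows "(\<lambda>n::int. C * exp (- t) ^ nat \<bar>n\<bar>) summable_on UNIV"
  using assms by (intro summable_on_cmult_right summable_on_power_nat_abs) auto

lemma summable_on_exp_neg_square:
  fixes t r :: real
  assumes "t > 0"
  shows "(\<lambda>n::int. exp (- (t * (of_int n + r)\<^sup>2))) summable_on UNIV"
  by (rule summable_on_comparison_test[OF summable_on_exp_bound[OF assms]])
     (use exp_neg_square_le[OF assms order_refl] in auto)

lemma uniform_limit_unit_exp_series:
  assumes "(\<lambda>k. norm (a k)) summable_on (UNIV :: int set)"
  shows "uniform_limit A (\<lambda>X x. \<Sum>k\<in>X. a k * unit_exp (of_int k * x))
    (\<lambda>x. \<Sum>\<^sub>\<infinity>k. a k * unit_exp (of_int k * x)) (finite_subsets_at_top UNIV)"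
  by (rule Weierstrass_m_test_general[OF _ assms]) (simp add: norm_mult)

lemma integral_unit_exp: "((\<lambda>x. unit_exp (of_int k * x)) has_integral (if k = 0 then 1 else 0)) {0..1}"
proof (cases "k = 0")
  case True
  then show ?thesis using has_integral_const_real[of "1::complex" 0 1] by simp
next
  case False
  have "((\<lambda>x. unit_exp (of_int k * x)) has_integral
      (unit_exp (of_int k * 1) / (2 * of_real pi * \<i> * of_int k) - unit_exp (of_int k * 0) / (2 * of_real pi * \<i> * of_int k))) {0..1}"
  proof (rule fundamental_theorem_of_calculus)
    fix x :: real assume "x \<in> {0..1}"
    show "((\<lambda>x. unit_exp (of_int k * x) / (2 * of_real pi * \<i> * of_int k)) has_vector_derivative unit_exp (of_int k * x)) (at x within {0..1})"
      unfolding unit_exp_eq_exp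
      using False by (auto intro!: derivative_eq_intros has_vector_derivative_real_field simp: field_simps)
  qed auto
  then show ?thesis using False unit_exp_of_int[of k] by simp
qed

text \<open>The pairing is with the character of frequency j itself, not with its conjugate; hence
  the index - j.\<close>

lemma fourier_coefficients_series:
  assumes "(\<lambda>k. norm (a k)) summable_on (UNIV :: int set)"
  shows "((\<lambda>x. (\<Sum>\<^sub>\<infinity>k. a k * unit_exp (of_int k * x)) * unit_exp (of_int j * x)) has_integral a (- j)) {0..1}"
proof -
  have sm: "(\<lambda>k. a k * unit_exp (of_int k * x)) summable_on UNIV" for x
    by (rule abs_summable_summable) (use assms in \<open>simp add: norm_mult\<close>)
  have "uniform_limit {0..1} (\<lambda>X x. \<Sum>k\<in>X. a k * unit_exp (of_int k * x) * unit_exp (of_int j * x))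
    (\<lambda>x. \<Sum>\<^sub>\<infinity>k. a k * unit_exp (of_int k * x) * unit_exp (of_int j * x)) (finite_subsets_at_top UNIV)"
    by (rule Weierstrass_m_test_general[OF _ assms]) (simp add: norm_mult)
  then obtain I J where I: "\<And>X. ((\<lambda>x. \<Sum>k\<in>X. a k * unit_exp (of_int k * x) * unit_exp (of_int j * x)) has_integral I X) {0..1}"
     and J: "((\<lambda>x. \<Sum>\<^sub>\<infinity>k. a k * unit_exp (of_int k * x) * unit_exp (of_int j * x)) has_integral J) {0..1}"
     and lim: "(I \<longlongrightarrow> J) (finite_subsets_at_top UNIV)"
    by (rule uniform_limit_integral) (auto intro!: continuous_intros)
  have "I X = (\<Sum>k\<in>X. if k = - j then a (- j) else 0)" if "finite X" for X
  proof (rule has_integral_unique[OF I], rule has_integral_sum[OF that])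
    fix k
    have "((\<lambda>x. a k * unit_exp (of_int (k + j) * x)) has_integral a k * (if k + j = 0 then 1 else 0)) {0..1}"
      by (intro has_integral_mult_right integral_unit_exp)
    moreover have e2: "a k * unit_exp (of_int k * x) * unit_exp (of_int j * x) = a k * unit_exp (of_int (k + j) * x)" for x
      by (simp add: unit_exp_add ring_distribs)
    moreover have e3: "a k * (if k + j = 0 then 1 else 0) = (if k = - j then a (- j) else 0)"
      by (cases "k = - j") auto
    ultimately show "((\<lambda>x. a k * unit_exp (of_int k * x) * unit_exp (of_int j * x)) has_integral (if k = - j then a (- j) else 0)) {0..1}"
      by (simp only: e2 e3)
  qed
  then have "\<forall>\<^sub>F X in finite_subsets_at_top UNIV. I X = (\<Sum>k\<in>X. if k = - j then a (- j) else 0)"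
    by (simp add: eventually_finite_subsets_at_top_weakI)
  with lim have "((\<lambda>X. \<Sum>k\<in>X. if k = - j then a (- j) else 0) \<longlongrightarrow> J) (finite_subsets_at_top UNIV)"
    using tendsto_cong by fast
  then have "((\<lambda>k. if k = - j then a (- j) else 0) has_sum J) UNIV"
    by (simp add: has_sum_def)
  moreover have "((\<lambda>k. if k = - j then a (- j) else 0) has_sum a (- j)) UNIV"
    by (rule has_sum_finite_neutralI[of "{- j}"]) auto
  ultimately have "J = a (- j)"
    by (rule has_sum_unique)
  with J show ?thesis
    by (simp add: infsum_cmult_left[OF sm])
qed

text \<open>The scale c = sqrt(2 pi t) makes (c x)^2 / 2 = pi t x^2, so the integral becomes the
  characteristic function of the standard normal distribution at 2 pi k / c; the Jacobian and the
  normalisation of the density leave the factor 1 / sqrt t.\<close>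

lemma gaussian_fourier_transform:
  fixes t :: real and k :: int
  assumes t: "t > 0"
  defines "G \<equiv> (\<lambda>x. of_real (exp (- (pi * t * x\<^sup>2))) * unit_exp (of_int k * x))"
  shows "integrable lborel G"
    and "(LINT x|lborel. G x) = of_real (exp (- (pi * (of_int k)\<^sup>2 / t)) / sqrt t)"
proof -
  define c where "c = sqrt (2 * pi * t)"
  have c: "c > 0" "c\<^sup>2 = 2 * pi * t"
    using t by (auto simp: c_def)
  define s where "s = 2 * pi * of_int k / c"
  define h where "h = (\<lambda>x. std_normal_density x *\<^sub>R iexp (s * x))"
  have inth: "integrable lborel h"
  proof (rule Bochner_Integration.integrable_bound)
    show "integrable lborel (\<lambda>x. std_normal_density x)"
      by simp
  qed (auto simp: h_def)
  have "(LINT x|lborel. h x) = char std_normal_distribution s"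
    unfolding char_def h_def by (subst integral_density) auto
  also have "\<dots> = of_real (exp (- (s\<^sup>2) / 2))"
    by (simp add: char_std_normal_distribution)
  also have "- (s\<^sup>2) / 2 = - (pi * (of_int k)\<^sup>2 / t)"
    using t by (simp add: s_def power_divide c power_mult_distrib) (simp add: power2_eq_square field_simps)
  finally have hI: "(LINT x|lborel. h x) = of_real (exp (- (pi * (of_int k)\<^sup>2 / t)))" .
  have hc: "h (0 + c * x) = (1 / sqrt (2 * pi)) *\<^sub>R G x" for x
  proof -
    have "(c * x)\<^sup>2 / 2 = pi * t * x\<^sup>2"
      by (simp add: power_mult_distrib c)
    moreover have "s * (c * x) = 2 * pi * (of_int k * x)"
      using c by (simp add: s_def)
    ultimately have "std_normal_density (0 + c * x) = 1 / sqrt (2 * pi) * exp (- (pi * t * x\<^sup>2))"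
      and "iexp (s * (0 + c * x)) = unit_exp (of_int k * x)"
      by (simp_all only: std_normal_density_def add_0 unit_exp_def cis_conv_exp minus_divide_left[symmetric])
    then show ?thesis
      by (simp only: h_def G_def scaleR_conv_of_real of_real_mult mult.assoc)
  qed
  have "integrable lborel (\<lambda>x. h (0 + c * x))"
    using c by (intro lborel_integrable_real_affine inth) auto
  then have "integrable lborel (\<lambda>x. sqrt (2 * pi) *\<^sub>R (1 / sqrt (2 * pi)) *\<^sub>R G x)"
    unfolding hc by (rule integrable_scaleR_right)
  then show intG: "integrable lborel G"
    by simp
  have "(LINT x|lborel. h x) = \<bar>c\<bar> *\<^sub>R (LINT x|lborel. h (0 + c * x))"
    using c by (intro lborel_integral_real_affine) auto
  also have "\<dots> = (c / sqrt (2 * pi)) *\<^sub>R (LINT x|lborel. G x)"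
    unfolding hc using c by simp
  also have "c / sqrt (2 * pi) = sqrt t"
    using t by (simp add: c_def real_sqrt_mult)
  finally show "(LINT x|lborel. G x) = of_real (exp (- (pi * (of_int k)\<^sup>2 / t)) / sqrt t)"
    using hI t by (simp add: scaleR_conv_of_real field_simps)
qed

section \<open>From sums over unit intervals to the integral over the line\<close>

lemma integral_sum_unit_intervals:
  fixes G :: "real \<Rightarrow> complex"
  assumes "continuous_on UNIV G"
  shows "(\<Sum>n\<in>{- int N..<int N}. integral {of_int n..of_int n + 1} G) = integral {- real N..real N} G"
proof (induction N)
  case (Suc N)
  have io: "G integrable_on {a..b}" for a b
    using assms continuous_on_subset by (intro integrable_continuous_real) blast
  have split: "{- int (Suc N)..<int (Suc N)} = insert (- int (Suc N)) (insert (int N) {- int N..<int N})"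
    by auto
  have e: "{of_int (- int (Suc N))..of_int (- int (Suc N)) + 1} = {- real (Suc N)..- real N}"
      "{of_int (int N)..of_int (int N) + 1} = {real N..real (Suc N)}"
    by simp_all
  have "(\<Sum>n\<in>{- int (Suc N)..<int (Suc N)}. integral {of_int n..of_int n + 1} G) =
      integral {- real (Suc N)..- real N} G + (integral {real N..real (Suc N)} G + integral {- real N..real N} G)"
    unfolding split by (subst sum.insert, simp, simp, subst sum.insert) (simp_all only: e Suc, simp_all)
  also have "integral {real N..real (Suc N)} G + integral {- real N..real N} G = integral {- real N..real (Suc N)} G"
    by (subst add.commute, rule Henstock_Kurzweil_Integration.integral_combine) (auto intro: io)
  also have "integral {- real (Suc N)..- real N} G + integral {- real N..real (Suc N)} G = integral {- real (Suc N)..real (Suc N)} G"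
    by (rule Henstock_Kurzweil_Integration.integral_combine) (auto intro: io)
  finally show ?case .
qed simp

lemma integral_symmetric_limit:
  fixes G :: "real \<Rightarrow> complex"
  assumes "integrable lborel G"
  shows "(\<lambda>N. integral {- real N..real N} G) \<longlonglongrightarrow> (LINT x|lborel. G x)"
proof -
  have "integral {- real N..real N} G = (LINT x|lborel. indicator {- real N..real N} x *\<^sub>R G x)" for N
  proof -
    have "set_integrable lborel {- real N..real N} G"
      using integrable_mult_indicator[OF _ assms, of "{- real N..real N}"]
      by (simp add: set_integrable_def)
    from set_borel_integral_eq_integral(2)[OF this] show ?thesis
      by (simp add: set_lebesgue_integral_def)
  qed
  moreover have "(\<lambda>N. LINT x|lborel. indicator {- real N..real N} x *\<^sub>R G x) \<longlonglongrightarrow> (LINT x|lborel. G x)"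
  proof (rule integral_dominated_convergence)
    show "integrable lborel (\<lambda>x. norm (G x))" using assms by (rule integrable_norm)
    show "AE x in lborel. (\<lambda>N. indicator {- real N..real N} x *\<^sub>R G x) \<longlonglongrightarrow> G x"
    proof (rule AE_I2)
      fix x :: real
      have "\<forall>\<^sub>F N in sequentially. \<bar>x\<bar> \<le> real N"
        using eventually_ge_at_top[of "nat \<lceil>\<bar>x\<bar>\<rceil>"] by eventually_elim linarith
      then have "\<forall>\<^sub>F N in sequentially. indicator {- real N..real N} x *\<^sub>R G x = G x"
        by eventually_elim (auto simp: indicator_def)
      then show "(\<lambda>N. indicator {- real N..real N} x *\<^sub>R G x) \<longlonglongrightarrow> G x"
        by (simp add: tendsto_eventually)
    qed
  qed (use assms in \<open>auto simp: indicator_def\<close>)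
  ultimately show ?thesis by simp
qed

text \<open>A limit over all finite sets of integers may be computed along these intervals. They are
  half-open because the unit intervals starting at -N, ..., N - 1 tile [-N, N].\<close>

lemma filterlim_symmetric_intervals:
  "filterlim (\<lambda>N. {- int N..<int N}) (finite_subsets_at_top UNIV) sequentially"
  unfolding filterlim_finite_subsets_at_top
proof (intro allI impI)
  fix X :: "int set" assume "finite X \<and> X \<subseteq> UNIV"
  then have "finite (abs ` X)" by blast
  then obtain B where B: "\<And>x. x \<in> X \<Longrightarrow> \<bar>x\<bar> \<le> B"
    by (metis bdd_above.unfold bdd_above_finite imageI)
  have "\<forall>\<^sub>F N in sequentially. nat B < N"
    by (rule eventually_gt_at_top)
  then show "\<forall>\<^sub>F N in sequentially. finite {- int N..<int N} \<and> X \<subseteq> {- int N..<int N} \<and> {- int N..<int N} \<subseteq> UNIV"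
  proof eventually_elim
    case (elim N)
    then show ?case using B by force
  qed
qed

text \<open>As functions of x both sides are continuous with period 1, so it is enough to compare
  their Fourier coefficients.\<close>

lemma theta_inversion_real:
  fixes t x :: real
  assumes t: "t > 0"
  shows "(\<Sum>\<^sub>\<infinity>n::int. complex_of_real (exp (- (pi * t * (of_int n + x)\<^sup>2)))) =
    (\<Sum>\<^sub>\<infinity>k::int. of_real (exp (- (pi * (of_int k)\<^sup>2 / t)) / sqrt t) * unit_exp (of_int k * x))"
proof -
  define P where "P = (\<lambda>x. \<Sum>\<^sub>\<infinity>n::int. complex_of_real (exp (- (pi * t * (of_int n + x)\<^sup>2))))"
  define a where "a = (\<lambda>k::int. complex_of_real (exp (- (pi * (of_int k)\<^sup>2 / t)) / sqrt t))"
  define Q where "Q = (\<lambda>x. \<Sum>\<^sub>\<infinity>k::int. a k * unit_exp (of_int k * x))"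
  have pt: "pi * t > 0" using t by simp
  have a: "(\<lambda>k. norm (a k)) summable_on UNIV"
  proof -
    have "(\<lambda>k::int. exp (- (pi / t * (of_int k + 0)\<^sup>2)) * (1 / sqrt t)) summable_on UNIV"
      using t by (intro summable_on_cmult_left summable_on_exp_neg_square) auto
    also have "(\<lambda>k::int. exp (- (pi / t * (of_int k + 0)\<^sup>2)) * (1 / sqrt t)) = (\<lambda>k. norm (a k))"
      using t by (auto simp: a_def norm_divide)
    finally show ?thesis .
  qed
  have contQ: "continuous_on UNIV Q"
    unfolding Q_def
    by (rule uniform_limit_theorem[OF _ uniform_limit_unit_exp_series[OF a]])
       (auto intro!: always_eventually continuous_intros)
  have perQ: "Q (x + 1) = Q x" for x
    unfolding Q_def by (simp add: ring_distribs unit_exp_add unit_exp_of_int)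
  \<comment> \<open>The majorant is uniform only for bounded x. Continuity of \<open>P\<close> is
    therefore proved near each point R; the instance R = 1 covers the interval of
    integration.\<close>
  have bound: "norm (complex_of_real (exp (- (pi * t * (of_int n + x)\<^sup>2)))) \<le>
      exp (pi * t * (1 + \<bar>R\<bar> + 1/4)) * exp (- (pi * t)) ^ nat \<bar>n\<bar>" if "x \<in> {R - 1..R + 1}" for n :: int and x R
  proof -
    have "\<bar>x\<bar> \<le> 1 + \<bar>R\<bar>" using that by auto
    from exp_neg_square_le[OF pt this] show ?thesis by simp
  qed
  have perP: "P (x + 1) = P x" for x
    unfolding P_def
    by (rule infsum_reindex_bij_witness[of _ "\<lambda>n. n - 1" "\<lambda>n. n + 1"]) (auto simp: add_ac)
  have contP: "continuous_on UNIV P"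
  proof -
    have "continuous_on {R - 1..R + 1} P" for R
    proof -
      have "uniform_limit {R - 1..R + 1} (\<lambda>X x. \<Sum>n\<in>X. complex_of_real (exp (- (pi * t * (of_int n + x)\<^sup>2)))) P (finite_subsets_at_top UNIV)"
        unfolding P_def
        by (rule Weierstrass_m_test_general[OF _ summable_on_exp_bound[OF pt]]) (use bound in blast)
      then show ?thesis
        by (rule uniform_limit_theorem[rotated]) (auto intro!: always_eventually continuous_intros)
    qed
    then have "isCont P R" for R
      by (rule continuous_on_interior[of "{R - 1..R + 1}"]) auto
    then show ?thesis by (simp add: continuous_at_imp_continuous_on)
  qed
  \<comment> \<open>Unfolding: the translates of [0,1] by integers fill the line, and the character
    is invariant under them, so the coefficient of the periodised Gaussian is its Fourier transform
    on the line.\<close>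
  have coeffP: "((\<lambda>x. P x * unit_exp (of_int j * x)) has_integral a j) {0..1}" for j
  proof -
    define G where "G = (\<lambda>x. of_real (exp (- (pi * t * x\<^sup>2))) * unit_exp (of_int j * x))"
    note gft = gaussian_fourier_transform[OF t, of j, folded G_def]
    have contG: "continuous_on A G" for A
      unfolding G_def by (intro continuous_intros)
    have sm: "(\<lambda>n::int. complex_of_real (exp (- (pi * t * (of_int n + x)\<^sup>2)))) summable_on UNIV" for x
      using summable_on_exp_neg_square[OF pt, of x] summable_on_of_real by blast
    have "uniform_limit {0..1} (\<lambda>X x. \<Sum>n\<in>X. complex_of_real (exp (- (pi * t * (of_int n + x)\<^sup>2))) * unit_exp (of_int j * x))
       (\<lambda>x. \<Sum>\<^sub>\<infinity>n. complex_of_real (exp (- (pi * t * (of_int n + x)\<^sup>2))) * unit_exp (of_int j * x)) (finite_subsets_at_top UNIV)"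
      by (rule Weierstrass_m_test_general[OF _ summable_on_exp_bound[OF pt, of "exp (pi * t * (1 + \<bar>1\<bar> + 1/4))"]])
         (use bound[of _ 1] in \<open>auto simp: norm_mult\<close>)
    then obtain I J where I: "\<And>X. ((\<lambda>x. \<Sum>n\<in>X. complex_of_real (exp (- (pi * t * (of_int n + x)\<^sup>2))) * unit_exp (of_int j * x)) has_integral I X) {0..1}"
     and J: "((\<lambda>x. \<Sum>\<^sub>\<infinity>n. complex_of_real (exp (- (pi * t * (of_int n + x)\<^sup>2))) * unit_exp (of_int j * x)) has_integral J) {0..1}"
     and lim: "(I \<longlongrightarrow> J) (finite_subsets_at_top UNIV)"
      by (rule uniform_limit_integral) (auto intro!: continuous_intros)
    have IX: "I X = (\<Sum>n\<in>X. integral {of_int n..of_int n + 1} G)" if "finite X" for X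
    proof (rule has_integral_unique[OF I], rule has_integral_sum[OF that])
      fix n :: int
      have "(G has_integral integral {of_int n..of_int n + 1} G) (cbox (of_int n) (of_int n + 1))"
        using contG by (simp add: integrable_continuous_real integrable_integral)
      from has_integral_affinity[OF this, of 1 "of_int n"]
      have "((\<lambda>x. G (x + of_int n)) has_integral integral {of_int n..of_int n + 1} G) ((\<lambda>x. x - of_int n) ` {of_int n..of_int n + 1})"
        by simp
      also have "(\<lambda>x. x - of_int n) ` {of_int n..of_int n + 1} = {0..1::real}"
        using image_diff_atLeastAtMost[of "of_int n :: real"] by (simp add: image_def) (force simp: algebra_simps)
      also have "(\<lambda>x. G (x + of_int n)) = (\<lambda>x. complex_of_real (exp (- (pi * t * (of_int n + x)\<^sup>2))) * unit_exp (of_int j * x))"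
      proof
        fix x :: real
        have "of_int j * (x + of_int n) = of_int j * x + of_int (j * n)"
          by (simp add: algebra_simps)
        then have "unit_exp (of_int j * (x + of_int n)) = unit_exp (of_int j * x)"
          by (metis unit_exp_add_of_int)
        then show "G (x + of_int n) = complex_of_real (exp (- (pi * t * (of_int n + x)\<^sup>2))) * unit_exp (of_int j * x)"
          unfolding G_def by (simp add: add_ac)
      qed
      finally show "((\<lambda>x. complex_of_real (exp (- (pi * t * (of_int n + x)\<^sup>2))) * unit_exp (of_int j * x)) has_integral integral {of_int n..of_int n + 1} G) {0..1}" .
    qed
    have "(\<lambda>N. I {- int N..<int N}) \<longlonglongrightarrow> J"
      by (rule filterlim_compose[OF lim filterlim_symmetric_intervals])
    also have "(\<lambda>N. I {- int N..<int N}) = (\<lambda>N. integral {- real N..real N} G)"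
      by (simp add: IX integral_sum_unit_intervals[OF contG])
    finally have "J = a j"
      using LIMSEQ_unique[OF _ integral_symmetric_limit[OF gft(1)]] gft(2) by (simp add: a_def)
    moreover have "(\<lambda>x. P x * unit_exp (of_int j * x)) = (\<lambda>x. \<Sum>\<^sub>\<infinity>n. complex_of_real (exp (- (pi * t * (of_int n + x)\<^sup>2))) * unit_exp (of_int j * x))"
      unfolding P_def by (simp add: infsum_cmult_left[OF sm])
    ultimately show ?thesis using J by simp
  qed
  have "P x - Q x = 0"
  proof (rule fourier_coefficients_zero[of "\<lambda>x. P x - Q x"])
    fix k :: int
    \<comment> \<open>The two coefficients are \<open>a k\<close> and \<open>a (- k)\<close>; they
      agree because \<open>a\<close> is even.\<close>
    have "((\<lambda>x. P x * unit_exp (of_int k * x) - Q x * unit_exp (of_int k * x)) has_integral (a k - a (- k))) {0..1}"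
      unfolding Q_def by (intro has_integral_diff coeffP fourier_coefficients_series a)
    then show "integral {0..1} (\<lambda>x. (P x - Q x) * unit_exp (of_int k * x)) = 0"
      by (simp add: ring_distribs a_def integral_unique)
  qed (auto intro!: continuous_intros contP contQ simp: perP perQ)
  then show ?thesis by (simp add: P_def Q_def a_def)
qed

section \<open>Theta series and their inversion\<close>

text \<open>The theta null value with characteristic r: r = 0 is Jacobi's theta_3 and r = 1/2 is
  theta_2.\<close>

definition theta :: "real \<Rightarrow> complex \<Rightarrow> complex" where
  "theta r \<tau> = (\<Sum>\<^sub>\<infinity>n::int. exp (pi * \<i> * (of_int n + r)\<^sup>2 * \<tau>))"

lemma norm_theta_term:
  "norm (exp (of_real pi * \<i> * (of_int n + of_real r)\<^sup>2 * \<tau>)) = exp (- (pi * Im \<tau> * (of_int n + r)\<^sup>2))"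
proof -
  have "of_real pi * \<i> * (of_int n + of_real r)\<^sup>2 * \<tau> = of_real (pi * (of_int n + r)\<^sup>2) * (\<i> * \<tau>)"
    by simp
  then show ?thesis by (simp only: norm_exp_eq_Re times_complex.simps Re_complex_of_real Im_complex_of_real) simp
qed

lemma theta_series_abs_summable:
  assumes "Im \<tau> > 0" "\<And>n. norm (c n) \<le> C"
  shows "(\<lambda>n::int. norm (c n * exp (of_real pi * \<i> * (of_int n + of_real r)\<^sup>2 * \<tau>))) summable_on UNIV"
proof (rule summable_on_comparison_test)
  show "(\<lambda>n::int. C * exp (- (pi * Im \<tau> * (of_int n + r)\<^sup>2))) summable_on UNIV"
    using assms by (intro summable_on_cmult_right summable_on_exp_neg_square) auto
  show "norm (c n * exp (of_real pi * \<i> * (of_int n + of_real r)\<^sup>2 * \<tau>)) \<le> C * exp (- (pi * Im \<tau> * (of_int n + r)\<^sup>2))" for n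
    unfolding norm_mult norm_theta_term using assms by (intro mult_right_mono) auto
qed auto

lemma theta_series_summable:
  assumes "Im \<tau> > 0" "\<And>n. norm (c n) \<le> C"
  shows "(\<lambda>n::int. c n * exp (of_real pi * \<i> * (of_int n + of_real r)\<^sup>2 * \<tau>)) summable_on UNIV"
  by (rule abs_summable_summable[OF theta_series_abs_summable[OF assms]])

text \<open>Sorting n by its residue s modulo M, the substitution M n + s turns (n + r)^2 into M^2
  (n + (s + r)/M)^2. Thus periodic coefficients never lead outside finite combinations of theta
  series.\<close>

lemma theta_series_split:
  assumes \<tau>: "Im \<tau> > 0" and M: "M > 0" and per: "\<And>n m. c (M * n + m) = c m"
  shows "(\<Sum>\<^sub>\<infinity>n::int. c n * exp (of_real pi * \<i> * (of_int n + of_real r)\<^sup>2 * \<tau>)) =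
    (\<Sum>s\<in>{0..<M}. c s * theta ((of_int s + r) / of_int M) ((of_int M)\<^sup>2 * \<tau>))"
proof -
  let ?f = "\<lambda>n::int. c n * exp (of_real pi * \<i> * (of_int n + of_real r)\<^sup>2 * \<tau>)"
  define C where "C = Max ((\<lambda>n. norm (c n)) ` {0..<M})"
  have "norm (c n) \<le> C" for n
  proof -
    have "c n = c (n mod M)"
      using per[of "n div M" "n mod M"] by simp
    then show ?thesis
      unfolding C_def using M by (auto intro!: Max_ge)
  qed
  then have sm: "?f summable_on UNIV"
    by (rule theta_series_summable[OF \<tau>])
  have parts: "infsum ?f (range (\<lambda>n. M * n + s)) = c s * theta ((of_int s + r) / of_int M) ((of_int M)\<^sup>2 * \<tau>)" for s
  proof -
    have "infsum ?f (range (\<lambda>n. M * n + s)) = (\<Sum>\<^sub>\<infinity>n. ?f (M * n + s))"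
      using M by (subst infsum_reindex) (auto simp: inj_on_def o_def)
    also have "\<dots> = (\<Sum>\<^sub>\<infinity>n::int. c s * exp (of_real pi * \<i> * (of_int n + of_real ((of_int s + r) / of_int M))\<^sup>2 * ((of_int M)\<^sup>2 * \<tau>)))"
    proof (rule infsum_cong)
      fix n
      have "(of_int n + of_real ((of_int s + r) / of_int M)) * of_int M = of_int (M * n + s) + complex_of_real r"
        using M by (simp add: field_simps)
      then have "(of_int n + of_real ((of_int s + r) / of_int M))\<^sup>2 * (of_int M)\<^sup>2 = (of_int (M * n + s) + complex_of_real r)\<^sup>2"
        by (metis power_mult_distrib)
      then show "?f (M * n + s) = c s * exp (of_real pi * \<i> * (of_int n + of_real ((of_int s + r) / of_int M))\<^sup>2 * ((of_int M)\<^sup>2 * \<tau>))"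
        unfolding per by (metis mult.assoc)
    qed
    also have "\<dots> = c s * theta ((of_int s + r) / of_int M) ((of_int M)\<^sup>2 * \<tau>)"
      unfolding theta_def by (rule infsum_cmult_right')
    finally show ?thesis .
  qed
  have "infsum ?f (\<Union>s\<in>{0..<M}. range (\<lambda>n. M * n + s)) = (\<Sum>s\<in>{0..<M}. infsum ?f (range (\<lambda>n. M * n + s)))"
  proof (rule sum_infsum[symmetric])
    fix s t assume st: "s \<in> {0..<M}" "t \<in> {0..<M}" "s \<noteq> t"
    show "range (\<lambda>n. M * n + s) \<inter> range (\<lambda>n. M * n + t) = {}"
    proof -
      have "(M * n + s) mod M = s" "(M * n + t) mod M = t" for n
        using st by auto
      then show ?thesis using st(3) by (metis (no_types, lifting) disjoint_iff imageE)
    qed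
  qed (auto intro: summable_on_subset_banach[OF sm])
  also have "(\<Union>s\<in>{0..<M}. range (\<lambda>n. M * n + s)) = UNIV"
  proof -
    have "n \<in> (\<Union>s\<in>{0..<M}. range (\<lambda>n. M * n + s))" for n
      using M by (intro UN_I[of "n mod M"] image_eqI[of _ _ "n div M"]) auto
    then show ?thesis by blast
  qed
  finally show ?thesis
    using parts by simp
qed

text \<open>For |w| <= R < 1 the growth condition on the exponents bounds the n-th term by R^(|n| -
  K), a summable majorant on each smaller disc.\<close>

lemma lacunary_series_holomorphic:
  fixes c :: "int \<Rightarrow> complex" and e :: "int \<Rightarrow> nat"
  assumes c: "\<And>n. norm (c n) \<le> 1" and e: "\<And>n. nat \<bar>n\<bar> \<le> e n + K"
  shows "(\<lambda>w. \<Sum>\<^sub>\<infinity>n. c n * w ^ e n) holomorphic_on ball 0 1"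
proof -
  have "(\<lambda>w. \<Sum>\<^sub>\<infinity>n. c n * w ^ e n) holomorphic_on ball 0 R" if R: "0 < R" "R < 1" for R
  proof (rule holomorphic_uniform_limit)
    show "uniform_limit (cball 0 R) (\<lambda>X w. \<Sum>n\<in>X. c n * w ^ e n) (\<lambda>w. \<Sum>\<^sub>\<infinity>n. c n * w ^ e n) (finite_subsets_at_top UNIV)"
    proof (rule Weierstrass_m_test_general)
      show "(\<lambda>n. (1 / R ^ K) * R ^ nat \<bar>n\<bar>) summable_on (UNIV :: int set)"
        using R by (intro summable_on_cmult_right summable_on_power_nat_abs) auto
      fix n w assume "w \<in> cball (0::complex) R"
      then have "norm (c n * w ^ e n) \<le> 1 * R ^ e n"
        unfolding norm_mult norm_power by (intro mult_mono c power_mono) auto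
      also have "R ^ (e n + K) \<le> R ^ nat \<bar>n\<bar>"
        using R e by (intro power_decreasing) auto
      then have "1 * R ^ e n \<le> (1 / R ^ K) * R ^ nat \<bar>n\<bar>"
        using R by (simp add: power_add field_simps)
      finally show "norm (c n * w ^ e n) \<le> (1 / R ^ K) * R ^ nat \<bar>n\<bar>" .
    qed
  qed (auto intro!: always_eventually continuous_intros holomorphic_intros)
  then have "(\<lambda>w. \<Sum>\<^sub>\<infinity>n. c n * w ^ e n) holomorphic_on (\<Union>R\<in>{0<..<1}. ball 0 R)"
    by (intro holomorphic_on_UN_open) auto
  moreover have "ball 0 1 \<subseteq> (\<Union>R\<in>{0<..<1}. ball (0::complex) R)"
  proof
    fix z :: complex assume "z \<in> ball 0 1"
    then have "(norm z + 1) / 2 \<in> {0<..<1}" "z \<in> ball 0 ((norm z + 1) / 2)"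
      by (auto simp: add_nonneg_pos)
    then show "z \<in> (\<Union>R\<in>{0<..<1}. ball (0::complex) R)" by blast
  qed
  ultimately show ?thesis by (rule holomorphic_on_subset)
qed

text \<open>For r = p/Q and \<alpha> = a/b the exponent is a (nQ + p)^2 times 2 pi i \<tau> / (2 b
  Q^2). Hence N = 2 b Q^2, and the exponents of the power series are the integers a (nQ + p)^2 >=
  |n| - |p|.\<close>

lemma theta_series_holomorphic_at_infinity:
  assumes r: "r \<in> \<rat>" and \<alpha>: "\<alpha> \<in> \<rat>" "\<alpha> > 0" and c: "\<And>n. norm (c n) \<le> 1"
  shows "holomorphic_at_infinity (\<lambda>\<tau>. \<Sum>\<^sub>\<infinity>n::int. c n * exp (of_real pi * \<i> * (of_int n + of_real r)\<^sup>2 * (of_real \<alpha> * \<tau>)))"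
proof -
  obtain p Q where r_eq: "Q > 0" "r = of_int p / of_int Q"
    using r by (cases rule: Rats_cases') auto
  obtain a b where \<alpha>_eq: "b > 0" "\<alpha> = of_int a / of_int b"
    using \<alpha> by (cases rule: Rats_cases') auto
  have a: "a > 0"
    using \<alpha>(2) \<alpha>_eq by (simp add: zero_less_divide_iff)
  define N where "N = nat (2 * b * Q\<^sup>2)"
  define e where "e = (\<lambda>n. nat (a * (n * Q + p)\<^sup>2))"
  have N: "N > 0" "of_nat N = (of_int (2 * b * Q\<^sup>2) :: complex)"
    using \<alpha>_eq r_eq unfolding N_def by (simp_all add: of_nat_nat)
  have e_eq: "of_nat (e n) = (of_int (a * (n * Q + p)\<^sup>2) :: complex)" for n
    using a unfolding e_def by (simp add: of_nat_nat)
  have "nat \<bar>n\<bar> \<le> e n + nat \<bar>p\<bar>" for n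
  proof -
    have "\<bar>n\<bar> * 1 \<le> \<bar>n\<bar> * \<bar>Q\<bar>"
      using r_eq by (intro mult_left_mono) auto
    then have "\<bar>n\<bar> - \<bar>p\<bar> \<le> \<bar>n * Q + p\<bar>"
      by (simp add: abs_mult[symmetric])
    also have "\<bar>n * Q + p\<bar> * 1 \<le> \<bar>n * Q + p\<bar> * \<bar>n * Q + p\<bar>"
    proof (cases "n * Q + p = 0")
      case False
      then have "1 \<le> \<bar>n * Q + p\<bar>" by linarith
      then show ?thesis by (intro mult_left_mono) auto
    qed simp
    then have "\<bar>n * Q + p\<bar> \<le> (n * Q + p)\<^sup>2"
      by (simp add: power2_eq_square)
    also have "1 * (n * Q + p)\<^sup>2 \<le> a * (n * Q + p)\<^sup>2"
      using a by (intro mult_right_mono) auto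
    finally show ?thesis by (simp add: e_def)
  qed
  note hol = lacunary_series_holomorphic[of c, OF c this]
  show ?thesis
    unfolding holomorphic_at_infinity_def
  proof (intro exI[of _ N] conjI exI[of _ "\<lambda>w. \<Sum>\<^sub>\<infinity>n. c n * w ^ e n"] ballI hol N(1))
    fix \<tau>
    have "exp (of_real pi * \<i> * (of_int n + of_real r)\<^sup>2 * (of_real \<alpha> * \<tau>)) = exp (2 * of_real pi * \<i> * \<tau> / of_nat N) ^ e n" for n
    proof -
      have nr: "complex_of_int n + of_real r = of_int (n * Q + p) / of_int Q"
        unfolding r_eq(2) using r_eq(1) by (simp add: field_simps)
      have "of_real pi * \<i> * (of_int n + of_real r)\<^sup>2 * (of_real \<alpha> * \<tau>) = of_nat (e n) * (2 * of_real pi * \<i> * \<tau> / of_nat N)"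
        unfolding N e_eq nr \<alpha>_eq(2) using r_eq(1) \<alpha>_eq(1)
        by (simp add: power_divide field_simps)
      then show ?thesis by (metis exp_of_nat_mult)
    qed
    then show "(\<Sum>\<^sub>\<infinity>n. c n * exp (of_real pi * \<i> * (of_int n + of_real r)\<^sup>2 * (of_real \<alpha> * \<tau>))) =
         (\<Sum>\<^sub>\<infinity>n. c n * exp (2 * of_real pi * \<i> * \<tau> / of_nat N) ^ e n)"
      by simp
  qed
qed

section \<open>Holomorphy on the upper half plane and continuation of the inversion formula\<close>

lemma norm_exp_upper_half_plane:
  assumes "\<tau> \<in> upper_half_plane" "N > 0"
  shows "exp (2 * of_real pi * \<i> * \<tau> / of_nat N) \<in> ball 0 1"
  using assms by (auto simp: upper_half_plane_def field_simps)

lemma holomorphic_at_infinity_imp_holomorphic: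
  assumes "holomorphic_at_infinity f"
  shows "f holomorphic_on upper_half_plane"
proof -
  obtain N g where N: "N > 0" and g: "g holomorphic_on ball 0 1"
    and f: "\<And>\<tau>. \<tau> \<in> upper_half_plane \<Longrightarrow> f \<tau> = g (exp (2 * of_real pi * \<i> * \<tau> / of_nat N))"
    using assms unfolding holomorphic_at_infinity_def by blast
  have "(g \<circ> (\<lambda>\<tau>. exp (2 * of_real pi * \<i> * \<tau> / of_nat N))) holomorphic_on upper_half_plane"
    by (rule holomorphic_on_compose_gen[OF _ g])
       (use N in \<open>auto intro!: holomorphic_intros norm_exp_upper_half_plane\<close>)
  then show ?thesis
    by (rule holomorphic_transform) (simp add: f)
qed

lemma open_upper_half_plane: "open upper_half_plane"
  unfolding upper_half_plane_def by (rule open_halfspace_Im_gt)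

lemma connected_upper_half_plane: "connected upper_half_plane"
  unfolding upper_half_plane_def by (intro convex_connected convex_halfspace_Im_gt)

lemma Im_neg_inverse: "Im \<tau> > 0 \<Longrightarrow> Im (- 1 / \<tau>) > 0"
  by (auto simp: Im_divide field_simps sum_power2_gt_zero_iff)

theorem theta_inversion:
  assumes r: "r \<in> \<rat>" and \<tau>: "Im \<tau> > 0"
  shows "theta r \<tau> * csqrt (- \<i> * \<tau>) =
    (\<Sum>\<^sub>\<infinity>k::int. unit_exp (of_int k * r) * exp (of_real pi * \<i> * (of_int k)\<^sup>2 * (- 1 / \<tau>)))"
proof -
  define dual where "dual = (\<lambda>\<tau>. \<Sum>\<^sub>\<infinity>k::int. unit_exp (of_int k * r) * exp (of_real pi * \<i> * (of_int k)\<^sup>2 * \<tau>))"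
  have hol1: "theta r holomorphic_on upper_half_plane"
    using holomorphic_at_infinity_imp_holomorphic[OF theta_series_holomorphic_at_infinity[OF r, of 1 "\<lambda>_. 1"]]
    unfolding theta_def[abs_def] by simp
  have hol2: "dual holomorphic_on upper_half_plane"
    using holomorphic_at_infinity_imp_holomorphic[OF theta_series_holomorphic_at_infinity[of 0 1 "\<lambda>k. unit_exp (of_int k * r)"]]
    unfolding dual_def by simp
  have "(dual \<circ> (\<lambda>\<tau>. - 1 / \<tau>)) holomorphic_on upper_half_plane"
    by (rule holomorphic_on_compose_gen[OF _ hol2])
       (auto intro!: holomorphic_intros simp: upper_half_plane_def Im_neg_inverse[simplified])
  then have hol3: "(\<lambda>\<tau>. dual (- 1 / \<tau>)) holomorphic_on upper_half_plane"
    by (simp add: o_def)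
  \<comment> \<open>The real part of \<open>- \<i> * \<tau>\<close> is Im \<tau> > 0, so the
    principal root is holomorphic here and equals the positive root on the imaginary axis.\<close>
  have nonneg: "- \<i> * \<tau> \<notin> \<real>\<^sub>\<le>\<^sub>0" if "\<tau> \<in> upper_half_plane" for \<tau>
    using that by (auto simp: upper_half_plane_def complex_nonpos_Reals_iff)
  have "theta r \<tau> * csqrt (- \<i> * \<tau>) - dual (- 1 / \<tau>) = 0"
  proof (rule analytic_continuation[where f = "\<lambda>\<tau>. theta r \<tau> * csqrt (- \<i> * \<tau>) - dual (- 1 / \<tau>)"
        and w = \<tau> and S = upper_half_plane and \<xi> = \<i> and U = "(\<lambda>t. \<i> * of_real t) ` {0<..}"])
    show "(\<lambda>\<tau>. theta r \<tau> * csqrt (- \<i> * \<tau>) - dual (- 1 / \<tau>)) holomorphic_on upper_half_plane"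
      by (intro holomorphic_intros hol1 hol3 nonneg)
    show "(\<lambda>t. \<i> * of_real t) ` {0<..} \<subseteq> upper_half_plane" "\<i> \<in> upper_half_plane" "\<tau> \<in> upper_half_plane"
      using \<tau> by (auto simp: upper_half_plane_def)
    show "\<i> islimpt (\<lambda>t. \<i> * of_real t) ` {0<..}"
      unfolding islimpt_approachable
    proof (intro allI impI)
      fix e :: real assume "e > 0"
      then show "\<exists>x'\<in>(\<lambda>t. \<i> * of_real t) ` {0<..}. x' \<noteq> \<i> \<and> dist x' \<i> < e"
        by (intro bexI[of _ "\<i> * of_real (1 + e/2)"])
           (auto simp: dist_norm algebra_simps norm_mult complex_eq_iff intro!: image_eqI[of _ _ "1 + e/2"])
    qed
    fix z assume "z \<in> (\<lambda>t. \<i> * of_real t) ` {0<..}"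
    then obtain t where t: "t > 0" "z = \<i> * of_real t" by auto
    have 1: "exp (of_real pi * \<i> * (of_int n + of_real r)\<^sup>2 * z) = of_real (exp (- (pi * t * (of_int n + r)\<^sup>2)))" for n :: int
      unfolding t by (simp add: exp_of_real[symmetric] algebra_simps)
    have 2: "exp (of_real pi * \<i> * (of_int k)\<^sup>2 * (- 1 / z)) = of_real (exp (- (pi * (of_int k)\<^sup>2 / t)))" for k :: int
      unfolding t by (simp add: exp_of_real[symmetric] algebra_simps)
    have "csqrt (- \<i> * z) = of_real (sqrt t)"
      using t by (simp add: algebra_simps)
    moreover have "theta r z = dual (- 1 / z) * (1 / of_real (sqrt t))"
      unfolding theta_def dual_def 1 2 theta_inversion_real[OF t(1)] infsum_cmult_left'[symmetric]
      by (simp add: mult_ac)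
    ultimately show "theta r z * csqrt (- \<i> * z) - dual (- 1 / z) = 0"
      using t by simp
  qed (auto simp: open_upper_half_plane connected_upper_half_plane)
  then show ?thesis by (simp add: dual_def)
qed

section \<open>Kronecker symbols and Gauss sums\<close>

lemma Legendre_values: "Legendre a p \<in> {- 1, 0, 1}"
  by (simp add: Legendre_def)

lemma Legendre_eq_0_iff: "Legendre a p = 0 \<longleftrightarrow> p dvd a"
  by (simp add: Legendre_def cong_0_iff)

lemma Legendre_cong:
  assumes "[a = b] (mod p)"
  shows "Legendre a p = Legendre b p"
proof -
  have "[a = 0] (mod p) \<longleftrightarrow> [b = 0] (mod p)" "QuadRes p a \<longleftrightarrow> QuadRes p b"
    unfolding QuadRes_def using assms by (metis cong_sym cong_trans)+
  then show ?thesis by (simp add: Legendre_def)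
qed

text \<open>Euler's criterion gives the congruence modulo p; both sides lie in {-1, 0, 1}, so they
  differ by at most 2 < p and must be equal.\<close>

lemma Legendre_mult:
  fixes p :: int
  assumes "prime p" "p > 2"
  shows "Legendre (a * b) p = Legendre a p * Legendre b p"
proof -
  obtain q where q: "p = int q" "prime q" "q > 2"
    using assms by (metis prime_int_nat_transfer nat_0_le prime_ge_0_int zless_nat_eq_int_zless of_nat_numeral)
  have "[Legendre (a * b) p = (a * b) ^ ((q - 1) div 2)] (mod p)"
    unfolding q by (rule euler_criterion[OF q(2,3)])
  also have "(a * b) ^ ((q - 1) div 2) = a ^ ((q - 1) div 2) * b ^ ((q - 1) div 2)"
    by (simp add: power_mult_distrib)
  also have "[\<dots> = Legendre a p * Legendre b p] (mod p)"
    unfolding q by (intro cong_mult cong_sym[OF euler_criterion[OF q(2,3)]])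
  finally have "p dvd Legendre (a * b) p - Legendre a p * Legendre b p"
    by (simp add: cong_iff_dvd_diff)
  moreover have "Legendre a p * Legendre b p \<in> {- 1, 0, 1}"
    using Legendre_values[of a p] Legendre_values[of b p] by auto
  then have "\<bar>Legendre (a * b) p - Legendre a p * Legendre b p\<bar> \<le> 2"
    using Legendre_values[of "a * b" p] by auto
  ultimately show ?thesis
    using assms(2) zdvd_imp_le[of p "\<bar>Legendre (a * b) p - Legendre a p * Legendre b p\<bar>"] by auto
qed

text \<open>Over the multiset of prime factors, multiplicativity in either argument becomes a
  property of products of multisets.\<close>

lemma kronecker_eq_prod_mset:
  assumes "n \<noteq> 0"
  shows "kronecker m n = (if n < 0 \<and> m < 0 then - 1 else 1) * prod_mset (image_mset (kronecker_prime m) (prime_factorization n))"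
  using assms by (simp add: kronecker_def image_prod_mset_multiplicity count_prime_factorization)
    (auto intro!: prod.cong simp: count_prime_factorization in_prime_factors_iff)

lemma kronecker_1_right [simp]: "kronecker m 1 = 1"
  by (simp add: kronecker_def)

lemma kronecker_mult_right:
  assumes "a \<noteq> 0" "b \<noteq> 0"
  shows "kronecker m (a * b) = kronecker m a * kronecker m b"
  using assms by (auto simp: kronecker_eq_prod_mset prime_factorization_mult mult_less_0_iff)

lemma kronecker_minus_right:
  assumes "n > 0"
  shows "kronecker m (- n) = (if m < 0 then - kronecker m n else kronecker m n)"
proof -
  have "prime_factorization (- n) = prime_factorization n"
    by (rule prime_factorization_cong) simp
  then show ?thesis using assms by (simp add: kronecker_eq_prod_mset)
qed

lemma kronecker_prime_right:
  assumes "prime p" "p > 2"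
  shows "kronecker m p = Legendre m p"
  using assms by (simp add: kronecker_eq_prod_mset prime_factorization_prime kronecker_prime_def)

lemma odd_prime_factor_gt_2:
  fixes n :: int
  assumes "odd n" "p \<in># prime_factorization n"
  shows "prime p" "p > 2"
proof -
  show "prime p" using assms(2) by blast
  have "p dvd n" using assms(2) by blast
  then have "p \<noteq> 2" using assms(1) by blast
  then show "p > 2" using prime_ge_2_int[OF \<open>prime p\<close>] by simp
qed

lemma kronecker_mult_left:
  assumes "odd n" "n > 0"
  shows "kronecker (a * b) n = kronecker a n * kronecker b n"
proof -
  have "image_mset (kronecker_prime (a * b)) (prime_factorization n) =
      image_mset (\<lambda>p. kronecker_prime a p * kronecker_prime b p) (prime_factorization n)"
    by (intro image_mset_cong)
       (use odd_prime_factor_gt_2[OF assms(1)] in \<open>auto simp: kronecker_prime_def Legendre_mult\<close>)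
  then show ?thesis
    using assms by (simp add: kronecker_eq_prod_mset prod_mset.distrib)
qed

lemma kronecker_1_left:
  assumes "odd n" "n > 0"
  shows "kronecker 1 n = 1"
proof -
  have "kronecker_prime 1 p = 1" if "p \<in># prime_factorization n" for p
  proof -
    have "\<not> p dvd 1" "QuadRes p 1"
      using odd_prime_factor_gt_2[OF assms(1) that] unfolding QuadRes_def
      by (auto intro!: exI[of _ 1])
    then show ?thesis
      using odd_prime_factor_gt_2[OF assms(1) that] by (simp add: kronecker_prime_def Legendre_def cong_0_iff)
  qed
  then have "image_mset (kronecker_prime 1) (prime_factorization n) = image_mset (\<lambda>_. 1) (prime_factorization n)"
    by (intro image_mset_cong) auto
  then show ?thesis
    using assms by (simp add: kronecker_eq_prod_mset)
qed

lemma kronecker_square: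
  assumes "odd n" "n > 0" "coprime m n"
  shows "kronecker m n * kronecker m n = 1"
proof -
  have *: "kronecker_prime m p * kronecker_prime m p = 1" if "p \<in># prime_factorization n" for p
  proof -
    note p = odd_prime_factor_gt_2[OF assms(1) that]
    have "\<not> p dvd m"
      using assms(3) that p by (metis coprime_common_divisor in_prime_factors_imp_dvd not_prime_unit)
    then have "Legendre m p \<noteq> 0" by (simp add: Legendre_eq_0_iff)
    then show ?thesis
      using p Legendre_values[of m p] by (auto simp: kronecker_prime_def)
  qed
  have "prod_mset (image_mset (\<lambda>p. kronecker_prime m p * kronecker_prime m p) (prime_factorization n)) =
      prod_mset (image_mset (\<lambda>_. 1) (prime_factorization n))"
    by (intro arg_cong[of _ _ prod_mset] image_mset_cong *)
  then show ?thesis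
    using assms by (simp add: kronecker_eq_prod_mset prod_mset.distrib)
qed

lemma kronecker_prod_left:
  assumes "odd n" "n > 0" "finite A"
  shows "kronecker (\<Prod>i\<in>A. f i) n = (\<Prod>i\<in>A. kronecker (f i) n)"
  using assms(3) by (induction rule: finite_induct) (simp_all add: kronecker_1_left kronecker_mult_left assms(1,2))

lemma kronecker_power_left:
  assumes "odd n" "n > 0"
  shows "kronecker (m ^ j) n = kronecker m n ^ j"
  by (induction j) (simp_all add: kronecker_1_left kronecker_mult_left assms)

section \<open>Exponential sums over residues and quadratic Gauss sums\<close>

lemma unit_exp_cong:
  assumes "[a = b] (mod D)"
  shows "unit_exp (of_int a / of_int D) = unit_exp (of_int b / of_int D)"
proof (cases "D = 0")
  case False
  obtain k where "a = b + D * k"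
    using assms by (metis cong_iff_lin cong_sym mult.commute)
  then have "of_int a / of_int D = of_int b / of_int D + (of_int k :: real)"
    using False by (simp add: field_simps)
  then show ?thesis by simp
qed simp

lemma sum_residues_affine:
  fixes f :: "int \<Rightarrow> 'a::comm_monoid_add"
  assumes D: "D > 0" and per: "\<And>x y. [x = y] (mod D) \<Longrightarrow> f x = f y" and cop: "coprime a D"
  shows "(\<Sum>x\<in>{0..<D}. f (a * x + b)) = (\<Sum>x\<in>{0..<D}. f x)"
proof -
  let ?g = "\<lambda>x. (a * x + b) mod D"
  have "inj_on ?g {0..<D}"
  proof (rule inj_onI)
    fix x y assume xy: "x \<in> {0..<D}" "y \<in> {0..<D}" "?g x = ?g y"
    then have "[a * x + b = a * y + b] (mod D)" by (simp add: cong_def)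
    then have "[a * x = a * y] (mod D)" by (simp add: cong_add_rcancel)
    then have "[x = y] (mod D)" using cop by (simp add: cong_mult_lcancel)
    then show "x = y" using xy by (simp add: cong_def)
  qed
  moreover have "?g ` {0..<D} \<subseteq> {0..<D}" using D by auto
  ultimately have bij: "bij_betw ?g {0..<D} {0..<D}"
    by (metis bij_betw_def endo_inj_surj finite_atLeastLessThan_int)
  have "(\<Sum>x\<in>{0..<D}. f (a * x + b)) = (\<Sum>x\<in>{0..<D}. f (?g x))"
    by (intro sum.cong refl per) (simp add: cong_def)
  also have "\<dots> = (\<Sum>x\<in>{0..<D}. f x)"
    by (rule sum.reindex_bij_betw[OF bij])
  finally show ?thesis .
qed

text \<open>The shift y to y + 1 multiplies the sum by \<open>unit_exp (c / D)\<close>, which is 1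
  only if D divides c.\<close>

lemma sum_unit_exp_residues:
  fixes D c :: int
  assumes D: "D > 0"
  shows "(\<Sum>y\<in>{0..<D}. unit_exp (of_int (c * y) / of_int D)) = (if D dvd c then of_int D else 0)"
proof (cases "D dvd c")
  case True
  then have "unit_exp (of_int (c * y) / of_int D) = 1" for y
    using unit_exp_cong[of "c * y" 0 D] by (simp add: cong_0_iff)
  then show ?thesis using True D by simp
next
  case False
  let ?S = "\<Sum>y\<in>{0..<D}. unit_exp (of_int (c * y) / of_int D)"
  have "?S = (\<Sum>y\<in>{0..<D}. unit_exp (of_int (c * (1 * y + 1)) / of_int D))"
    by (rule sum_residues_affine[symmetric, where f = "\<lambda>y. unit_exp (of_int (c * y) / of_int D)"])
       (fact D | (intro unit_exp_cong cong_mult cong_refl, assumption) | simp)+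
  also have "\<dots> = unit_exp (of_int c / of_int D) * ?S"
    unfolding sum_distrib_left unit_exp_add[symmetric]
    by (intro sum.cong refl arg_cong[of _ _ unit_exp]) (simp add: field_simps)
  finally have "(1 - unit_exp (of_int c / of_int D)) * ?S = 0"
    by (simp add: algebra_simps)
  moreover have "unit_exp (of_int c / of_int D) \<noteq> 1"
  proof
    assume "unit_exp (of_int c / of_int D) = 1"
    then have "unit_exp (of_int c / of_int D) = unit_exp 0" by simp
    then obtain n :: int where "of_int c / of_int D = (of_int n :: real)"
      unfolding unit_exp_eq_iff by auto
    then have "of_int c = (of_int (n * D) :: real)" using D by (simp add: field_simps)
    then have "c = n * D" by (simp only: of_int_eq_iff)
    with False show False by simp
  qed
  ultimately have "?S = 0" by simp
  then show ?thesis using False by simp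
qed

definition gauss_sum :: "int \<Rightarrow> int \<Rightarrow> complex" where
  "gauss_sum b D = (\<Sum>x\<in>{0..<D}. unit_exp (of_int (b * x\<^sup>2) / of_int D))"

lemma gauss_sum_1_right [simp]: "gauss_sum b 1 = 1"
proof -
  have "{0..<1::int} = {0}" by auto
  then show ?thesis by (simp add: gauss_sum_def)
qed

text \<open>Replacing x by x + y makes the phase b x^2 + 2 b x y, linear in y. The sum over y then
  kills every x except 0, because 2b is a unit modulo D.\<close>

lemma gauss_sum_norm_square:
  assumes D: "D > 0" "odd D" and b: "coprime b D"
  shows "gauss_sum b D * gauss_sum (- b) D = of_int D"
proof -
  have "gauss_sum b D * gauss_sum (- b) D =
      (\<Sum>y\<in>{0..<D}. \<Sum>x\<in>{0..<D}. unit_exp (of_int (b * x\<^sup>2 - b * y\<^sup>2) / of_int D))"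
    unfolding gauss_sum_def sum_product
    by (subst sum.swap) (intro sum.cong refl, simp add: unit_exp_add[symmetric] diff_divide_distrib)
  also have "\<dots> = (\<Sum>y\<in>{0..<D}. \<Sum>x\<in>{0..<D}. unit_exp (of_int (b * (1 * x + y)\<^sup>2 - b * y\<^sup>2) / of_int D))"
    by (intro sum.cong refl sum_residues_affine[symmetric, where f = "\<lambda>x. unit_exp (of_int (b * x\<^sup>2 - b * y\<^sup>2) / of_int D)" for y]
         unit_exp_cong cong_diff cong_mult cong_pow) (use D in auto)
  also have "\<dots> = (\<Sum>x\<in>{0..<D}. \<Sum>y\<in>{0..<D}. unit_exp (of_int (b * x\<^sup>2) / of_int D) * unit_exp (of_int ((2 * b * x) * y) / of_int D))"
    by (subst sum.swap, intro sum.cong refl, subst unit_exp_add[symmetric], rule arg_cong[of _ _ unit_exp])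
       (simp add: add_divide_distrib[symmetric] power2_eq_square algebra_simps)
  also have "\<dots> = (\<Sum>x\<in>{0..<D}. unit_exp (of_int (b * x\<^sup>2) / of_int D) * (if D dvd 2 * b * x then of_int D else 0))"
    unfolding sum_distrib_left[symmetric] sum_unit_exp_residues[OF D(1)] ..
  also have "\<dots> = (\<Sum>x\<in>{0..<D}. if x = 0 then of_int D else 0)"
  proof (intro sum.cong refl)
    fix x assume x: "x \<in> {0..<D}"
    have "D dvd 2 * b * x \<longleftrightarrow> D dvd x"
    proof -
      have "coprime D (2 * b)" using D b by (simp add: coprime_commute)
      then show ?thesis by (simp add: coprime_dvd_mult_right_iff)
    qed
    also have "\<dots> \<longleftrightarrow> x = 0" using x zdvd_imp_le[of D x] by (cases "x = 0") auto
    finally show "unit_exp (of_int (b * x\<^sup>2) / of_int D) * (if D dvd 2 * b * x then of_int D else 0) = (if x = 0 then of_int D else 0)"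
      by auto
  qed
  also have "\<dots> = of_int D" using D by simp
  finally show ?thesis .
qed

text \<open>Write the residues as x + pD y. The part of the phase that depends on y is 2 b x y / p
  up to an integer, so only multiples x = p z survive, each with weight p.\<close>

lemma gauss_sum_mult_square:
  assumes D: "D > 0" and p: "p > 0" "odd p" "coprime b p"
  shows "gauss_sum b (p\<^sup>2 * D) = of_int p * gauss_sum b D"
proof -
  let ?M = "p * D"
  have M: "?M > 0" using D p by simp
  have bij: "bij_betw (\<lambda>(x, y). x + ?M * y) ({0..<?M} \<times> {0..<p}) {0..<p\<^sup>2 * D}"
  proof (rule bij_betw_byWitness[where f' = "\<lambda>n. (n mod ?M, n div ?M)"])
    show "\<forall>a\<in>{0..<?M} \<times> {0..<p}. (case case a of (x, y) \<Rightarrow> x + ?M * y of n \<Rightarrow> (n mod ?M, n div ?M)) = a"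
      using D p by auto
    show "(\<lambda>(x, y). x + ?M * y) ` ({0..<?M} \<times> {0..<p}) \<subseteq> {0..<p\<^sup>2 * D}"
    proof (rule image_subsetI, clarify)
      fix x y assume xy: "x \<in> {0..<?M}" "y \<in> {0..<p}"
      have "x + ?M * y < ?M * (y + 1)" using xy by (simp add: algebra_simps)
      also have "\<dots> \<le> ?M * p" using xy M by (intro mult_left_mono) auto
      finally show "x + ?M * y \<in> {0..<p\<^sup>2 * D}"
        using xy M D p by (simp add: power2_eq_square mult_ac)
    qed
    show "(\<lambda>n. (n mod ?M, n div ?M)) ` {0..<p\<^sup>2 * D} \<subseteq> {0..<?M} \<times> {0..<p}"
    proof (rule image_subsetI)
      fix n assume n: "n \<in> {0..<p\<^sup>2 * D}"
      have "?M * (n div ?M) \<le> n"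
        using mult_div_mod_eq[of ?M n] pos_mod_sign[OF M, of n] by linarith
      also have "n < ?M * p" using n by (simp add: power2_eq_square mult_ac)
      finally have "n div ?M < p" by (simp only: mult_less_cancel_left_pos[OF M])
      then show "(n mod ?M, n div ?M) \<in> {0..<?M} \<times> {0..<p}"
        using n M by (auto simp: pos_imp_zdiv_nonneg_iff)
    qed
  qed auto
  have "gauss_sum b (p\<^sup>2 * D) = (\<Sum>(x, y)\<in>{0..<?M} \<times> {0..<p}. unit_exp (of_int (b * (x + ?M * y)\<^sup>2) / of_int (p\<^sup>2 * D)))"
    unfolding gauss_sum_def sum.reindex_bij_betw[OF bij, symmetric] by (simp add: case_prod_unfold)
  also have "\<dots> = (\<Sum>x\<in>{0..<?M}. \<Sum>y\<in>{0..<p}. unit_exp (of_int (b * x\<^sup>2) / of_int (p\<^sup>2 * D)) * unit_exp (of_int ((2 * b * x) * y) / of_int p))"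
    unfolding sum.cartesian_product[symmetric]
  proof (intro sum.cong refl)
    fix x y
    have "of_int (b * (x + ?M * y)\<^sup>2) / of_int (p\<^sup>2 * D) =
        (of_int (b * x\<^sup>2) / of_int (p\<^sup>2 * D) + of_int ((2 * b * x) * y) / of_int p) + (of_int (b * D * y\<^sup>2) :: real)"
      using D p by (simp add: field_simps power2_eq_square)
    then show "unit_exp (of_int (b * (x + ?M * y)\<^sup>2) / of_int (p\<^sup>2 * D)) = unit_exp (of_int (b * x\<^sup>2) / of_int (p\<^sup>2 * D)) * unit_exp (of_int ((2 * b * x) * y) / of_int p)"
      by (metis unit_exp_add unit_exp_add_of_int)
  qed
  also have "\<dots> = (\<Sum>x\<in>{0..<?M}. unit_exp (of_int (b * x\<^sup>2) / of_int (p\<^sup>2 * D)) * (if p dvd 2 * b * x then of_int p else 0))"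
    unfolding sum_distrib_left[symmetric] sum_unit_exp_residues[OF p(1)] ..
  also have "\<dots> = (\<Sum>x\<in>{0..<?M}. if p dvd x then of_int p * unit_exp (of_int (b * x\<^sup>2) / of_int (p\<^sup>2 * D)) else 0)"
  proof (intro sum.cong refl)
    fix x
    have "coprime p (2 * b)" using p by (simp add: coprime_commute)
    then have "p dvd 2 * b * x \<longleftrightarrow> p dvd x" by (simp add: coprime_dvd_mult_right_iff)
    then show "unit_exp (of_int (b * x\<^sup>2) / of_int (p\<^sup>2 * D)) * (if p dvd 2 * b * x then of_int p else 0) =
        (if p dvd x then of_int p * unit_exp (of_int (b * x\<^sup>2) / of_int (p\<^sup>2 * D)) else 0)"
      by simp
  qed
  also have "\<dots> = (\<Sum>x\<in>{x\<in>{0..<?M}. p dvd x}. of_int p * unit_exp (of_int (b * x\<^sup>2) / of_int (p\<^sup>2 * D)))"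
    by (simp only: sum.inter_filter[OF finite_atLeastLessThan_int])
  also have "\<dots> = (\<Sum>z\<in>{0..<D}. of_int p * unit_exp (of_int (b * (p * z)\<^sup>2) / of_int (p\<^sup>2 * D)))"
    by (rule sum.reindex_bij_witness[of _ "\<lambda>z. p * z" "\<lambda>x. x div p"])
       (use p D in \<open>auto simp: zero_le_mult_iff elim!: dvdE\<close>)
  also have "\<dots> = of_int p * gauss_sum b D"
    unfolding gauss_sum_def sum_distrib_left
    by (intro sum.cong refl arg_cong[of _ _ "\<lambda>z. of_int p * unit_exp z"]) (use p D in \<open>simp add: field_simps power2_eq_square\<close>)
  finally show ?thesis .
qed

text \<open>By the Chinese remainder theorem m y + n z runs through the residues modulo m n. The
  cross term of its square contributes the integer 2 b y z and drops out.\<close>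

lemma gauss_sum_mult_coprime:
  assumes m: "m > 0" and n: "n > 0" and cop: "coprime m n"
  shows "gauss_sum b (m * n) = gauss_sum (b * m) n * gauss_sum (b * n) m"
proof -
  let ?g = "\<lambda>(y, z). (m * y + n * z) mod (m * n)"
  have mn: "m * n > 0" using m n by simp
  have "inj_on ?g ({0..<n} \<times> {0..<m})"
  proof (rule inj_onI, clarify)
    fix y z y' z'
    assume yz: "y \<in> {0..<n}" "z \<in> {0..<m}" "y' \<in> {0..<n}" "z' \<in> {0..<m}"
      and "(m * y + n * z) mod (m * n) = (m * y' + n * z') mod (m * n)"
    then have c: "[m * y + n * z = m * y' + n * z'] (mod m * n)" by (simp add: cong_def)
    have "[m * y + n * z = m * y' + n * z'] (mod n)"
      using c by (metis cong_modulus_mult mult.commute)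
    then have "[m * y = m * y'] (mod n)" by (simp add: cong_def)
    then have "[y = y'] (mod n)" using cop by (simp add: cong_mult_lcancel)
    moreover have "[m * y + n * z = m * y' + n * z'] (mod m)"
      using c by (metis cong_modulus_mult)
    then have "[n * z = n * z'] (mod m)" by (simp add: cong_def)
    then have "[z = z'] (mod m)" using cop by (simp add: cong_mult_lcancel coprime_commute)
    ultimately show "y = y' \<and> z = z'" using yz by (simp add: cong_def)
  qed
  moreover have "?g ` ({0..<n} \<times> {0..<m}) \<subseteq> {0..<m * n}" using mn by auto
  moreover have "card ({0..<n} \<times> {0..<m}) = card {0..<m * n}"
    using m n by (simp add: card_cartesian_product nat_mult_distrib mult.commute)
  ultimately have bij: "bij_betw ?g ({0..<n} \<times> {0..<m}) {0..<m * n}"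
    by (simp add: bij_betw_def card_image card_subset_eq)
  have "gauss_sum b (m * n) = (\<Sum>(y, z)\<in>{0..<n} \<times> {0..<m}. unit_exp (of_int (b * ((m * y + n * z) mod (m * n))\<^sup>2) / of_int (m * n)))"
    unfolding gauss_sum_def sum.reindex_bij_betw[OF bij, symmetric] by (simp add: case_prod_unfold)
  also have "\<dots> = (\<Sum>y\<in>{0..<n}. \<Sum>z\<in>{0..<m}. unit_exp (of_int (b * m * y\<^sup>2) / of_int n) * unit_exp (of_int (b * n * z\<^sup>2) / of_int m))"
    unfolding sum.cartesian_product[symmetric]
  proof (intro sum.cong refl)
    fix y z
    have "unit_exp (of_int (b * ((m * y + n * z) mod (m * n))\<^sup>2) / of_int (m * n)) = unit_exp (of_int (b * (m * y + n * z)\<^sup>2) / of_int (m * n))"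
      by (intro unit_exp_cong cong_mult cong_pow) auto
    also have "of_int (b * (m * y + n * z)\<^sup>2) / of_int (m * n) =
        (of_int (b * m * y\<^sup>2) / of_int n + of_int (b * n * z\<^sup>2) / of_int m) + (of_int (2 * b * y * z) :: real)"
      using m n by (simp add: field_simps power2_eq_square)
    also have "unit_exp \<dots> = unit_exp (of_int (b * m * y\<^sup>2) / of_int n) * unit_exp (of_int (b * n * z\<^sup>2) / of_int m)"
      by (simp only: unit_exp_add unit_exp_of_int mult_1_right)
    finally show "unit_exp (of_int (b * ((m * y + n * z) mod (m * n))\<^sup>2) / of_int (m * n)) =
       unit_exp (of_int (b * m * y\<^sup>2) / of_int n) * unit_exp (of_int (b * n * z\<^sup>2) / of_int m)" .
  qed
  also have "\<dots> = gauss_sum (b * m) n * gauss_sum (b * n) m"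
    by (simp only: gauss_sum_def sum_product)
  finally show ?thesis .
qed

lemma card_square_roots:
  fixes p r :: int
  assumes p: "prime p" "p > 2" and r: "r \<in> {0..<p}"
  shows "int (card {x\<in>{0..<p}. x\<^sup>2 mod p = r}) = 1 + Legendre r p"
proof (cases "QuadRes p r")
  case False
  then have "{x\<in>{0..<p}. x\<^sup>2 mod p = r} = {}"
    using r by (auto simp: QuadRes_def cong_def)
  moreover have "r \<noteq> 0" using False unfolding QuadRes_def by (metis cong_refl zero_power2)
  then have "\<not> [r = 0] (mod p)" using r by (simp add: cong_def)
  then have "Legendre r p = - 1" using False by (simp add: Legendre_def)
  ultimately show ?thesis by (metis add.right_inverse card.empty of_nat_0)
next
  case True
  then obtain y where y: "[y\<^sup>2 = r] (mod p)" by (auto simp: QuadRes_def)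
  have roots: "{x\<in>{0..<p}. x\<^sup>2 mod p = r} = {y mod p, (- y) mod p}"
  proof (intro equalityI subsetI)
    fix x assume "x \<in> {x\<in>{0..<p}. x\<^sup>2 mod p = r}"
    then have x: "x \<in> {0..<p}" "[x\<^sup>2 = y\<^sup>2] (mod p)" using y r by (auto simp: cong_def)
    then have "p dvd (x - y) * (x + y)"
      by (simp add: cong_iff_dvd_diff power2_eq_square algebra_simps)
    then have "p dvd x - y \<or> p dvd x - (- y)"
      using p by (simp add: prime_dvd_mult_iff)
    then have "[x = y] (mod p) \<or> [x = - y] (mod p)"
      by (simp only: cong_iff_dvd_diff)
    then show "x \<in> {y mod p, (- y) mod p}" using x by (auto simp: cong_def)
  next
    fix x assume "x \<in> {y mod p, (- y) mod p}"
    then have "x \<in> {0..<p}" "[x = y] (mod p) \<or> [x = - y] (mod p)"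
      using p by (auto simp: cong_def)
    then have "[x\<^sup>2 = y\<^sup>2] (mod p)" by (metis cong_pow power2_minus)
    then show "x \<in> {x\<in>{0..<p}. x\<^sup>2 mod p = r}"
      using \<open>x \<in> {0..<p}\<close> y r by (auto simp: cong_def)
  qed
  show ?thesis
  proof (cases "r = 0")
    case True
    then have "p dvd y" using y p by (simp add: cong_0_iff prime_dvd_power_iff)
    then have "y mod p = 0" "(- y) mod p = 0" by auto
    then show ?thesis unfolding roots using True by (simp add: Legendre_def)
  next
    case r0: False
    then have r0': "\<not> [r = 0] (mod p)" using r by (simp add: cong_def)
    have "y mod p \<noteq> (- y) mod p"
    proof
      assume "y mod p = (- y) mod p"
      then have "p dvd 2 * y" by (simp add: mod_eq_dvd_iff)
      then have "p dvd y" using p by (auto simp: prime_dvd_mult_iff dest: zdvd_imp_le)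
      then have "[y\<^sup>2 = 0] (mod p)" by (simp add: cong_0_iff power2_eq_square)
      with y r0' show False using cong_sym cong_trans by blast
    qed
    then show ?thesis unfolding roots using True r0' by (simp add: Legendre_def)
  qed
qed

text \<open>A residue r has 1 + (r/p) square roots and the plain character sum vanishes, which
  leaves the sum of (r/p) against characters; the substitution r to b r then extracts (b/p).\<close>

lemma gauss_sum_prime:
  assumes p: "prime p" "p > 2" and b: "coprime b p"
  shows "gauss_sum b p = of_int (Legendre b p) * gauss_sum 1 p"
proof -
  have p0: "p > 0" using p by simp
  have "\<not> p dvd b"
    using p b by (metis coprime_common_divisor dvd_refl not_prime_unit)
  then have Lb: "Legendre b p * Legendre b p = 1"
    using Legendre_values[of b p] Legendre_eq_0_iff[of b p] by auto
  have char: "gauss_sum c p = (\<Sum>r\<in>{0..<p}. of_int (Legendre r p) * unit_exp (of_int (c * r) / of_int p))"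
    if c: "\<not> p dvd c" for c
  proof -
    have "gauss_sum c p = (\<Sum>x\<in>{0..<p}. unit_exp (of_int (c * (x\<^sup>2 mod p)) / of_int p))"
      unfolding gauss_sum_def by (intro sum.cong refl unit_exp_cong cong_mult) (auto simp: cong_def)
    also have "\<dots> = (\<Sum>r\<in>{0..<p}. \<Sum>x\<in>{x\<in>{0..<p}. x\<^sup>2 mod p = r}. unit_exp (of_int (c * (x\<^sup>2 mod p)) / of_int p))"
      by (rule sum.group[symmetric]) (use p0 in auto)
    also have "\<dots> = (\<Sum>r\<in>{0..<p}. of_int (int (card {x\<in>{0..<p}. x\<^sup>2 mod p = r})) * unit_exp (of_int (c * r) / of_int p))"
      by (intro sum.cong refl) simp
    also have "\<dots> = (\<Sum>r\<in>{0..<p}. unit_exp (of_int (c * r) / of_int p) + of_int (Legendre r p) * unit_exp (of_int (c * r) / of_int p))"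
      by (intro sum.cong refl) (subst card_square_roots[OF p], simp_all add: ring_distribs)
    also have "\<dots> = (\<Sum>r\<in>{0..<p}. of_int (Legendre r p) * unit_exp (of_int (c * r) / of_int p))"
      unfolding sum.distrib sum_unit_exp_residues[OF p0] using c by simp
    finally show ?thesis .
  qed
  have "of_int (Legendre b p) * gauss_sum b p = (\<Sum>r\<in>{0..<p}. of_int (Legendre (b * r + 0) p) * unit_exp (of_int (1 * (b * r + 0)) / of_int p))"
    unfolding char[OF \<open>\<not> p dvd b\<close>] sum_distrib_left by (simp add: Legendre_mult[OF p] mult_ac)
  also have "\<dots> = (\<Sum>r\<in>{0..<p}. of_int (Legendre r p) * unit_exp (of_int (1 * r) / of_int p))"
    by (rule sum_residues_affine[OF p0 _ b, where f = "\<lambda>r. of_int (Legendre r p) * unit_exp (of_int (1 * r) / of_int p)"])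
       (auto intro!: arg_cong2[of _ _ _ _ "(*)"] unit_exp_cong Legendre_cong)
  also have "\<dots> = gauss_sum 1 p"
    using p by (subst char) auto
  finally have "of_int (Legendre b p * Legendre b p) * gauss_sum b p = of_int (Legendre b p) * gauss_sum 1 p"
    by simp
  then show ?thesis by (simp add: Lb)
qed

text \<open>Induction on D by removing a prime p. If p^2 divides D, both copies go and the symbol
  changes by the square (b/p)^2 = 1. Otherwise the sum factors as G(bp, D') G(bD', p), and since the
  formula is relative to G(1, D), the factors G(p, D') and G(D', p) are common to both
  sides.\<close>

lemma gauss_sum_eq_kronecker:
  assumes "odd D" "D > 0" "coprime b D"
  shows "gauss_sum b D = of_int (kronecker b D) * gauss_sum 1 D"
  using assms
proof (induction "nat D" arbitrary: D b rule: less_induct)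
  case less
  show ?case
  proof (cases "D = 1")
    case False
    with less.prems have "D \<noteq> 0" "\<not> is_unit D" by auto
    then obtain p where p: "prime p" "p dvd D" using prime_divisor_exists by blast
    then have "p \<noteq> 2" using less.prems by blast
    with p have p2: "p > 2" using prime_ge_2_int[of p] by simp
    have oddp: "odd p" using p(2) less.prems(1) by (metis dvd_trans)
    obtain D' where D: "D = p * D'" using p(2) by (elim dvdE)
    have D': "D' > 0" "odd D'" "coprime b D'" "coprime b p"
      using less.prems D p2 by (auto simp: zero_less_mult_iff)
    have ltD: "D' < D" unfolding D using p2 D' by simp
    show ?thesis
    proof (cases "p dvd D'")
      case True
      then obtain E where E: "D' = p * E" by (elim dvdE)
      have DE: "D = p\<^sup>2 * E" by (simp add: D E power2_eq_square)
      have E': "E > 0" "odd E" "coprime b E"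
        using D' E p2 by (auto simp: zero_less_mult_iff)
      have "E < D'" unfolding E using p2 E' by simp
      then have "gauss_sum b E = of_int (kronecker b E) * gauss_sum 1 E"
        using less.hyps[of E b] E' ltD by auto
      moreover have "kronecker b D = kronecker b E"
      proof -
        have "kronecker b D = kronecker b p * kronecker b p * kronecker b E"
          unfolding DE power2_eq_square using p2 E' by (simp add: kronecker_mult_right)
        then show ?thesis using kronecker_square[of p b] oddp p2 D' by simp
      qed
      ultimately show ?thesis
        unfolding DE using p2 oddp E' D' by (simp add: gauss_sum_mult_square)
    next
      case False
      then have cop: "coprime p D'" using p(1) by (simp add: prime_imp_coprime)
      have IH: "gauss_sum c D' = of_int (kronecker c D') * gauss_sum 1 D'" if "coprime c D'" for c
        using less.hyps[of D' c] ltD D' that by auto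
      have "gauss_sum (b * p) D' = of_int (kronecker b D') * gauss_sum p D'"
        using IH[of "b * p"] IH[of p] cop D' by (simp add: kronecker_mult_left)
      moreover have "gauss_sum (b * D') p = of_int (Legendre b p) * gauss_sum D' p"
        using gauss_sum_prime[OF p(1) p2, of "b * D'"] gauss_sum_prime[OF p(1) p2, of D'] cop D'
        by (simp add: Legendre_mult[OF p(1) p2] coprime_commute)
      moreover have "kronecker b D = Legendre b p * kronecker b D'"
        unfolding D using D' p2 by (simp add: kronecker_mult_right kronecker_prime_right[OF p(1)])
      ultimately show ?thesis
        unfolding D using p2 D' cop gauss_sum_mult_coprime[of p D' b] gauss_sum_mult_coprime[of p D' 1]
        by simp
    qed
  qed (simp_all add: kronecker_eq_prod_mset)
qed

text \<open>G(1, D) G(-1, D) = D, and G(-1, D) differs from G(1, D) by the symbol (-1 / D).\<close>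

lemma gauss_sum_1_square:
  assumes "odd D" "D > 0"
  shows "(gauss_sum 1 D)\<^sup>2 = of_int (kronecker (- 1) D * D)"
proof -
  have "gauss_sum 1 D * (of_int (kronecker (- 1) D) * gauss_sum 1 D) = of_int D"
    using gauss_sum_norm_square[of D 1] gauss_sum_eq_kronecker[of D "- 1"] assms by simp
  then have "of_int (kronecker (- 1) D * kronecker (- 1) D) * (gauss_sum 1 D)\<^sup>2 = of_int (kronecker (- 1) D * D)"
    by (simp add: power2_eq_square mult_ac)
  then show ?thesis
    using kronecker_square[of D "- 1"] assms by simp
qed

section \<open>Polynomials in theta series\<close>

lemma csqrt_of_real_mult:
  assumes "r \<ge> 0"
  shows "csqrt (of_real r * z) = of_real (sqrt r) * csqrt z"
proof (cases "r = 0")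
  case False
  show ?thesis
  proof (rule csqrt_unique)
    show "(of_real (sqrt r) * csqrt z)\<^sup>2 = of_real r * z"
      using assms by (simp add: power_mult_distrib of_real_power[symmetric] del: of_real_power)
    show "0 < Re (of_real (sqrt r) * csqrt z) \<or> Re (of_real (sqrt r) * csqrt z) = 0 \<and> 0 \<le> Im (of_real (sqrt r) * csqrt z)"
      using csqrt_principal[of z] assms False by auto
  qed
qed simp

lemma Re_inverse_pos: "Re w > 0 \<Longrightarrow> Re (inverse w) > 0"
  by (auto intro!: divide_pos_pos add_pos_nonneg)

text \<open>False on the negative axis. For Re z > 0 the root has positive real part, inversion
  preserves the right half plane, and so the inverse is again the principal root.\<close>

lemma csqrt_inverse:
  assumes "Re z > 0"
  shows "csqrt (inverse z) = inverse (csqrt z)"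
proof (rule csqrt_unique)
  show "(inverse (csqrt z))\<^sup>2 = inverse z"
    by (simp add: power_inverse)
  have "Re (csqrt z) \<noteq> 0"
  proof
    assume "Re (csqrt z) = 0"
    then have "Re ((csqrt z)\<^sup>2) \<le> 0" by (simp add: power2_eq_square)
    then show False using assms by simp
  qed
  then have "Re (csqrt z) > 0" using csqrt_principal[of z] by auto
  then show "0 < Re (inverse (csqrt z)) \<or> Re (inverse (csqrt z)) = 0 \<and> 0 \<le> Im (inverse (csqrt z))"
    using Re_inverse_pos by blast
qed

lemma csqrt_neg_ii_nonzero: "Im \<tau> > 0 \<Longrightarrow> csqrt (- \<i> * \<tau>) \<noteq> 0"
  by auto

lemma theta_neg_inverse:
  assumes "r \<in> \<rat>" "Im \<sigma> > 0"
  shows "theta r (- 1 / \<sigma>) = csqrt (- \<i> * \<sigma>) *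
    (\<Sum>\<^sub>\<infinity>k::int. unit_exp (of_int k * r) * exp (of_real pi * \<i> * (of_int k)\<^sup>2 * \<sigma>))"
proof -
  have "- \<i> * (- 1 / \<sigma>) = inverse (- \<i> * \<sigma>)"
    by (rule inverse_unique[symmetric]) (use assms(2) in auto)
  then have "csqrt (- \<i> * (- 1 / \<sigma>)) = inverse (csqrt (- \<i> * \<sigma>))"
    using csqrt_inverse[of "- \<i> * \<sigma>"] assms(2) by simp
  moreover have "- 1 / (- 1 / \<sigma>) = \<sigma>" by simp
  ultimately show ?thesis
    using theta_inversion[OF assms(1) Im_neg_inverse[OF assms(2)]] csqrt_neg_ii_nonzero[OF assms(2)]
    by (simp add: field_simps)
qed

lemma theta_neg_inverse_sum:
  assumes Q: "Q > 0" and r: "r = of_int p / of_int Q" and \<sigma>: "Im \<sigma> > 0"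
  shows "theta r (- 1 / \<sigma>) = csqrt (- \<i> * \<sigma>) *
    (\<Sum>s\<in>{0..<Q}. unit_exp (of_int s * r) * theta (of_int s / of_int Q) ((of_int Q)\<^sup>2 * \<sigma>))"
proof -
  have "unit_exp (of_int (Q * n + m) * r) = unit_exp (of_int m * r)" for n m
  proof -
    have "of_int (Q * n + m) * r = of_int m * r + of_int (n * p)"
      unfolding r using Q by (simp add: field_simps)
    then show ?thesis by (metis unit_exp_add_of_int)
  qed
  then have "(\<Sum>\<^sub>\<infinity>k::int. unit_exp (of_int k * r) * exp (of_real pi * \<i> * (of_int k + of_real 0)\<^sup>2 * \<sigma>)) =
     (\<Sum>s\<in>{0..<Q}. unit_exp (of_int s * r) * theta ((of_int s + 0) / of_int Q) ((of_int Q)\<^sup>2 * \<sigma>))"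
    by (rule theta_series_split[OF \<sigma> Q])
  moreover have "r \<in> \<rat>" unfolding r by simp
  ultimately show ?thesis
    using theta_neg_inverse[of r \<sigma>] \<sigma> by simp
qed

lemma theta_translate:
  fixes j :: int
  assumes r: "r \<in> \<rat>" and \<alpha>: "\<alpha> \<in> \<rat>" "\<alpha> > 0"
  obtains M c where "M > 0"
    "\<And>\<tau>. Im \<tau> > 0 \<Longrightarrow> theta r (of_real \<alpha> * (\<tau> + of_int j)) =
       (\<Sum>s\<in>{0..<M}. c s * theta ((of_int s + r) / of_int M) (of_real ((of_int M)\<^sup>2 * \<alpha>) * \<tau>))"
proof -
  obtain p Q where r_eq: "Q > 0" "r = of_int p / of_int Q"
    using r by (cases rule: Rats_cases') auto
  obtain a b where \<alpha>_eq: "b > 0" "\<alpha> = of_int a / of_int b"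
    using \<alpha> by (cases rule: Rats_cases') auto
  \<comment> \<open>Translation multiplies the n-th term by
    \<open>unit_exp (\<alpha> * j * (n + r)^2 / 2)\<close>. Passing from n to n + M k adds a j k
    (2nQ + 2p + MkQ) inside, an integer, for this choice of M.\<close>
  define M where "M = 2 * b * Q"
  define c where "c = (\<lambda>n::int. unit_exp (\<alpha> * of_int j * (of_int n + r)\<^sup>2 / 2))"
  have M: "M > 0" using r_eq \<alpha>_eq by (simp add: M_def)
  have per: "c (M * k + n) = c n" for k n
  proof -
    have "\<alpha> * of_int j * (of_int (M * k + n) + r)\<^sup>2 / 2 =
        \<alpha> * of_int j * (of_int n + r)\<^sup>2 / 2 + of_int (j * a * k * (2 * n * Q + 2 * p + M * k * Q))"
      unfolding r_eq(2) \<alpha>_eq(2) M_def using r_eq(1) \<alpha>_eq(1)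
      by (simp add: field_simps power2_eq_square)
    then show ?thesis unfolding c_def by (metis unit_exp_add_of_int)
  qed
  show ?thesis
  proof (rule that[OF M, of c])
    fix \<tau> :: complex assume \<tau>: "Im \<tau> > 0"
    have "theta r (of_real \<alpha> * (\<tau> + of_int j)) =
        (\<Sum>\<^sub>\<infinity>n::int. c n * exp (of_real pi * \<i> * (of_int n + of_real r)\<^sup>2 * (of_real \<alpha> * \<tau>)))"
      unfolding theta_def c_def unit_exp_eq_exp exp_add[symmetric]
      by (intro infsum_cong arg_cong[of _ _ exp]) (simp add: field_simps)
    also have "\<dots> = (\<Sum>s\<in>{0..<M}. c s * theta ((of_int s + r) / of_int M) ((of_int M)\<^sup>2 * (of_real \<alpha> * \<tau>)))"
      using \<tau> \<alpha> by (intro theta_series_split per M) auto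
    finally show "theta r (of_real \<alpha> * (\<tau> + of_int j)) =
       (\<Sum>s\<in>{0..<M}. c s * theta ((of_int s + r) / of_int M) (of_real ((of_int M)\<^sup>2 * \<alpha>) * \<tau>))"
      by (simp add: mult_ac)
  qed
qed

text \<open>Homogeneous polynomials of degree m in theta values with rational characteristics and
  positive rational scales. Homogeneity gives all terms the same factor
  \<open>csqrt (- \<i> * \<tau>) ^ m\<close> under inversion; \<open>cong\<close> is included
  because theta identities hold on the upper half plane only.\<close>

inductive theta_poly :: "nat \<Rightarrow> (complex \<Rightarrow> complex) \<Rightarrow> bool" where
  const: "theta_poly 0 (\<lambda>_. c)"
| mult: "theta_poly m f \<Longrightarrow> r \<in> \<rat> \<Longrightarrow> \<alpha> \<in> \<rat> \<Longrightarrow> \<alpha> > 0 \<Longrightarrow> theta_poly (Suc m) (\<lambda>\<tau>. theta r (of_real \<alpha> * \<tau>) * f \<tau>)"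
| add: "theta_poly m f \<Longrightarrow> theta_poly m g \<Longrightarrow> theta_poly m (\<lambda>\<tau>. f \<tau> + g \<tau>)"
| cong: "theta_poly m f \<Longrightarrow> (\<And>\<tau>. \<tau> \<in> upper_half_plane \<Longrightarrow> g \<tau> = f \<tau>) \<Longrightarrow> theta_poly m g"

lemma theta_poly_cmult: "theta_poly m f \<Longrightarrow> theta_poly m (\<lambda>\<tau>. k * f \<tau>)"
proof (induction rule: theta_poly.induct)
  case (mult m f r \<alpha>)
  then show ?case using theta_poly.mult[OF mult.IH mult.hyps(2-4)] by (simp add: mult.left_commute)
next
  case (add m f g)
  then show ?case using theta_poly.add[OF add.IH] by (simp add: ring_distribs)
next
  case (cong m f g)
  then show ?case by (auto intro: theta_poly.cong)
qed (rule theta_poly.const)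

text \<open>\<open>f0\<close> shows that degree m is inhabited: the empty sum is obtained as 0 times
  \<open>f0\<close>, constants themselves having degree 0.\<close>

lemma theta_poly_sum:
  assumes "finite A" "theta_poly m f0" "\<And>s. s \<in> A \<Longrightarrow> theta_poly m (f s)"
  shows "theta_poly m (\<lambda>\<tau>. \<Sum>s\<in>A. f s \<tau>)"
  using assms(1,3)
proof (induction rule: finite_induct)
  case empty
  then show ?case using theta_poly_cmult[OF assms(2), of 0] by simp
qed (simp add: theta_poly.add)

lemma theta_poly_mult_sum:
  assumes "theta_poly m f" "finite A"
    and "\<And>s. s \<in> A \<Longrightarrow> r s \<in> \<rat>" "\<And>s. s \<in> A \<Longrightarrow> \<alpha> s \<in> \<rat>" "\<And>s. s \<in> A \<Longrightarrow> \<alpha> s > 0"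
  shows "theta_poly (Suc m) (\<lambda>\<tau>. (\<Sum>s\<in>A. k s * theta (r s) (of_real (\<alpha> s) * \<tau>)) * f \<tau>)"
proof -
  have "theta_poly (Suc m) (\<lambda>\<tau>. \<Sum>s\<in>A. k s * (theta (r s) (of_real (\<alpha> s) * \<tau>) * f \<tau>))"
    using assms by (intro theta_poly_sum[OF assms(2) theta_poly.mult[OF assms(1), of 0 1]] theta_poly_cmult theta_poly.mult) auto
  then show ?thesis by (simp add: sum_distrib_right mult.assoc)
qed

lemma theta_poly_times:
  assumes "theta_poly m f" "theta_poly n g"
  shows "theta_poly (m + n) (\<lambda>\<tau>. f \<tau> * g \<tau>)"
  using assms(1)
proof (induction rule: theta_poly.induct)
  case (const c)
  then show ?case using theta_poly_cmult[OF assms(2)] by simp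
next
  case (mult m f r \<alpha>)
  then show ?case using theta_poly.mult[OF mult.IH, of r \<alpha>] by (simp add: mult.assoc)
next
  case (add m f h)
  then show ?case using theta_poly.add[OF add.IH] by (simp add: ring_distribs)
next
  case (cong m f h)
  then show ?case by (intro theta_poly.cong[OF cong.IH]) auto
qed

lemma theta_poly_theta: "r \<in> \<rat> \<Longrightarrow> \<alpha> \<in> \<rat> \<Longrightarrow> \<alpha> > 0 \<Longrightarrow> theta_poly 1 (\<lambda>\<tau>. theta r (of_real \<alpha> * \<tau>))"
  using theta_poly.mult[OF theta_poly.const[of 1]] by simp

lemma theta_poly_prod:
  assumes "finite A" "\<And>i. i \<in> A \<Longrightarrow> theta_poly m (f i)"
  shows "theta_poly (card A * m) (\<lambda>\<tau>. \<Prod>i\<in>A. f i \<tau>)"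
  using assms
proof (induction rule: finite_induct)
  case empty
  then show ?case using theta_poly.const[of 1] by simp
next
  case (insert x A)
  then show ?case using theta_poly_times[of m "f x" "card A * m"] by simp
qed

section \<open>Holomorphy at infinity and stability under translation and inversion\<close>

lemma holomorphic_at_infinity_cong:
  assumes "holomorphic_at_infinity f" "\<And>\<tau>. \<tau> \<in> upper_half_plane \<Longrightarrow> g \<tau> = f \<tau>"
  shows "holomorphic_at_infinity g"
  using assms unfolding holomorphic_at_infinity_def by metis

lemma holomorphic_at_infinity_const: "holomorphic_at_infinity (\<lambda>_. c)"
  unfolding holomorphic_at_infinity_def by (intro exI[of _ 1] conjI exI[of _ "\<lambda>_. c"]) auto

lemma holomorphic_at_infinity_rescale:
  assumes g: "g holomorphic_on ball 0 1" and M: "M > 0"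
  shows "(\<lambda>w. g (w ^ M)) holomorphic_on ball (0::complex) 1"
    and "exp (2 * of_real pi * \<i> * \<tau> / of_nat N) = exp (2 * of_real pi * \<i> * \<tau> / of_nat (N * M)) ^ M"
proof -
  have "(g \<circ> (\<lambda>w. w ^ M)) holomorphic_on ball 0 1"
    by (rule holomorphic_on_compose_gen[OF _ g])
       (use M in \<open>auto intro!: holomorphic_intros simp: norm_power power_less_one_iff\<close>)
  then show "(\<lambda>w. g (w ^ M)) holomorphic_on ball (0::complex) 1" by (simp add: o_def)
  have "exp (2 * of_real pi * \<i> * \<tau> / of_nat (N * M)) ^ M = exp (of_nat M * (2 * of_real pi * \<i> * \<tau> / of_nat (N * M)))"
    by (rule exp_of_nat_mult[symmetric])
  also have "of_nat M * (2 * of_real pi * \<i> * \<tau> / of_nat (N * M)) = 2 * of_real pi * \<i> * \<tau> / of_nat N"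
    using M by simp
  finally show "exp (2 * of_real pi * \<i> * \<tau> / of_nat N) = exp (2 * of_real pi * \<i> * \<tau> / of_nat (N * M)) ^ M" ..
qed

lemma holomorphic_at_infinity_common:
  assumes "holomorphic_at_infinity f1" "holomorphic_at_infinity f2"
  obtains N g1 g2 where "N > 0" "g1 holomorphic_on ball 0 1" "g2 holomorphic_on ball 0 1"
    "\<And>\<tau>. \<tau> \<in> upper_half_plane \<Longrightarrow> f1 \<tau> = g1 (exp (2 * of_real pi * \<i> * \<tau> / of_nat N))"
    "\<And>\<tau>. \<tau> \<in> upper_half_plane \<Longrightarrow> f2 \<tau> = g2 (exp (2 * of_real pi * \<i> * \<tau> / of_nat N))"
proof -
  obtain N1 g1 N2 g2 where 1: "N1 > 0" "g1 holomorphic_on ball 0 1"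
      "\<And>\<tau>. \<tau> \<in> upper_half_plane \<Longrightarrow> f1 \<tau> = g1 (exp (2 * of_real pi * \<i> * \<tau> / of_nat N1))"
    and 2: "N2 > 0" "g2 holomorphic_on ball 0 1"
      "\<And>\<tau>. \<tau> \<in> upper_half_plane \<Longrightarrow> f2 \<tau> = g2 (exp (2 * of_real pi * \<i> * \<tau> / of_nat N2))"
    using assms unfolding holomorphic_at_infinity_def by metis
  show ?thesis
  proof (rule that[of "N1 * N2" "\<lambda>w. g1 (w ^ N2)" "\<lambda>w. g2 (w ^ N1)"])
    fix \<tau> assume \<tau>: "\<tau> \<in> upper_half_plane"
    show "f1 \<tau> = g1 (exp (2 * of_real pi * \<i> * \<tau> / of_nat (N1 * N2)) ^ N2)"
      using 1(3)[OF \<tau>] holomorphic_at_infinity_rescale(2)[OF 1(2) 2(1)] by metis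
    show "f2 \<tau> = g2 (exp (2 * of_real pi * \<i> * \<tau> / of_nat (N1 * N2)) ^ N1)"
      using 2(3)[OF \<tau>] holomorphic_at_infinity_rescale(2)[OF 2(2) 1(1)] by (metis mult.commute)
  qed (use 1 2 holomorphic_at_infinity_rescale in auto)
qed

lemma holomorphic_at_infinity_add:
  assumes "holomorphic_at_infinity f1" "holomorphic_at_infinity f2"
  shows "holomorphic_at_infinity (\<lambda>\<tau>. f1 \<tau> + f2 \<tau>)"
proof -
  obtain N g1 g2 where "N > 0" "g1 holomorphic_on ball 0 1" "g2 holomorphic_on ball 0 1"
    "\<And>\<tau>. \<tau> \<in> upper_half_plane \<Longrightarrow> f1 \<tau> = g1 (exp (2 * of_real pi * \<i> * \<tau> / of_nat N))"
    "\<And>\<tau>. \<tau> \<in> upper_half_plane \<Longrightarrow> f2 \<tau> = g2 (exp (2 * of_real pi * \<i> * \<tau> / of_nat N))"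
    using holomorphic_at_infinity_common[OF assms] by blast
  then show ?thesis
    unfolding holomorphic_at_infinity_def
    by (intro exI[of _ N] conjI exI[of _ "\<lambda>w. g1 w + g2 w"] holomorphic_intros) auto
qed

lemma holomorphic_at_infinity_mult:
  assumes "holomorphic_at_infinity f1" "holomorphic_at_infinity f2"
  shows "holomorphic_at_infinity (\<lambda>\<tau>. f1 \<tau> * f2 \<tau>)"
proof -
  obtain N g1 g2 where "N > 0" "g1 holomorphic_on ball 0 1" "g2 holomorphic_on ball 0 1"
    "\<And>\<tau>. \<tau> \<in> upper_half_plane \<Longrightarrow> f1 \<tau> = g1 (exp (2 * of_real pi * \<i> * \<tau> / of_nat N))"
    "\<And>\<tau>. \<tau> \<in> upper_half_plane \<Longrightarrow> f2 \<tau> = g2 (exp (2 * of_real pi * \<i> * \<tau> / of_nat N))"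
    using holomorphic_at_infinity_common[OF assms] by blast
  then show ?thesis
    unfolding holomorphic_at_infinity_def
    by (intro exI[of _ N] conjI exI[of _ "\<lambda>w. g1 w * g2 w"] holomorphic_intros) auto
qed

lemma theta_poly_holomorphic_at_infinity:
  "theta_poly m f \<Longrightarrow> holomorphic_at_infinity f"
proof (induction rule: theta_poly.induct)
  case (mult m f r \<alpha>)
  have "holomorphic_at_infinity (\<lambda>\<tau>. theta r (of_real \<alpha> * \<tau>))"
    using theta_series_holomorphic_at_infinity[OF mult.hyps(2-4), of "\<lambda>_. 1"] by (simp add: theta_def)
  then show ?case using mult.IH by (rule holomorphic_at_infinity_mult)
qed (auto intro: holomorphic_at_infinity_const holomorphic_at_infinity_add holomorphic_at_infinity_cong)

lemma theta_poly_translate: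
  fixes j :: int
  assumes "theta_poly m f"
  shows "theta_poly m (\<lambda>\<tau>. f (\<tau> + of_int j))"
  using assms
proof (induction rule: theta_poly.induct)
  case (mult m f r \<alpha>)
  obtain M c where M: "M > 0" and eq: "\<And>\<tau>. Im \<tau> > 0 \<Longrightarrow> theta r (of_real \<alpha> * (\<tau> + of_int j)) =
       (\<Sum>s\<in>{0..<M}. c s * theta ((of_int s + r) / of_int M) (of_real ((of_int M)\<^sup>2 * \<alpha>) * \<tau>))"
    using theta_translate[OF mult.hyps(2-4)] by blast
  have "theta_poly (Suc m) (\<lambda>\<tau>. (\<Sum>s\<in>{0..<M}. c s * theta ((of_int s + r) / of_int M) (of_real ((of_int M)\<^sup>2 * \<alpha>) * \<tau>)) * f (\<tau> + of_int j))"
    using M mult.hyps by (intro theta_poly_mult_sum mult.IH) auto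
  then show ?case
    by (rule theta_poly.cong) (simp add: eq upper_half_plane_def)
next
  case (cong m f g)
  then show ?case
    by (intro theta_poly.cong[OF cong.IH]) (auto simp: upper_half_plane_def)
qed (auto intro: theta_poly.intros)

lemma theta_poly_invert:
  assumes "theta_poly m f"
  shows "theta_poly m (\<lambda>\<tau>. f (- 1 / \<tau>) / csqrt (- \<i> * \<tau>) ^ m)"
  using assms
proof (induction rule: theta_poly.induct)
  case (mult m f r \<alpha>)
  obtain p Q where r_eq: "Q > 0" "r = of_int p / of_int Q"
    using mult.hyps(2) by (cases rule: Rats_cases') auto
  \<comment> \<open>With \<sigma> = \<tau>/\<alpha> the argument is -1/\<sigma>, and splitting the
    dual series modulo Q produces theta values at Q^2 \<sigma> = \<beta>\<tau>.\<close>
  define \<beta> where "\<beta> = (of_int Q)\<^sup>2 / \<alpha>"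
  have eq: "theta r (of_real \<alpha> * (- 1 / \<tau>)) / csqrt (- \<i> * \<tau>) =
     (\<Sum>s\<in>{0..<Q}. (unit_exp (of_int s * r) / of_real (sqrt \<alpha>)) * theta (of_int s / of_int Q) (of_real \<beta> * \<tau>))"
    if \<tau>: "Im \<tau> > 0" for \<tau>
  proof -
    define \<sigma> where "\<sigma> = of_real (1 / \<alpha>) * \<tau>"
    have \<sigma>: "Im \<sigma> > 0" using \<tau> mult.hyps by (simp add: \<sigma>_def)
    have "of_real \<alpha> * (- 1 / \<tau>) = - 1 / \<sigma>" using mult.hyps by (simp add: \<sigma>_def)
    moreover have "csqrt (- \<i> * \<sigma>) = csqrt (- \<i> * \<tau>) / of_real (sqrt \<alpha>)"
    proof -
      have "- \<i> * \<sigma> = of_real (1 / \<alpha>) * (- \<i> * \<tau>)" by (simp add: \<sigma>_def)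
      then have "csqrt (- \<i> * \<sigma>) = of_real (sqrt (1 / \<alpha>)) * csqrt (- \<i> * \<tau>)"
        using csqrt_of_real_mult[of "1 / \<alpha>" "- \<i> * \<tau>"] mult.hyps by simp
      then show ?thesis by (simp add: real_sqrt_divide)
    qed
    moreover have "(of_int Q)\<^sup>2 * \<sigma> = of_real \<beta> * \<tau>" by (simp add: \<sigma>_def \<beta>_def)
    ultimately show ?thesis
      using theta_neg_inverse_sum[OF r_eq \<sigma>] csqrt_neg_ii_nonzero[OF \<tau>]
      by (simp add: sum_distrib_left sum_distrib_right sum_divide_distrib mult_ac)
  qed
  have "theta_poly (Suc m) (\<lambda>\<tau>. (\<Sum>s\<in>{0..<Q}. (unit_exp (of_int s * r) / of_real (sqrt \<alpha>)) * theta (of_int s / of_int Q) (of_real \<beta> * \<tau>)) *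
      (f (- 1 / \<tau>) / csqrt (- \<i> * \<tau>) ^ m))"
    using r_eq mult.hyps by (intro theta_poly_mult_sum mult.IH) (auto simp: \<beta>_def)
  then show ?case
  proof (rule theta_poly.cong)
    fix \<tau> assume "\<tau> \<in> upper_half_plane"
    then have \<tau>: "Im \<tau> > 0" by (simp add: upper_half_plane_def)
    show "theta r (of_real \<alpha> * (- 1 / \<tau>)) * f (- 1 / \<tau>) / csqrt (- \<i> * \<tau>) ^ Suc m =
       (\<Sum>s\<in>{0..<Q}. (unit_exp (of_int s * r) / of_real (sqrt \<alpha>)) * theta (of_int s / of_int Q) (of_real \<beta> * \<tau>)) *
       (f (- 1 / \<tau>) / csqrt (- \<i> * \<tau>) ^ m)"
      unfolding eq[OF \<tau>, symmetric] by simp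
  qed
next
  case (add m f g)
  then show ?case using theta_poly.add[OF add.IH] by (simp add: add_divide_distrib)
next
  case (cong m f g)
  show ?case
  proof (rule theta_poly.cong[OF cong.IH])
    fix \<tau> assume "\<tau> \<in> upper_half_plane"
    then have "- 1 / \<tau> \<in> upper_half_plane" using Im_neg_inverse by (simp add: upper_half_plane_def)
    then show "g (- 1 / \<tau>) / csqrt (- \<i> * \<tau>) ^ m = f (- 1 / \<tau>) / csqrt (- \<i> * \<tau>) ^ m"
      using cong.hyps by simp
  qed
qed (simp add: theta_poly.const)

section \<open>The slash action\<close>

text \<open>Euclidean descent on |c| + |d| in the bottom row. \<open>T\<close> and \<open>V\<close>
  are right multiplication by (1 1; 0 1) and (1 0; N 1), so the rule expresses generation by these
  and the upper triangular matrices. N = 1 serves the theta polynomials and N = 3 serves F; the case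
  d = 0 can arise for N = 1 only.\<close>

lemma Gamma0_induct [consumes 3, case_names base T T' V V']:
  fixes N a b c d :: int
  assumes N: "N = 1 \<or> N = 3" and det: "a * d - b * c = 1" and dvd: "N dvd c"
    and base: "\<And>a b d. a * d = 1 \<Longrightarrow> P a b 0 d"
    and T: "\<And>a b c d. a * d - b * c = 1 \<Longrightarrow> N dvd c \<Longrightarrow> P a b c d \<Longrightarrow> P a (b + a) c (d + c)"
    and T': "\<And>a b c d. a * d - b * c = 1 \<Longrightarrow> N dvd c \<Longrightarrow> P a b c d \<Longrightarrow> P a (b - a) c (d - c)"
    and V: "\<And>a b c d. a * d - b * c = 1 \<Longrightarrow> N dvd c \<Longrightarrow> P a b c d \<Longrightarrow> P (a + N * b) b (c + N * d) d"
    and V': "\<And>a b c d. a * d - b * c = 1 \<Longrightarrow> N dvd c \<Longrightarrow> P a b c d \<Longrightarrow> P (a - N * b) b (c - N * d) d"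
  shows "P a b c d"
  using det dvd
proof (induction "nat (\<bar>c\<bar> + \<bar>d\<bar>)" arbitrary: a b c d rule: less_induct)
  case less
  \<comment> \<open>Changing d by c with the right sign shortens it iff |c| < 2|d|; changing c by N
    d shortens it iff |c| > (N/2)|d|. The threshold 2|d| suits both since N < 4.\<close>
  consider "c = 0" | "d = 0" | "c \<noteq> 0" "d \<noteq> 0" "\<bar>c\<bar> < 2 * \<bar>d\<bar>" | "c \<noteq> 0" "d \<noteq> 0" "2 * \<bar>d\<bar> \<le> \<bar>c\<bar>"
    by linarith
  then show ?case
  proof cases
    case 1
    then show ?thesis using base less.prems by simp
  next
    case 2
    then have bc: "- b * c = 1" using less.prems by simp
    then have "c dvd 1" by (metis dvd_triv_right)
    then have "N dvd 1" using less.prems(2) dvd_trans by blast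
    then have N1: "N = 1" using N by auto
    have "P (- b) (a + b) 0 c" using base bc by simp
    from V[OF _ _ this] bc N1 have "P a (a + b) c c" by simp
    from T'[OF _ _ this] bc N1 2 show ?thesis by (simp add: algebra_simps)
  next
    case 3
    show ?thesis
    proof (cases "c > 0 \<longleftrightarrow> d > 0")
      case True
      then have "P a (b - a) c (d - c)"
        using 3 less.prems by (intro less.hyps) (auto simp: algebra_simps)
      from T[OF _ _ this] less.prems show ?thesis by (simp add: algebra_simps)
    next
      case False
      then have "P a (b + a) c (d + c)"
        using 3 less.prems by (intro less.hyps) (auto simp: algebra_simps)
      from T'[OF _ _ this] less.prems show ?thesis by (simp add: algebra_simps)
    qed
  next
    case 4
    have dvds: "N dvd c - N * d" "N dvd c + N * d" using less.prems(2) by auto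
    show ?thesis
    proof (cases "c > 0 \<longleftrightarrow> d > 0")
      case True
      then have "P (a - N * b) b (c - N * d) d"
        using 4 less.prems dvds N by (intro less.hyps) (auto simp: algebra_simps)
      from V[OF _ dvds(1) this] less.prems show ?thesis by (simp add: algebra_simps)
    next
      case False
      then have "P (a + N * b) b (c + N * d) d"
        using 4 less.prems dvds N by (intro less.hyps) (auto simp: algebra_simps)
      from V'[OF _ dvds(2) this] less.prems show ?thesis by (simp add: algebra_simps)
    qed
  qed
qed

section \<open>Moebius maps and the slash operator on theta polynomials\<close>

lemma moebius_denominator_nonzero:
  fixes a b c d :: int
  assumes "a * d - b * c = 1" "Im \<tau> > 0"
  shows "of_int c * \<tau> + of_int d \<noteq> (0::complex)"
proof
  assume eq: "of_int c * \<tau> + of_int d = 0"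
  then have "Im (of_int c * \<tau> + of_int d) = 0" by simp
  then have c: "c = 0" using assms(2) by simp
  with eq have "d = 0" by simp
  with c assms(1) show False by simp
qed

lemma Im_moebius_pos:
  fixes a b c d :: int
  assumes "a * d - b * c = 1" "Im \<tau> > 0"
  shows "Im ((of_int a * \<tau> + of_int b) / (of_int c * \<tau> + of_int d)) > 0"
proof -
  let ?w = "of_int c * \<tau> + of_int d"
  have "Im ((of_int a * \<tau> + of_int b) / ?w) = (of_int (a * d - b * c) * Im \<tau>) / (cmod ?w)\<^sup>2"
    by (simp add: Im_divide cmod_power2 algebra_simps)
  then show ?thesis
    using assms moebius_denominator_nonzero[OF assms] by simp
qed

lemma slash_translate:
  "slash w a (b + j * a) c (d + j * c) f \<tau> = slash w a b c d f (\<tau> + of_int j)"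
  by (simp add: slash_def algebra_simps)

lemma slash_lower:
  fixes j :: int
  assumes "Im \<tau> > 0"
  shows "slash w (a + j * b) b (c + j * d) d f \<tau> =
    (of_int j * \<tau> + 1) powi (- w) * slash w a b c d f (\<tau> / (of_int j * \<tau> + 1))"
proof -
  define x where "x = of_int j * \<tau> + 1"
  have x: "x \<noteq> 0"
    using moebius_denominator_nonzero[of 1 1 0 j \<tau>] assms by (simp add: x_def)
  have "of_int a * (\<tau> / x) + of_int b = (of_int (a + j * b) * \<tau> + of_int b) / x"
    "of_int c * (\<tau> / x) + of_int d = (of_int (c + j * d) * \<tau> + of_int d) / x"
    using x by (simp_all add: field_simps) (simp_all add: x_def algebra_simps)
  then show ?thesis
    using x unfolding slash_def x_def[symmetric]
    by (simp add: power_int_divide_distrib)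
qed

lemma Im_lower_pos:
  fixes j :: int
  assumes "Im \<tau> > 0"
  shows "Im (\<tau> / (of_int j * \<tau> + 1)) > 0" "of_int j * \<tau> + 1 \<noteq> 0"
  using Im_moebius_pos[of 1 1 0 j \<tau>] moebius_denominator_nonzero[of 1 1 0 j \<tau>] assms by simp_all

text \<open>The map \<tau> / (j\<tau> + 1) is inversion, translation by -j, inversion. The two roots
  that arise have arguments with product j\<tau> + 1; raised to the power 2w they give exactly the
  weight w factor.\<close>

lemma theta_poly_lower:
  fixes j :: int
  assumes "theta_poly (2 * w) g"
  shows "theta_poly (2 * w) (\<lambda>\<tau>. (of_int j * \<tau> + 1) powi (- int w) * g (\<tau> / (of_int j * \<tau> + 1)))"
proof -
  define h where "h = (\<lambda>\<tau>. g (- 1 / \<tau>) / csqrt (- \<i> * \<tau>) ^ (2 * w))"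
  have "theta_poly (2 * w) (\<lambda>\<tau>. h (\<tau> + of_int (- j)))"
    unfolding h_def by (intro theta_poly_translate theta_poly_invert assms)
  from theta_poly_invert[OF this]
  have "theta_poly (2 * w) (\<lambda>\<tau>. h (- 1 / \<tau> + of_int (- j)) / csqrt (- \<i> * \<tau>) ^ (2 * w))" .
  then show ?thesis
  proof (rule theta_poly.cong)
    fix \<tau> assume "\<tau> \<in> upper_half_plane"
    then have \<tau>: "Im \<tau> > 0" by (simp add: upper_half_plane_def)
    then have \<tau>0: "\<tau> \<noteq> 0" by auto
    note nz = Im_lower_pos(2)[OF \<tau>, of j]
    have "- 1 / \<tau> + of_int (- j) = - ((of_int j * \<tau> + 1) / \<tau>)"
      using \<tau>0 by (simp add: field_simps)
    then have "- 1 / (- 1 / \<tau> + of_int (- j)) = \<tau> / (of_int j * \<tau> + 1)"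
      using \<tau>0 nz by simp
    moreover have "csqrt (- \<i> * (- 1 / \<tau> + of_int (- j))) ^ (2 * w) * csqrt (- \<i> * \<tau>) ^ (2 * w) = (of_int j * \<tau> + 1) ^ w"
    proof -
      have "(- \<i> * (- 1 / \<tau> + of_int (- j))) * (- \<i> * \<tau>) = of_int j * \<tau> + 1"
        using \<tau>0 by (simp add: field_simps)
      then show ?thesis
        by (simp only: power_mult power2_csqrt power_mult_distrib[symmetric])
    qed
    ultimately show "(of_int j * \<tau> + 1) powi (- int w) * g (\<tau> / (of_int j * \<tau> + 1)) =
        h (- 1 / \<tau> + of_int (- j)) / csqrt (- \<i> * \<tau>) ^ (2 * w)"
      by (simp only: h_def power_int_minus power_int_of_nat divide_divide_eq_left) (simp add: divide_inverse)
  qed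
qed

lemma theta_poly_slash:
  fixes a b c d :: int
  assumes f: "theta_poly (2 * w) f" and det: "a * d - b * c = 1"
  shows "theta_poly (2 * w) (slash (int w) a b c d f)"
  using disjI1[OF refl] det one_dvd
proof (induction rule: Gamma0_induct)
  case (base a b d)
  then have ad: "a = d" "d = 1 \<or> d = - 1" by (auto simp: zmult_eq_1_iff)
  have "theta_poly (2 * w) (\<lambda>\<tau>. of_int d powi (- int w) * f (\<tau> + of_int (a * b)))"
    by (intro theta_poly_cmult theta_poly_translate f)
  then show ?case
    by (rule theta_poly.cong) (use ad in \<open>auto simp: slash_def\<close>)
next
  case (T a b c d)
  then show ?case
    using slash_translate[of "int w" a b 1 c d f] theta_poly_translate[OF T(3), of 1]
    by (auto intro: theta_poly.cong)
next
  case (T' a b c d)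
  then show ?case
    using slash_translate[of "int w" a b "- 1" c d f] theta_poly_translate[OF T'(3), of "- 1"]
    by (auto intro: theta_poly.cong)
next
  case (V a b c d)
  from theta_poly_lower[OF V(3), of 1] show ?case
    by (rule theta_poly.cong) (use slash_lower[of _ "int w" a 1 b c d f] in \<open>simp add: upper_half_plane_def\<close>)
next
  case (V' a b c d)
  from theta_poly_lower[OF V'(3), of "- 1"] show ?case
    by (rule theta_poly.cong) (use slash_lower[of _ "int w" a "- 1" b c d f] in \<open>simp add: upper_half_plane_def\<close>)
qed

section \<open>The functions F and Psi\<close>

lemma has_sum_product_pairs:
  fixes f :: "'a \<Rightarrow> complex" and g :: "'b \<Rightarrow> complex"
  assumes f: "(\<lambda>x. norm (f x)) summable_on UNIV" and g: "(\<lambda>y. norm (g y)) summable_on UNIV"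
  shows "((\<lambda>(x, y). f x * g y) has_sum (infsum f UNIV * infsum g UNIV)) UNIV"
proof -
  have "((\<lambda>(x, y). f x * g y) has_sum (infsum f UNIV * infsum g UNIV)) (UNIV \<times> UNIV)"
  proof (rule has_sum_SigmaI)
    show "((\<lambda>y. case (x, y) of (x, y) \<Rightarrow> f x * g y) has_sum f x * infsum g UNIV) UNIV" for x
      using abs_summable_summable[OF g] by (simp add: has_sum_cmult_right)
    show "((\<lambda>x. f x * infsum g UNIV) has_sum infsum f UNIV * infsum g UNIV) UNIV"
      using abs_summable_summable[OF f] by (intro has_sum_cmult_left) simp
    show "(\<lambda>(x, y). f x * g y) summable_on UNIV \<times> UNIV"
    proof (rule abs_summable_summable,
        rule iffD2[OF Infinite_Sum.abs_summable_on_Sigma_iff[where f = "\<lambda>(x, y). f x * g y" and A = UNIV and B = "\<lambda>_. UNIV"]],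
        intro conjI ballI)
      fix x
      show "(\<lambda>y. norm (case (x, y) of (x, y) \<Rightarrow> f x * g y)) summable_on UNIV"
        using g by (simp add: norm_mult summable_on_cmult_right)
    next
      have "(\<lambda>x. norm (f x) * infsum (\<lambda>y. norm (g y)) UNIV) summable_on UNIV"
        using f by (rule summable_on_cmult_left)
      moreover have "infsum (\<lambda>y. norm (g y)) UNIV \<ge> 0" by (rule infsum_nonneg) auto
      ultimately show "(\<lambda>x. norm (\<Sum>\<^sub>\<infinity>y. norm (case (x, y) of (x, y) \<Rightarrow> f x * g y))) summable_on UNIV"
        by (simp add: norm_mult infsum_cmult_right')
    qed
  qed
  then show ?thesis by simp
qed

lemma nome_powi: "nome \<tau> powi n = exp (2 * of_real pi * \<i> * \<tau> * of_int n)"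
proof (cases "n \<ge> 0")
  case True
  then obtain m where "n = int m" by (metis nonneg_int_cases)
  then show ?thesis by (simp add: nome_def exp_of_nat_mult[symmetric] mult_ac)
next
  case False
  then obtain m where "n = - int m" by (metis int_cases2 nle_le of_nat_0_le_iff neg_int_cases less_le_not_le)
  then show ?thesis by (simp add: nome_def power_int_minus exp_of_nat_mult[symmetric] exp_minus[symmetric] mult_ac)
qed

text \<open>Completing the square: for n = 2y + e and m = x - y the form m^2 + mn + n^2 equals (x +
  e/2)^2 + 3 (y + e/2)^2. The two summands are the parities e = 0 and e = 1 of n.\<close>

lemma F_theta_eq_theta:
  assumes \<tau>: "Im \<tau> > 0"
  shows "F_theta \<tau> = theta 0 (2 * \<tau>) * theta 0 (6 * \<tau>) + theta (1/2) (2 * \<tau>) * theta (1/2) (6 * \<tau>)"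
proof -
  let ?F = "\<lambda>(m, n). nome \<tau> powi (m\<^sup>2 + m * n + n\<^sup>2)"
  have prod: "((\<lambda>(x, y). exp (of_real pi * \<i> * (of_int x + of_real r)\<^sup>2 * (2 * \<tau>)) * exp (of_real pi * \<i> * (of_int y + of_real r)\<^sup>2 * (6 * \<tau>)))
      has_sum (theta r (2 * \<tau>) * theta r (6 * \<tau>))) (UNIV :: (int \<times> int) set)" for r
    unfolding theta_def
    using theta_series_abs_summable[of "2 * \<tau>" "\<lambda>_. 1" 1 r] theta_series_abs_summable[of "6 * \<tau>" "\<lambda>_. 1" 1 r] \<tau>
    by (intro has_sum_product_pairs) auto
  have part: "(?F has_sum (theta (of_int e / 2) (2 * \<tau>) * theta (of_int e / 2) (6 * \<tau>))) (range (\<lambda>(x, y). (x - y, 2 * y + e)))"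
    for e :: int
  proof -
    have inj: "inj (\<lambda>(x, y). (x - y, 2 * y + e))" by (auto simp: inj_def)
    have "?F \<circ> (\<lambda>(x, y). (x - y, 2 * y + e)) =
      (\<lambda>(x, y). exp (of_real pi * \<i> * (of_int x + of_real (of_int e / 2))\<^sup>2 * (2 * \<tau>)) * exp (of_real pi * \<i> * (of_int y + of_real (of_int e / 2))\<^sup>2 * (6 * \<tau>)))"
    proof (rule ext, clarify)
      fix x y :: int
      have "2 * of_real pi * \<i> * \<tau> * of_int ((x - y)\<^sup>2 + (x - y) * (2 * y + e) + (2 * y + e)\<^sup>2) =
          of_real pi * \<i> * (of_int x + of_real (of_int e / 2))\<^sup>2 * (2 * \<tau>) + of_real pi * \<i> * (of_int y + of_real (of_int e / 2))\<^sup>2 * (6 * \<tau>)"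
        by (simp add: power2_eq_square field_simps)
      then show "(?F \<circ> (\<lambda>(x, y). (x - y, 2 * y + e))) (x, y) =
          exp (of_real pi * \<i> * (of_int x + of_real (of_int e / 2))\<^sup>2 * (2 * \<tau>)) * exp (of_real pi * \<i> * (of_int y + of_real (of_int e / 2))\<^sup>2 * (6 * \<tau>))"
        by (simp only: o_apply case_prod_conv nome_powi exp_add)
    qed
    then show ?thesis
      using prod[of "of_int e / 2"] by (simp add: has_sum_reindex[OF inj])
  qed
  have "(?F has_sum (theta (of_int 0 / 2) (2 * \<tau>) * theta (of_int 0 / 2) (6 * \<tau>) + theta (of_int 1 / 2) (2 * \<tau>) * theta (of_int 1 / 2) (6 * \<tau>)))
     (range (\<lambda>(x, y). (x - y, 2 * y + 0)) \<union> range (\<lambda>(x, y). (x - y, 2 * y + 1)))"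
    by (intro has_sum_Un_disjoint part) (auto, presburger)
  also have "range (\<lambda>(x, y). (x - y, 2 * y + 0)) \<union> range (\<lambda>(x, y). (x - y, 2 * y + 1)) = (UNIV :: (int \<times> int) set)"
  proof -
    have "(m, n) \<in> range (\<lambda>(x, y). (x - y, 2 * y + 0)) \<union> range (\<lambda>(x, y). (x - y, 2 * y + 1))" for m n :: int
    proof (cases "even n")
      case True
      then obtain y where "n = 2 * y" by blast
      then show ?thesis by (intro UnI1 image_eqI[of _ _ "(m + y, y)"]) auto
    next
      case False
      then obtain y where "n = 2 * y + 1" by (elim oddE)
      then show ?thesis by (intro UnI2 image_eqI[of _ _ "(m + y, y)"]) auto
    qed
    then show ?thesis by auto
  qed
  finally show ?thesis
    unfolding F_theta_def by (simp add: infsumI)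
qed

text \<open>n(n+1)/2 + 1/8 = (n + 1/2)^2 / 2. The reflection n to -1 - n fixes this exponent, so the
  series over all integers counts each term twice.\<close>

lemma Psi_theta_eq_theta:
  assumes \<tau>: "Im \<tau> > 0"
  shows "exp (of_real pi * \<i> * \<tau> / 4) * Psi_theta \<tau> = theta (1/2) \<tau> / 2"
proof -
  let ?f = "\<lambda>n::int. exp (of_real pi * \<i> * (of_int n + of_real (1/2))\<^sup>2 * \<tau>)"
  have sm: "?f summable_on A" for A
    using theta_series_summable[of \<tau> "\<lambda>_. 1" 1 "1/2"] \<tau> summable_on_subset_banach by fastforce
  have UN: "UNIV = range int \<union> range (\<lambda>n. - 1 - int n)"
  proof -
    have "x \<in> range int \<union> range (\<lambda>n. - 1 - int n)" for x
      by (cases "x \<ge> 0") (auto intro: image_eqI[of _ _ "nat x"] image_eqI[of _ _ "nat (- 1 - x)"])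
    then show ?thesis by blast
  qed
  have "theta (1/2) \<tau> = infsum ?f (range int \<union> range (\<lambda>n. - 1 - int n))"
    unfolding theta_def by (subst UN) simp
  also have "\<dots> = infsum ?f (range int) + infsum ?f (range (\<lambda>n. - 1 - int n))"
    by (intro infsum_Un_disjoint sm) auto
  also have "infsum ?f (range int) = (\<Sum>\<^sub>\<infinity>n. ?f (int n))"
    by (subst infsum_reindex) (auto simp: o_def)
  also have "infsum ?f (range (\<lambda>n. - 1 - int n)) = (\<Sum>\<^sub>\<infinity>n. ?f (- 1 - int n))"
    by (subst infsum_reindex) (auto simp: o_def inj_on_def)
  also have "(\<lambda>n. ?f (- 1 - int n)) = (\<lambda>n. ?f (int n))"
    by (simp add: fun_eq_iff power2_eq_square field_simps)
  finally have th: "theta (1/2) \<tau> = 2 * (\<Sum>\<^sub>\<infinity>n. ?f (int n))" by simp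
  have trm: "?f (int n) = exp (of_real pi * \<i> * \<tau> / 4) * nome \<tau> ^ (n * (n + 1) div 2)" for n
  proof -
    define k where "k = n * (n + 1) div 2"
    have "2 * k = n * (n + 1)" unfolding k_def by simp
    then have "2 * complex_of_nat k = of_nat n * (of_nat n + 1)"
      by (metis of_nat_1 of_nat_add of_nat_mult of_nat_numeral)
    then have "of_real pi * \<i> * (of_int (int n) + of_real (1/2))\<^sup>2 * \<tau> = of_real pi * \<i> * \<tau> / 4 + of_real pi * \<i> * \<tau> * (2 * of_nat k)"
      by (simp add: power2_eq_square field_simps)
    then show ?thesis
      unfolding k_def[symmetric] nome_def exp_of_nat_mult[symmetric] exp_add[symmetric]
      by (simp add: mult_ac)
  qed
  have "(\<lambda>n. ?f (int n)) summable_on UNIV"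
    using sm[of "range int"] by (subst (asm) summable_on_reindex) (auto simp: o_def)
  then have "(\<lambda>n. ?f (int n)) sums (\<Sum>\<^sub>\<infinity>n. ?f (int n))"
    by (intro has_sum_imp_sums has_sum_infsum)
  from sums_mult[OF this, of "exp (- (of_real pi * \<i> * \<tau> / 4))"]
  have "(\<lambda>n. nome \<tau> ^ (n * (n + 1) div 2)) sums (exp (- (of_real pi * \<i> * \<tau> / 4)) * (\<Sum>\<^sub>\<infinity>n. ?f (int n)))"
    unfolding trm mult.assoc[symmetric] exp_add[symmetric] by simp
  then have "Psi_theta \<tau> = exp (- (of_real pi * \<i> * \<tau> / 4)) * (\<Sum>\<^sub>\<infinity>n. ?f (int n))"
    unfolding Psi_theta_def by (simp add: sums_iff)
  then show ?thesis
    unfolding th by (simp add: exp_minus)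
qed

section \<open>The Fricke involution and covariance of F under Gamma_0(3)\<close>

lemma theta_dual_quarter:
  assumes "Im \<sigma> > 0"
  shows "(\<Sum>\<^sub>\<infinity>k::int. unit_exp (of_int k * 0) * exp (of_real pi * \<i> * (of_int k)\<^sup>2 * (\<sigma> / 4))) = theta 0 \<sigma> + theta (1/2) \<sigma>"
    and "(\<Sum>\<^sub>\<infinity>k::int. unit_exp (of_int k * (1/2)) * exp (of_real pi * \<i> * (of_int k)\<^sup>2 * (\<sigma> / 4))) = theta 0 \<sigma> - theta (1/2) \<sigma>"
proof -
  have set: "{0..<2::int} = {0, 1}" by auto
  have half: "unit_exp (of_int k * (1/2)) = (if even k then 1 else - 1)" for k
    using unit_exp_half[of k] by simp
  show "(\<Sum>\<^sub>\<infinity>k::int. unit_exp (of_int k * 0) * exp (of_real pi * \<i> * (of_int k)\<^sup>2 * (\<sigma> / 4))) = theta 0 \<sigma> + theta (1/2) \<sigma>"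
    using theta_series_split[of "\<sigma> / 4" 2 "\<lambda>_. 1" 0] assms by (simp add: set)
  show "(\<Sum>\<^sub>\<infinity>k::int. unit_exp (of_int k * (1/2)) * exp (of_real pi * \<i> * (of_int k)\<^sup>2 * (\<sigma> / 4))) = theta 0 \<sigma> - theta (1/2) \<sigma>"
    unfolding half using theta_series_split[of "\<sigma> / 4" 2 "\<lambda>k. if even k then 1 else - 1" 0] assms by (simp add: set)
qed

text \<open>Inversion exchanges the scales 2 and 6 and turns characteristics 0 and 1/2 into sum and
  difference of the two theta values. F reproduces itself because (A + a)(B + b) + (A - a)(B - b) =
  2(AB + ab).\<close>

lemma F_theta_fricke:
  assumes \<tau>: "Im \<tau> > 0"
  shows "F_theta (- 1 / (3 * \<tau>)) = - \<i> * of_real (sqrt 3) * \<tau> * F_theta \<tau>"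
proof -
  have \<tau>0: "\<tau> \<noteq> 0" using \<tau> by auto
  define x where "x = csqrt (- \<i> * (\<tau> / 2))"
  have x2: "x * x = - \<i> * \<tau> / 2"
    unfolding x_def power2_eq_square[symmetric] power2_csqrt by simp
  have "Im (- 1 / (3 * \<tau>)) > 0"
    using Im_neg_inverse[of "3 * \<tau>"] \<tau> by simp
  note F = F_theta_eq_theta[OF this]
  have s1: "2 * (- 1 / (3 * \<tau>)) = - 1 / (6 * \<tau> / 4)" "6 * (- 1 / (3 * \<tau>)) = - 1 / (2 * \<tau> / 4)"
    using \<tau>0 by (simp_all add: field_simps)
  have s2: "csqrt (- \<i> * (6 * \<tau> / 4)) = of_real (sqrt 3) * x" "csqrt (- \<i> * (2 * \<tau> / 4)) = x"
    using csqrt_of_real_mult[of 3 "- \<i> * (\<tau> / 2)"] by (simp_all add: x_def mult_ac)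
  have i: "Im (6 * \<tau>) > 0" "Im (2 * \<tau>) > 0" "Im (6 * \<tau> / 4) > 0" "Im (2 * \<tau> / 4) > 0"
    using \<tau> by auto
  have r: "(0::real) \<in> \<rat>" "(1/2::real) \<in> \<rat>" by auto
  have alg: "s * x * (B + b) * (x * (A + a)) + s * x * (B - b) * (x * (A - a)) = - \<i> * s * \<tau> * (A * B + a * b)" for s A B a b
  proof -
    have "s * x * (B + b) * (x * (A + a)) + s * x * (B - b) * (x * (A - a)) = 2 * s * (x * x) * (A * B + a * b)"
      by (simp add: algebra_simps)
    then show ?thesis by (simp add: x2)
  qed
  show ?thesis
    unfolding F F_theta_eq_theta[OF \<tau>] s1
      theta_neg_inverse[OF r(1) i(3)] theta_neg_inverse[OF r(2) i(3)]
      theta_neg_inverse[OF r(1) i(4)] theta_neg_inverse[OF r(2) i(4)]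
      theta_dual_quarter[OF i(1)] theta_dual_quarter[OF i(2)] s2
    by (rule alg)
qed

lemma F_theta_translate: "F_theta (\<tau> + of_int n) = F_theta \<tau>"
proof -
  have "nome (\<tau> + of_int n) = nome \<tau>"
    unfolding nome_def ring_distribs exp_add
    by (simp add: exp_eq_1)
  then show ?thesis by (simp add: F_theta_def)
qed

text \<open>Conjugating the translation by -1 with the Fricke involution gives the lower parabolic
  generator; the two Fricke factors multiply to -3(\<sigma> - 1)\<tau> = 3\<tau> + 1.\<close>

lemma F_theta_lower:
  assumes \<tau>: "Im \<tau> > 0"
  shows "F_theta (\<tau> / (3 * \<tau> + 1)) = (3 * \<tau> + 1) * F_theta \<tau>"
proof -
  have \<tau>0: "\<tau> \<noteq> 0" using \<tau> by auto
  have nz: "3 * \<tau> + 1 \<noteq> 0" using Im_lower_pos(2)[OF \<tau>, of 3] by simp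
  define \<sigma> where "\<sigma> = - 1 / (3 * \<tau>)"
  have \<sigma>: "Im \<sigma> > 0" unfolding \<sigma>_def using Im_neg_inverse[of "3 * \<tau>"] \<tau> by simp
  have "3 * (\<sigma> - 1) = - ((3 * \<tau> + 1) / \<tau>)"
    unfolding \<sigma>_def using \<tau>0 by (simp add: field_simps)
  then have "\<tau> / (3 * \<tau> + 1) = - 1 / (3 * (\<sigma> - 1))"
    using \<tau>0 nz by simp
  then have "F_theta (\<tau> / (3 * \<tau> + 1)) = - \<i> * of_real (sqrt 3) * (\<sigma> - 1) * F_theta (\<sigma> - 1)"
    using F_theta_fricke[of "\<sigma> - 1"] \<sigma> by simp
  also have "F_theta (\<sigma> - 1) = F_theta \<sigma>" using F_theta_translate[of \<sigma> "- 1"] by simp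
  also have "F_theta \<sigma> = - \<i> * of_real (sqrt 3) * \<tau> * F_theta \<tau>"
    unfolding \<sigma>_def by (rule F_theta_fricke[OF \<tau>])
  also have "- \<i> * of_real (sqrt 3) * (\<sigma> - 1) * (- \<i> * of_real (sqrt 3) * \<tau> * F_theta \<tau>) =
      - ((of_real (sqrt 3) * of_real (sqrt 3)) * ((\<sigma> - 1) * \<tau>)) * F_theta \<tau>"
    by (simp add: mult_ac)
  also have "complex_of_real (sqrt 3) * of_real (sqrt 3) = 3"
    unfolding of_real_mult[symmetric] by simp
  also have "- (3 * ((\<sigma> - 1) * \<tau>)) = 3 * \<tau> + 1"
    unfolding \<sigma>_def using \<tau>0 by (simp add: field_simps)
  finally show ?thesis .
qed

lemma Legendre_1_3: "Legendre 1 3 = 1" and Legendre_minus_1_3: "Legendre (- 1) 3 = - 1"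
proof -
  show "Legendre 1 3 = 1"
    unfolding Legendre_def QuadRes_def by (auto simp: cong_def intro!: exI[of _ 1])
  have "\<not> [y\<^sup>2 = - 1] (mod 3)" for y :: int
  proof
    assume "[y\<^sup>2 = - 1] (mod 3)"
    then have "(y mod 3)\<^sup>2 mod 3 = 2" by (simp add: cong_def power_mod)
    moreover have "y mod 3 = 0 \<or> y mod 3 = 1 \<or> y mod 3 = 2" by presburger
    ultimately show False by auto
  qed
  then show "Legendre (- 1) 3 = - 1"
    unfolding Legendre_def QuadRes_def by (auto simp: cong_def)
qed

text \<open>The generators change d by multiples of 3 or not at all, so the symbol stays constant
  along the descent; at -I the weight 1 sign agrees with (-1 / 3) = -1.\<close>

lemma F_theta_slash:
  fixes a b c d :: int
  assumes det: "a * d - b * c = 1" and dvd: "3 dvd c"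
  shows "\<forall>\<tau>. Im \<tau> > 0 \<longrightarrow> slash 1 a b c d F_theta \<tau> = of_int (Legendre d 3) * F_theta \<tau>"
  using disjI2[OF refl] det dvd
proof (induction rule: Gamma0_induct)
  case (base a b d)
  then have ad: "a = d" "d = 1 \<or> d = - 1" by (auto simp: zmult_eq_1_iff)
  then have "slash 1 a b 0 d F_theta \<tau> = of_int d * F_theta (\<tau> + of_int (a * b))" for \<tau>
    by (auto simp: slash_def)
  then have "slash 1 a b 0 d F_theta \<tau> = of_int d * F_theta \<tau>" for \<tau>
    by (simp only: F_theta_translate)
  then show ?case using ad by (auto simp: Legendre_1_3 Legendre_minus_1_3)
next
  case (T a b c d)
  have "Legendre (d + c) 3 = Legendre d 3"
    using T(2) by (intro Legendre_cong) (simp add: cong_iff_dvd_diff)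
  then show ?case
    using slash_translate[of 1 a b 1 c d F_theta] F_theta_translate[of _ 1] T(3) by simp
next
  case (T' a b c d)
  have "Legendre (d - c) 3 = Legendre d 3"
    using T'(2) by (intro Legendre_cong) (simp add: cong_iff_dvd_diff)
  then show ?case
    using slash_translate[of 1 a b "- 1" c d F_theta] F_theta_translate[of _ "- 1"] T'(3) by simp
next
  case (V a b c d)
  show ?case
  proof (intro allI impI)
    fix \<tau> :: complex assume \<tau>: "Im \<tau> > 0"
    have "slash 1 (a + 3 * b) b (c + 3 * d) d F_theta \<tau> =
      (3 * \<tau> + 1) powi (- 1) * slash 1 a b c d F_theta (\<tau> / (3 * \<tau> + 1))"
      using slash_lower[OF \<tau>, of 1 a 3 b c d F_theta] by simp
    also have "slash 1 a b c d F_theta (\<tau> / (3 * \<tau> + 1)) = of_int (Legendre d 3) * F_theta (\<tau> / (3 * \<tau> + 1))"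
      using V(3) Im_lower_pos(1)[OF \<tau>, of 3] by simp
    finally show "slash 1 (a + 3 * b) b (c + 3 * d) d F_theta \<tau> = of_int (Legendre d 3) * F_theta \<tau>"
      using F_theta_lower[OF \<tau>] Im_lower_pos(2)[OF \<tau>, of 3] by (simp add: power_int_minus)
  qed
next
  case (V' a b c d)
  show ?case
  proof (intro allI impI)
    fix \<tau> :: complex assume \<tau>: "Im \<tau> > 0"
    \<comment> \<open>The inverse of the lower generator: F is transformed at \<sigma>, whose image
      under \<sigma> / (3\<sigma> + 1) is \<tau>.\<close>
    define \<sigma> where "\<sigma> = \<tau> / (- 3 * \<tau> + 1)"
    have \<sigma>: "Im \<sigma> > 0" "- 3 * \<tau> + 1 \<noteq> 0"
      using Im_lower_pos[OF \<tau>, of "- 3"] by (simp_all add: \<sigma>_def)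
    have "3 * \<sigma> + 1 = inverse (- 3 * \<tau> + 1)" "\<sigma> / (3 * \<sigma> + 1) = \<tau>"
      using \<sigma>(2) by (simp_all add: \<sigma>_def divide_simps)
    then have F: "F_theta \<tau> = inverse (- 3 * \<tau> + 1) * F_theta \<sigma>"
      using F_theta_lower[OF \<sigma>(1)] by simp
    have "slash 1 (a - 3 * b) b (c - 3 * d) d F_theta \<tau> =
      (- 3 * \<tau> + 1) powi (- 1) * slash 1 a b c d F_theta \<sigma>"
      using slash_lower[OF \<tau>, of 1 a "- 3" b c d F_theta] by (simp add: \<sigma>_def)
    then show "slash 1 (a - 3 * b) b (c - 3 * d) d F_theta \<tau> = of_int (Legendre d 3) * F_theta \<tau>"
      using V'(3) \<sigma> unfolding F by (simp add: power_int_minus)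
  qed
qed

text \<open>Scaling by a conjugates the matrix to (A aB; C/a D), which lies in Gamma_0(3) because 3a
  divides C.\<close>

lemma F_theta_Gamma0:
  fixes A B C D a :: int
  assumes det: "A * D - B * C = 1" and a: "a > 0" "3 * a dvd C" and \<tau>: "Im \<tau> > 0"
  shows "F_theta (of_int a * ((of_int A * \<tau> + of_int B) / (of_int C * \<tau> + of_int D))) =
    of_int (Legendre D 3) * (of_int C * \<tau> + of_int D) * F_theta (of_int a * \<tau>)"
proof -
  obtain C' where C: "C = 3 * a * C'" using a(2) by (elim dvdE)
  have "A * D - (a * B) * (3 * C') = 1" using det C by (simp add: mult_ac)
  moreover have "Im (of_int a * \<tau>) > 0" using a \<tau> by simp
  ultimately have "slash 1 A (a * B) (3 * C') D F_theta (of_int a * \<tau>) = of_int (Legendre D 3) * F_theta (of_int a * \<tau>)"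
    using F_theta_slash by simp
  moreover have "of_int (3 * C') * (of_int a * \<tau>) + of_int D = of_int C * \<tau> + of_int D"
    by (simp add: C mult_ac)
  moreover have "of_int A * (of_int a * \<tau>) + of_int (a * B) = of_int a * (of_int A * \<tau> + of_int B)"
    by (simp add: algebra_simps)
  ultimately have "inverse (of_int C * \<tau> + of_int D) *
      F_theta (of_int a * ((of_int A * \<tau> + of_int B) / (of_int C * \<tau> + of_int D))) =
      of_int (Legendre D 3) * F_theta (of_int a * \<tau>)"
    by (simp only: slash_def power_int_minus power_int_1_right times_divide_eq_right)
  moreover have "X = l * w * Y" if "inverse w * X = l * Y" "w \<noteq> 0" for w X l Y :: complex
    using that by (simp add: field_simps)
  ultimately show ?thesis
    using moebius_denominator_nonzero[OF det \<tau>] by blast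
qed

section \<open>Transformation of products of theta series\<close>

lemma unit_exp_sum: "finite A \<Longrightarrow> unit_exp (\<Sum>i\<in>A. f i) = (\<Prod>i\<in>A. unit_exp (f i))"
  by (induction rule: finite_induct) (simp_all add: unit_exp_add)

lemma infsum_finite_sum:
  fixes f :: "'a \<Rightarrow> 'b \<Rightarrow> complex"
  assumes "finite A" "\<And>s. s \<in> A \<Longrightarrow> f s summable_on B"
  shows "(\<Sum>\<^sub>\<infinity>l\<in>B. \<Sum>s\<in>A. f s l) = (\<Sum>s\<in>A. \<Sum>\<^sub>\<infinity>l\<in>B. f s l)"
proof -
  have "((\<lambda>l. \<Sum>s\<in>A. f s l) has_sum (\<Sum>s\<in>A. \<Sum>\<^sub>\<infinity>l\<in>B. f s l)) B"
    using assms by (induction rule: finite_induct) (auto intro!: has_sum_add)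
  then show ?thesis by (rule infsumI)
qed

text \<open>The odd square \<open>(2s+1)\<^sup>2\<close> is determined modulo \<open>8D\<close> by \<open>s\<close> modulo the odd number \<open>D\<close>;
  substituting \<open>s = 2t + (D-1)/2\<close> turns the sum into an ordinary Gauss sum.\<close>

lemma odd_square_exp_periodic:
  fixes b D x y :: int
  assumes "odd D" "[x = y] (mod D)"
  shows "unit_exp (of_int (b * (2 * x + 1)\<^sup>2) / of_int (8 * D)) = unit_exp (of_int (b * (2 * y + 1)\<^sup>2) / of_int (8 * D))"
proof (rule unit_exp_cong)
  obtain k where x: "x = y + D * k"
    using assms(2) by (metis cong_iff_lin cong_sym mult.commute)
  have "even (k * (2 * y + 1 + D * k))" using assms(1) by simp
  then obtain t where t: "k * (2 * y + 1 + D * k) = 2 * t" by blast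
  have "b * (2 * x + 1)\<^sup>2 - b * (2 * y + 1)\<^sup>2 = b * 4 * D * (k * (2 * y + 1 + D * k))"
    unfolding x by (simp add: power2_eq_square algebra_simps)
  then have "b * (2 * x + 1)\<^sup>2 - b * (2 * y + 1)\<^sup>2 = (8 * D) * (b * t)"
    unfolding t by simp
  then show "[b * (2 * x + 1)\<^sup>2 = b * (2 * y + 1)\<^sup>2] (mod 8 * D)"
    by (simp only: cong_iff_dvd_diff dvd_triv_left)
qed

lemma sum_odd_square_exp:
  fixes b D :: int
  assumes D: "odd D" "D > 0"
  shows "(\<Sum>s\<in>{0..<D}. unit_exp (of_int (b * (2 * s + 1)\<^sup>2) / of_int (8 * D))) =
    unit_exp (of_int (b * D) / 8) * gauss_sum (2 * b) D"
proof -
  obtain e where e: "D = 2 * e + 1" using D(1) by (elim oddE)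
  have "(\<Sum>s\<in>{0..<D}. unit_exp (of_int (b * (2 * s + 1)\<^sup>2) / of_int (8 * D))) =
      (\<Sum>t\<in>{0..<D}. unit_exp (of_int (b * (2 * (2 * t + e) + 1)\<^sup>2) / of_int (8 * D)))"
    by (rule sum_residues_affine[symmetric, where f = "\<lambda>s. unit_exp (of_int (b * (2 * s + 1)\<^sup>2) / of_int (8 * D))"])
       (fact D(2) | (rule odd_square_exp_periodic[OF D(1)], assumption) | simp add: D(1))+
  also have "\<dots> = (\<Sum>t\<in>{0..<D}. unit_exp (of_int (b * D) / 8) * unit_exp (of_int (2 * b * t\<^sup>2) / of_int D))"
  proof (rule sum.cong[OF refl])
    fix t
    have "2 * (2 * t + e) + 1 = 4 * t + D" by (simp add: e)
    then have "of_int (b * (2 * (2 * t + e) + 1)\<^sup>2) / of_int (8 * D) = (of_int (b * (4 * t + D)\<^sup>2) / of_int (8 * D) :: real)"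
      by (simp only:)
    also have "\<dots> = (of_int (b * D) / 8 + of_int (2 * b * t\<^sup>2) / of_int D) + of_int (b * t)"
      using D(2) by (simp add: power2_eq_square field_simps)
    finally show "unit_exp (of_int (b * (2 * (2 * t + e) + 1)\<^sup>2) / of_int (8 * D)) =
        unit_exp (of_int (b * D) / 8) * unit_exp (of_int (2 * b * t\<^sup>2) / of_int D)"
      by (metis unit_exp_add unit_exp_add_of_int)
  qed
  finally show ?thesis by (simp only: gauss_sum_def sum_distrib_left)
qed

text \<open>Writing \<open>(A\<tau> + B) / (C\<tau> + D) = B / D + \<tau>'\<close>, the first inversion moves \<open>\<tau>'\<close> to
  \<open>- 1 / \<tau>' = - C D - D\<^sup>2 / \<tau>\<close> and the second one moves \<open>- 1 / \<tau>\<close> back to \<open>\<tau>\<close>. Completing the square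
  shows that all coefficients in between equal, up to sign, one and the same Gauss sum.\<close>

lemma theta_half_Gamma0:
  fixes A B C D c :: int
  assumes det: "A * D - B * C = 1" and c: "c > 0" "2 * c dvd C" and D: "D > 0" and \<tau>: "Im \<tau> > 0"
  defines "\<tau>' \<equiv> \<tau> / (of_int D * (of_int C * \<tau> + of_int D))"
  shows "theta (1/2) (of_int c * ((of_int A * \<tau> + of_int B) / (of_int C * \<tau> + of_int D))) =
    unit_exp (of_int (c * B * D) / 8) * gauss_sum (2 * c * B) D *
    (csqrt (- \<i> * \<tau>) / csqrt (- \<i> * (of_int (D\<^sup>2) * \<tau>'))) * theta (1/2) (of_int c * \<tau>)"
proof -
  obtain C' where C: "C = 2 * c * C'" using c(2) by (elim dvdE)
  have ADodd: "odd (A * D)"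
  proof -
    have "A * D = 2 * (B * c * C') + 1" using det C by simp
    then show ?thesis by simp
  qed
  then have oddD: "odd D" and oddA: "odd A" by auto
  have \<tau>0: "\<tau> \<noteq> 0" using \<tau> by auto
  define w where "w = of_int C * \<tau> + of_int D"
  have w: "w \<noteq> 0" unfolding w_def by (rule moebius_denominator_nonzero[OF det \<tau>])
  have \<gamma>: "(of_int A * \<tau> + of_int B) / w = of_int B / of_int D + \<tau>'"
  proof -
    have "A * D = B * C + 1" using det by simp
    then have AD: "of_int A * of_int D = of_int B * of_int C + (1 :: complex)"
      by (metis of_int_1 of_int_add of_int_mult)
    have "(of_int A * \<tau> + of_int B) * of_int D = (of_int A * of_int D) * \<tau> + of_int B * of_int D"
      by (simp add: algebra_simps)
    also have "\<dots> = of_int B * w + \<tau>"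
      unfolding w_def AD by (simp add: algebra_simps)
    finally have "(of_int A * \<tau> + of_int B) * of_int D = of_int B * w + \<tau>" .
    moreover have "P / w = Q / d + R / (d * w)" if "P * d = Q * w + R" "d \<noteq> 0" for P Q R d :: complex
      using that w by (simp add: field_simps)
    ultimately show ?thesis
      unfolding \<tau>'_def w_def[symmetric] using D by simp
  qed
  have \<tau>': "Im \<tau>' > 0"
  proof -
    have "Im \<tau>' = Im ((of_int A * \<tau> + of_int B) / w)"
    proof -
      have "of_int B / of_int D = complex_of_real (of_int B / of_int D)" by simp
      then show ?thesis unfolding \<gamma> by (simp only: plus_complex.simps Im_complex_of_real)
    qed
    then show ?thesis using Im_moebius_pos[OF det \<tau>] by (simp add: w_def)
  qed
  define \<sigma> where "\<sigma> = of_int c * \<tau>'"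
  define \<rho> where "\<rho> = of_int (D\<^sup>2) * \<sigma>"
  have \<sigma>: "Im \<sigma> > 0" and \<rho>: "Im \<rho> > 0" and c\<tau>: "Im (of_int c * \<tau>) > 0"
    using \<tau>' c D \<tau> by (simp_all add: \<sigma>_def \<rho>_def)
  define E where "E = (\<lambda>n::int. unit_exp (of_int (c * B * (2 * n + 1)\<^sup>2) / of_int (8 * D)))"
  have E_cong: "E x = E y" if "[x = y] (mod D)" for x y
    unfolding E_def by (rule odd_square_exp_periodic[OF oddD that])
  have split: "theta (1/2) (of_int c * ((of_int A * \<tau> + of_int B) / w)) =
      (\<Sum>s\<in>{0..<D}. E s * theta ((of_int s + 1/2) / of_int D) \<rho>)"
  proof -
    have "theta (1/2) (of_int c * ((of_int A * \<tau> + of_int B) / w)) =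
        (\<Sum>\<^sub>\<infinity>n::int. E n * exp (of_real pi * \<i> * (of_int n + of_real (1/2))\<^sup>2 * \<sigma>))"
      unfolding theta_def
    proof (rule infsum_cong)
      fix n :: int
      have "of_real pi * \<i> * (of_int n + of_real (1/2))\<^sup>2 * (of_int c * ((of_int A * \<tau> + of_int B) / w)) =
         2 * of_real pi * \<i> * of_real (of_int (c * B * (2 * n + 1)\<^sup>2) / of_int (8 * D)) + of_real pi * \<i> * (of_int n + of_real (1/2))\<^sup>2 * \<sigma>"
        unfolding \<gamma> \<sigma>_def using D by (simp add: field_simps power2_eq_square)
      then show "exp (of_real pi * \<i> * (of_int n + of_real (1/2))\<^sup>2 * (of_int c * ((of_int A * \<tau> + of_int B) / w))) =
          E n * exp (of_real pi * \<i> * (of_int n + of_real (1/2))\<^sup>2 * \<sigma>)"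
        unfolding E_def unit_exp_eq_exp by (simp only: exp_add)
    qed
    also have "\<dots> = (\<Sum>s\<in>{0..<D}. E s * theta ((of_int s + 1/2) / of_int D) ((of_int D)\<^sup>2 * \<sigma>))"
      by (rule theta_series_split[OF \<sigma> D]) (auto intro: E_cong simp: cong_def)
    finally show ?thesis by (simp add: \<rho>_def)
  qed
  let ?e = "\<lambda>l::int. exp (of_real pi * \<i> * (of_int l)\<^sup>2 * (- 1 / (of_int c * \<tau>)))"
  have dual: "theta ((of_int s + 1/2) / of_int D) \<rho> * csqrt (- \<i> * \<rho>) =
     (\<Sum>\<^sub>\<infinity>l::int. unit_exp (of_int l * ((of_int s + 1/2) / of_int D) - of_int (l\<^sup>2 * C') / of_int D) * ?e l)" for s
  proof -
    have "(of_int s + 1/2) / of_int D \<in> (\<rat> :: real set)" by auto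
    from theta_inversion[OF this \<rho>]
    have "theta ((of_int s + 1/2) / of_int D) \<rho> * csqrt (- \<i> * \<rho>) =
      (\<Sum>\<^sub>\<infinity>l::int. unit_exp (of_int l * ((of_int s + 1/2) / of_int D)) * exp (of_real pi * \<i> * (of_int l)\<^sup>2 * (- 1 / \<rho>)))" .
    also have "\<dots> = (\<Sum>\<^sub>\<infinity>l::int. unit_exp (of_int l * ((of_int s + 1/2) / of_int D) - of_int (l\<^sup>2 * C') / of_int D) * ?e l)"
    proof (rule infsum_cong)
      fix l :: int
      have "- 1 / \<rho> = - (w / (of_int c * of_int D * \<tau>))"
        unfolding \<rho>_def \<sigma>_def \<tau>'_def w_def[symmetric] using w D c \<tau>0 by (simp add: power2_eq_square field_simps)
      also have "\<dots> = - 2 * of_int C' / of_int D - 1 / (of_int c * \<tau>)"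
        unfolding w_def C using D c \<tau>0 by (simp add: field_simps)
      finally have inv: "- 1 / \<rho> = - 2 * of_int C' / of_int D - 1 / (of_int c * \<tau>)" .
      have "of_real pi * \<i> * (of_int l)\<^sup>2 * (- 1 / \<rho>) =
          2 * of_real pi * \<i> * of_real (- (of_int (l\<^sup>2 * C') / of_int D)) + of_real pi * \<i> * (of_int l)\<^sup>2 * (- 1 / (of_int c * \<tau>))"
        unfolding inv by (simp add: algebra_simps)
      then have "exp (of_real pi * \<i> * (of_int l)\<^sup>2 * (- 1 / \<rho>)) = unit_exp (- (of_int (l\<^sup>2 * C') / of_int D)) * ?e l"
        unfolding unit_exp_eq_exp by (simp only: exp_add)
      then show "unit_exp (of_int l * ((of_int s + 1/2) / of_int D)) * exp (of_real pi * \<i> * (of_int l)\<^sup>2 * (- 1 / \<rho>)) =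
          unit_exp (of_int l * ((of_int s + 1/2) / of_int D) - of_int (l\<^sup>2 * C') / of_int D) * ?e l"
        by (simp only: diff_conv_add_uminus unit_exp_add mult.assoc)
    qed
    finally show ?thesis .
  qed
  have square: "E s * unit_exp (of_int l * ((of_int s + 1/2) / of_int D) - of_int (l\<^sup>2 * C') / of_int D) =
      unit_exp (of_int l * (1/2)) * E (1 * s + (- 2 * C' * l))" for s l
  proof -
    define y where "y = 2 * s + 1"
    have "odd (A * y)" using oddA by (simp add: y_def)
    then obtain v where v: "A * y = 2 * v + 1" by (elim oddE)
    have cBC: "2 * (c * B * C') = A * D - 1" using det unfolding C by (simp add: mult_ac)
    \<comment> \<open>The relation \<open>2 * (c * B * C') = A * D - 1\<close> turns the cross term
      into -4Dl(Ay) + 4ly. As Ay is odd, -4Dl(Ay) is -4Dl modulo 8D; divided by 8D it accounts for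
      the sign (-1)^l, the coefficient in the inversion formula for characteristic 1/2.\<close>
    have "c * B * (y - 4 * C' * l)\<^sup>2 = c * B * y\<^sup>2 - 4 * (2 * (c * B * C')) * l * y + 8 * (2 * (c * B * C')) * C' * l\<^sup>2"
      by (simp add: power2_eq_square algebra_simps)
    also have "\<dots> = c * B * y\<^sup>2 - 4 * D * l * (A * y) + 4 * l * y + 8 * (A * D - 1) * C' * l\<^sup>2"
      unfolding cBC by (simp add: algebra_simps)
    also have "\<dots> = (c * B * y\<^sup>2 + 4 * l * y - 8 * (l\<^sup>2 * C') - 4 * D * l) + 8 * D * (A * C' * l\<^sup>2 - l * v)"
      unfolding v by (simp add: algebra_simps)
    finally have key: "c * B * y\<^sup>2 + 4 * l * y - 8 * (l\<^sup>2 * C') =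
        4 * D * l + c * B * (y - 4 * C' * l)\<^sup>2 + 8 * D * (l * v - A * C' * l\<^sup>2)"
      by (simp add: algebra_simps)
    have y': "2 * (1 * s + (- 2 * C' * l)) + 1 = y - 4 * C' * l" by (simp add: y_def)
    have "of_int (c * B * y\<^sup>2) / of_int (8 * D) + (of_int l * ((of_int s + 1/2) / of_int D) - of_int (l\<^sup>2 * C') / of_int D) =
        (of_int (c * B * y\<^sup>2 + 4 * l * y - 8 * (l\<^sup>2 * C')) / of_int (8 * D) :: real)"
      using D by (simp add: y_def field_simps)
    also have "\<dots> = of_int l * (1/2) + of_int (c * B * (y - 4 * C' * l)\<^sup>2) / of_int (8 * D) + of_int (l * v - A * C' * l\<^sup>2)"
      unfolding key using D by (simp add: field_simps)
    finally show ?thesis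
      unfolding E_def y' y_def[symmetric] by (metis unit_exp_add unit_exp_add_of_int)
  qed
  define K where "K = (\<Sum>s\<in>{0..<D}. E s)"
  have K: "K = unit_exp (of_int (c * B * D) / 8) * gauss_sum (2 * (c * B)) D"
    unfolding K_def E_def by (rule sum_odd_square_exp[OF oddD D])
  have "theta (1/2) (of_int c * ((of_int A * \<tau> + of_int B) / w)) * csqrt (- \<i> * \<rho>) =
      (\<Sum>s\<in>{0..<D}. E s * (theta ((of_int s + 1/2) / of_int D) \<rho> * csqrt (- \<i> * \<rho>)))"
    unfolding split by (simp only: sum_distrib_right mult.assoc)
  also have "\<dots> = (\<Sum>s\<in>{0..<D}. \<Sum>\<^sub>\<infinity>l::int. unit_exp (of_int l * (1/2)) * E (1 * s + (- 2 * C' * l)) * ?e l)"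
    by (intro sum.cong refl, simp only: dual infsum_cmult_right'[symmetric]) (intro infsum_cong, simp only: mult.assoc[symmetric] square)
  also have "\<dots> = (\<Sum>\<^sub>\<infinity>l::int. \<Sum>s\<in>{0..<D}. unit_exp (of_int l * (1/2)) * E (1 * s + (- 2 * C' * l)) * ?e l)"
  proof (rule infsum_finite_sum[symmetric])
    fix s
    have "norm (unit_exp (of_int l * (1/2)) * E (1 * s + (- 2 * C' * l))) \<le> 1" for l
      by (simp add: norm_mult E_def)
    from theta_series_summable[OF Im_neg_inverse[OF c\<tau>] this, where r = 0]
    show "(\<lambda>l::int. unit_exp (of_int l * (1/2)) * E (1 * s + (- 2 * C' * l)) * ?e l) summable_on UNIV"
      by simp
  qed simp
  also have "\<dots> = (\<Sum>\<^sub>\<infinity>l::int. K * (unit_exp (of_int l * (1/2)) * ?e l))"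
  proof (rule infsum_cong)
    fix l
    have "(\<Sum>s\<in>{0..<D}. E (1 * s + (- 2 * C' * l))) = K"
      unfolding K_def by (rule sum_residues_affine[OF D E_cong]) auto
    then show "(\<Sum>s\<in>{0..<D}. unit_exp (of_int l * (1/2)) * E (1 * s + (- 2 * C' * l)) * ?e l) = K * (unit_exp (of_int l * (1/2)) * ?e l)"
      by (simp only: sum_distrib_left[symmetric] sum_distrib_right[symmetric] mult_ac)
  qed
  also have "\<dots> = K * (theta (1/2) (of_int c * \<tau>) * csqrt (- \<i> * (of_int c * \<tau>)))"
    unfolding infsum_cmult_right' by (subst theta_inversion[OF _ c\<tau>]) auto
  finally have main: "theta (1/2) (of_int c * ((of_int A * \<tau> + of_int B) / w)) * csqrt (- \<i> * \<rho>) =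
      K * (theta (1/2) (of_int c * \<tau>) * csqrt (- \<i> * (of_int c * \<tau>)))" .
  \<comment> \<open>The root sqrt c splits off on both sides and cancels, so the remaining quotient
    of roots is common to all factors of the product.\<close>
  have scale: "csqrt (- \<i> * (of_int c * z)) = of_real (sqrt (of_int c)) * csqrt (- \<i> * z)" for z
    using csqrt_of_real_mult[of "of_int c" "- \<i> * z"] c by (simp add: mult_ac)
  have \<rho>': "csqrt (- \<i> * \<rho>) = of_real (sqrt (of_int c)) * csqrt (- \<i> * (of_int (D\<^sup>2) * \<tau>'))"
    unfolding scale[symmetric] by (simp add: \<rho>_def \<sigma>_def mult_ac)
  have Y: "csqrt (- \<i> * (of_int (D\<^sup>2) * \<tau>')) \<noteq> 0"
    using \<tau>' D by (intro csqrt_neg_ii_nonzero) simp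
  have c0: "complex_of_real (sqrt (of_int c)) \<noteq> 0" using c by simp
  have solve: "X = K * (Z / Y) * T" if "X * (s * Y) = K * (T * (s * Z))" "s \<noteq> 0" "Y \<noteq> 0" for X Y Z T s :: complex
    using that by (simp add: field_simps)
  from solve[OF main[unfolded \<rho>' scale] c0 Y] show ?thesis
    unfolding K w_def mult.assoc[of 2 c B] .
qed

lemma prod_theta_half_Gamma0:
  fixes A B C D :: int and c :: "nat \<Rightarrow> nat"
  assumes det: "A * D - B * C = 1" and k: "k > 0" "even k"
    and c: "\<And>j. j \<in> {1..k} \<Longrightarrow> c j > 0" "\<And>j. j \<in> {1..k} \<Longrightarrow> 2 * int (c j) dvd C"
    and h: "8 dvd (\<Sum>j\<in>{1..k}. c j)" and D: "D > 0" and \<tau>: "Im \<tau> > 0"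
  shows "(\<Prod>j\<in>{1..k}. theta (1/2) (of_nat (c j) * ((of_int A * \<tau> + of_int B) / (of_int C * \<tau> + of_int D)))) =
    of_int (kronecker ((- 1) ^ (k div 2) * 4 * (\<Prod>j\<in>{1..k}. int (c j))) D) *
    (of_int C * \<tau> + of_int D) ^ (k div 2) * (\<Prod>j\<in>{1..k}. theta (1/2) (of_nat (c j) * \<tau>))"
proof -
  define m where "m = k div 2"
  have km: "k = 2 * m" using k by (simp add: m_def)
  define w where "w = of_int C * \<tau> + of_int D"
  define \<tau>' where "\<tau>' = \<tau> / (of_int D * w)"
  define X where "X = csqrt (- \<i> * \<tau>) / csqrt (- \<i> * (of_int (D\<^sup>2) * \<tau>'))"
  have \<tau>0: "\<tau> \<noteq> 0" using \<tau> by auto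
  have w: "w \<noteq> 0" unfolding w_def by (rule moebius_denominator_nonzero[OF det \<tau>])
  \<comment> \<open>As k is even, the product contains this root factor only through its square, and
    no branch has to be determined.\<close>
  have X2: "X\<^sup>2 = w / of_int D"
    unfolding X_def \<tau>'_def power_divide power2_csqrt using \<tau>0 w D by (simp add: power2_eq_square)
  have "2 dvd C" using c(2)[of 1] k by (auto dest: dvd_mult_left)
  then have oddD: "odd D"
  proof -
    have "A * D = B * C + 1" using det by simp
    then have "odd (A * D)" using \<open>2 dvd C\<close> by simp
    then show ?thesis by simp
  qed
  \<comment> \<open>A common divisor of D and of a divisor of BC divides the determinant 1. This
    applies to B and to every c_j, since c_j divides C.\<close>
  have cop: "coprime x D" if "x dvd B * C" for x
  proof (rule coprimeI)
    fix y assume y: "y dvd x" "y dvd D"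
    then have "y dvd A * D - B * C" using that by (meson dvd_diff dvd_mult dvd_trans)
    then show "is_unit y" by (simp add: det)
  qed
  have copB: "coprime (2 * B) D"
    using cop[of B] oddD by simp
  have copc: "coprime (int (c j)) D" if "j \<in> {1..k}" for j
    using c(2)[OF that] by (intro cop) (auto dest: dvd_mult_right)
  have kron: "kronecker x D * kronecker x D = 1" if "coprime x D" for x
    using kronecker_square[OF oddD D that] .
  have step: "theta (1/2) (of_nat (c j) * ((of_int A * \<tau> + of_int B) / w)) =
      unit_exp (of_int (int (c j) * B * D) / 8) * gauss_sum (2 * int (c j) * B) D * X * theta (1/2) (of_nat (c j) * \<tau>)"
    if "j \<in> {1..k}" for j
    using theta_half_Gamma0[OF det _ c(2)[OF that] D \<tau>] c(1)[OF that]
    unfolding X_def \<tau>'_def w_def by simp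
  have "(\<Prod>j\<in>{1..k}. theta (1/2) (of_nat (c j) * ((of_int A * \<tau> + of_int B) / w))) =
      (\<Prod>j\<in>{1..k}. unit_exp (of_int (int (c j) * B * D) / 8)) * (\<Prod>j\<in>{1..k}. gauss_sum (2 * int (c j) * B) D) *
      X ^ k * (\<Prod>j\<in>{1..k}. theta (1/2) (of_nat (c j) * \<tau>))"
    using step by (simp add: prod.distrib)
  also have "(\<Prod>j\<in>{1..k}. unit_exp (of_int (int (c j) * B * D) / 8)) = 1"
  proof -
    obtain n where n: "(\<Sum>j\<in>{1..k}. c j) = 8 * n" using h by (elim dvdE)
    have "(\<Sum>j\<in>{1..k}. of_int (int (c j) * B * D) / 8) = (of_nat (\<Sum>j\<in>{1..k}. c j) * of_int (B * D) / 8 :: real)"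
      unfolding of_nat_sum sum_distrib_right sum_divide_distrib by (intro sum.cong refl) simp
    also have "\<dots> = of_int (int n * B * D)" unfolding n by simp
    finally show ?thesis
      by (simp only: unit_exp_sum[OF finite_atLeastAtMost, symmetric] unit_exp_of_int)
  qed
  also have "(\<Prod>j\<in>{1..k}. gauss_sum (2 * int (c j) * B) D) =
      of_int (\<Prod>j\<in>{1..k}. kronecker (int (c j)) D) * (of_int (kronecker (- 1) D) ^ m * of_int D ^ m)"
  proof -
    have "(\<Prod>j\<in>{1..k}. gauss_sum (2 * int (c j) * B) D) =
        (\<Prod>j\<in>{1..k}. of_int (kronecker (int (c j)) D) * (of_int (kronecker (2 * B) D) * gauss_sum 1 D))"
    proof (rule prod.cong[OF refl])
      fix j assume j: "j \<in> {1..k}"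
      have "2 * int (c j) * B = int (c j) * (2 * B)" by simp
      moreover have "coprime (int (c j) * (2 * B)) D" using copc[OF j] copB by simp
      ultimately show "gauss_sum (2 * int (c j) * B) D = of_int (kronecker (int (c j)) D) * (of_int (kronecker (2 * B) D) * gauss_sum 1 D)"
        using gauss_sum_eq_kronecker[OF oddD D, of "int (c j) * (2 * B)"]
        by (simp only: kronecker_mult_left[OF oddD D, of "int (c j)"] of_int_mult mult.assoc)
    qed
    \<comment> \<open>The symbol of \<open>2 * B\<close> is shared by all factors and occurs to the
      even power k, so it disappears; the symbols of the c_j remain and form the character.\<close>
    also have "\<dots> = of_int (\<Prod>j\<in>{1..k}. kronecker (int (c j)) D) * ((of_int (kronecker (2 * B) D) * gauss_sum 1 D)\<^sup>2) ^ m"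
      by (simp add: prod.distrib km power_mult)
    also have "(of_int (kronecker (2 * B) D) * gauss_sum 1 D)\<^sup>2 = of_int (kronecker (2 * B) D * kronecker (2 * B) D) * (gauss_sum 1 D)\<^sup>2"
      by (simp add: power2_eq_square)
    also have "\<dots> = of_int (kronecker (- 1) D) * of_int D"
      by (simp only: kron[OF copB] gauss_sum_1_square[OF oddD D]) simp
    finally show ?thesis by (simp only: power_mult_distrib)
  qed
  also have "X ^ k = w ^ m / of_int D ^ m"
    unfolding km power_mult X2 by (rule power_divide)
  finally have "(\<Prod>j\<in>{1..k}. theta (1/2) (of_nat (c j) * ((of_int A * \<tau> + of_int B) / w))) =
      of_int ((\<Prod>j\<in>{1..k}. kronecker (int (c j)) D) * kronecker (- 1) D ^ m) * w ^ m * (\<Prod>j\<in>{1..k}. theta (1/2) (of_nat (c j) * \<tau>))"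
    using D by simp
  moreover have "kronecker ((- 1) ^ m * 4 * (\<Prod>j\<in>{1..k}. int (c j))) D = (\<Prod>j\<in>{1..k}. kronecker (int (c j)) D) * kronecker (- 1) D ^ m"
  proof -
    have "kronecker 4 D = kronecker (2 * 2) D" by simp
    also have "\<dots> = 1" using kron[of 2] oddD by (simp only: kronecker_mult_left[OF oddD D]) simp
    finally show ?thesis
      by (simp add: kronecker_mult_left[OF oddD D] kronecker_power_left[OF oddD D] kronecker_prod_left[OF oddD D])
  qed
  ultimately show ?thesis unfolding w_def m_def by simp
qed

text \<open>All terms are positive there. This provides a point where the form is nonzero, which is
  needed to read its character off from its values.\<close>

lemma theta_imaginary_pos:
  fixes y :: real
  assumes "y > 0"
  obtains p where "p > 0" "theta r (\<i> * of_real y) = of_real p"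
proof
  let ?f = "\<lambda>n::int. exp (- (pi * y * (of_int n + r)\<^sup>2))"
  have sm: "?f summable_on UNIV" using assms by (intro summable_on_exp_neg_square) simp
  have "exp (of_real pi * \<i> * (of_int n + of_real r)\<^sup>2 * (\<i> * of_real y)) = complex_of_real (?f n)" for n
    by (simp add: exp_of_real[symmetric] algebra_simps)
  then show "theta r (\<i> * of_real y) = of_real (infsum ?f UNIV)"
    unfolding theta_def by (simp only: infsumI[OF has_sum_of_real[OF has_sum_infsum[OF sm]]])
  have "(\<Sum>n\<in>{0}. ?f n) \<le> infsum ?f UNIV"
    by (rule finite_sum_le_infsum[OF sm]) auto
  then show "infsum ?f UNIV > 0"
    by (rule less_le_trans[rotated]) simp
qed

lemma F_theta_imaginary_nonzero:
  fixes y :: real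
  assumes "y > 0"
  shows "F_theta (\<i> * of_real y) \<noteq> 0"
proof -
  have y: "2 * y > 0" "6 * y > 0" using assms by auto
  obtain p1 where p1: "p1 > 0" "theta 0 (\<i> * of_real (2 * y)) = of_real p1"
    using theta_imaginary_pos[OF y(1)] .
  obtain p2 where p2: "p2 > 0" "theta 0 (\<i> * of_real (6 * y)) = of_real p2"
    using theta_imaginary_pos[OF y(2)] .
  obtain p3 where p3: "p3 > 0" "theta (1/2) (\<i> * of_real (2 * y)) = of_real p3"
    using theta_imaginary_pos[OF y(1)] .
  obtain p4 where p4: "p4 > 0" "theta (1/2) (\<i> * of_real (6 * y)) = of_real p4"
    using theta_imaginary_pos[OF y(2)] .
  have "F_theta (\<i> * of_real y) = of_real (p1 * p2 + p3 * p4)"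
    using F_theta_eq_theta[of "\<i> * of_real y"] assms p1 p2 p3 p4 by (simp add: mult.left_commute)
  moreover have "p1 * p2 + p3 * p4 > 0" using p1 p2 p3 p4 by (simp add: add_pos_pos)
  ultimately show ?thesis by (metis less_irrefl of_real_eq_0_iff)
qed

section \<open>Assembling the modular form\<close>

lemma nome_mult_psi_eq:
  assumes h: "8 dvd (\<Sum>j\<in>{1..k}. c j)" and c: "\<And>j. j \<in> {1..k} \<Longrightarrow> c j > 0" and \<tau>: "Im \<tau> > 0"
  shows "nome \<tau> ^ ((\<Sum>j\<in>{1..k}. c j) div 8) * psi u k a c \<tau> =
    (\<Prod>i\<in>{1..u}. F_theta (of_nat (a i) * \<tau>)) * ((1/2) ^ k * (\<Prod>j\<in>{1..k}. theta (1/2) (of_nat (c j) * \<tau>)))"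
proof -
  obtain n where n: "(\<Sum>j\<in>{1..k}. c j) = 8 * n" using h by (elim dvdE)
  \<comment> \<open>Each Psi factor needs the fractional power q^(c_j/8) to become a theta value;
    the product of these has exponent h/8 and is an integral power of the nome.\<close>
  have "(\<Sum>j\<in>{1..k}. of_real pi * \<i> * (of_nat (c j) * \<tau>) / 4) = of_nat (\<Sum>j\<in>{1..k}. c j) * (of_real pi * \<i> * \<tau> / 4)"
    unfolding of_nat_sum sum_distrib_right by (intro sum.cong refl) simp
  also have "\<dots> = of_nat n * (2 * of_real pi * \<i> * \<tau>)"
    unfolding n by simp
  finally have "nome \<tau> ^ n = (\<Prod>j\<in>{1..k}. exp (of_real pi * \<i> * (of_nat (c j) * \<tau>) / 4))"
    by (simp only: nome_def exp_of_nat_mult[symmetric] exp_sum[OF finite_atLeastAtMost, symmetric])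
  then have "nome \<tau> ^ n * (\<Prod>j\<in>{1..k}. Psi_theta (of_nat (c j) * \<tau>)) =
      (\<Prod>j\<in>{1..k}. exp (of_real pi * \<i> * (of_nat (c j) * \<tau>) / 4) * Psi_theta (of_nat (c j) * \<tau>))"
    by (simp only: prod.distrib)
  also have "\<dots> = (\<Prod>j\<in>{1..k}. (1/2) * theta (1/2) (of_nat (c j) * \<tau>))"
  proof (rule prod.cong[OF refl])
    fix j assume "j \<in> {1..k}"
    then have "Im (of_nat (c j) * \<tau>) > 0" using c \<tau> by simp
    from Psi_theta_eq_theta[OF this]
    show "exp (of_real pi * \<i> * (of_nat (c j) * \<tau>) / 4) * Psi_theta (of_nat (c j) * \<tau>) = (1/2) * theta (1/2) (of_nat (c j) * \<tau>)"
      by simp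
  qed
  also have "\<dots> = (1/2) ^ k * (\<Prod>j\<in>{1..k}. theta (1/2) (of_nat (c j) * \<tau>))"
    by (simp only: prod.distrib prod_constant card_atLeastAtMost) simp
  finally show ?thesis
    unfolding n psi_def by (simp add: mult_ac)
qed

lemma theta_poly_F_theta:
  assumes "a > 0"
  shows "theta_poly 2 (\<lambda>\<tau>. F_theta (of_nat a * \<tau>))"
proof (rule theta_poly.cong)
  show "theta_poly 2 (\<lambda>\<tau>. theta 0 (of_real (2 * of_nat a) * \<tau>) * theta 0 (of_real (6 * of_nat a) * \<tau>) +
      theta (1/2) (of_real (2 * of_nat a) * \<tau>) * theta (1/2) (of_real (6 * of_nat a) * \<tau>))"
    unfolding one_add_one[symmetric] using assms
    by (intro theta_poly.add theta_poly_times theta_poly_theta) (auto simp: one_add_one)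
  fix \<tau> assume "\<tau> \<in> upper_half_plane"
  then have "Im (of_nat a * \<tau>) > 0" using assms by (simp add: upper_half_plane_def)
  from F_theta_eq_theta[OF this]
  show "F_theta (of_nat a * \<tau>) = theta 0 (of_real (2 * of_nat a) * \<tau>) * theta 0 (of_real (6 * of_nat a) * \<tau>) +
      theta (1/2) (of_real (2 * of_nat a) * \<tau>) * theta (1/2) (of_real (6 * of_nat a) * \<tau>)"
    by (simp add: mult.assoc)
qed

theorem theorem1p2:
  fixes u k :: nat and a c :: "nat \<Rightarrow> nat"
  defines "h \<equiv> (\<Sum>j\<in>{1..k}. c j)"
  defines "L \<equiv> lcm (3 * (LCM i\<in>{1..u}. a i)) (2 * (LCM j\<in>{1..k}. c j))"
  defines "chi \<equiv> kronecker ((- 1) ^ (k div 2) * 4 * (\<Prod>j\<in>{1..k}. int (c j)))"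
  defines "chi' \<equiv> (if even u then chi else (\<lambda>d. Legendre d 3 * chi d))"
  assumes "k > 0" and "even k"
    and "\<And>i. i \<in> {1..u} \<Longrightarrow> a i \<in> {1, 2, 4, 8}"
    and "\<And>j. j \<in> {1..k} \<Longrightarrow> c j \<in> {1, 2, 3, 4, 6}"
    and "[h = 0] (mod 8)"
  shows "(\<lambda>\<tau>. nome \<tau> ^ (h div 8) * psi u k a c \<tau>)
           \<in> modular_forms (int (u + k div 2)) L (\<lambda>d. of_int (chi' d))"
proof -
  define f where "f = (\<lambda>\<tau>. nome \<tau> ^ (h div 8) * psi u k a c \<tau>)"
  define m where "m = k div 2"
  define w where "w = u + m"
  define M where "M = (- 1) ^ m * 4 * (\<Prod>j\<in>{1..k}. int (c j))"
  have a: "a i > 0" if "i \<in> {1..u}" for i using assms(7)[OF that] by auto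
  have c: "c j > 0" if "j \<in> {1..k}" for j using assms(8)[OF that] by auto
  have h: "8 dvd (\<Sum>j\<in>{1..k}. c j)" using assms(9) by (simp add: h_def cong_0_iff)
  have f_eq: "f \<tau> = (\<Prod>i\<in>{1..u}. F_theta (of_nat (a i) * \<tau>)) * ((1/2) ^ k * (\<Prod>j\<in>{1..k}. theta (1/2) (of_nat (c j) * \<tau>)))"
    if "Im \<tau> > 0" for \<tau>
    unfolding f_def h_def by (rule nome_mult_psi_eq[OF h c that])
  have chi: "chi = kronecker M" by (simp add: chi_def M_def m_def)
  \<comment> \<open>At a negative argument the Kronecker symbol picks up the sign of
    \<open>M\<close>, which has to match the sign (-1)^m of -I in weight m.\<close>
  have M_sgn: "M < 0 \<longleftrightarrow> odd m"
  proof -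
    have "(\<Prod>j\<in>{1..k}. int (c j)) > 0" using c by (intro prod_pos) auto
    then show ?thesis by (cases "even m") (simp_all add: M_def mult_less_0_iff)
  qed
  have aL: "3 * int (a i) dvd int L" if "i \<in> {1..u}" for i
  proof -
    have "3 * a i dvd 3 * (LCM i\<in>{1..u}. a i)" using that by (intro mult_dvd_mono dvd_Lcm) auto
    then have "3 * a i dvd L" unfolding L_def by (rule dvd_trans) simp
    then have "int (3 * a i) dvd int L" by (simp only: of_nat_dvd_iff)
    then show ?thesis by simp
  qed
  have cL: "2 * int (c j) dvd int L" if "j \<in> {1..k}" for j
  proof -
    have "2 * c j dvd 2 * (LCM j\<in>{1..k}. c j)" using that by (intro mult_dvd_mono dvd_Lcm) auto
    then have "2 * c j dvd L" unfolding L_def by (rule dvd_trans) simp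
    then have "int (2 * c j) dvd int L" by (simp only: of_nat_dvd_iff)
    then show ?thesis by simp
  qed
  have L3: "3 dvd int L"
  proof -
    have "3 dvd L" unfolding L_def by (rule dvd_trans[of _ "3 * (LCM i\<in>{1..u}. a i)"]) auto
    then show ?thesis by presburger
  qed
  have L2: "2 dvd int L" using cL[of 1] \<open>k > 0\<close> by (auto dest: dvd_mult_left)
  \<comment> \<open>3 and 2 divide L: the first makes the Legendre symbol a unit, the second
    excludes 0, where the Kronecker symbol would not be multiplicative by its prime factors.\<close>
  have cop3: "\<not> 3 dvd d" and cop2: "d \<noteq> 0" if "coprime d (int L)" for d
  proof -
    show "\<not> 3 dvd d" using coprime_common_divisor[OF that _ L3] by auto
    show "d \<noteq> 0" using coprime_common_divisor[OF that _ L2] by auto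
  qed
  have Legendre_square: "Legendre d 3 * Legendre d 3 = 1" if "\<not> 3 dvd d" for d
    using Legendre_values[of d 3] Legendre_eq_0_iff[of d 3] that by auto
  \<comment> \<open>The u factors F produce the u-th power of the symbol modulo 3. It is
    \<plusminus>1 here, so only the parity of u matters and both cases of the character take one
    form.\<close>
  have chi'_power: "chi' d = Legendre d 3 ^ u * chi d" if "\<not> 3 dvd d" for d
  proof (cases "even u")
    case True
    then show ?thesis
      using Legendre_square[OF that] by (auto simp: chi'_def power_mult power2_eq_square elim!: evenE)
  next
    case False
    then show ?thesis
      using Legendre_square[OF that] by (auto simp: chi'_def power_mult power_add power2_eq_square elim!: oddE)
  qed
  \<comment> \<open>The parity condition imposed by -I in weight w: u signs come from (-1 / 3) and m
    signs from the sign of \<open>M\<close>.\<close>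
  have chi'_minus: "chi' (- d) = (- 1) ^ w * chi' d" if "d > 0" "\<not> 3 dvd d" for d
  proof -
    have "Legendre (- d) 3 = - Legendre d 3"
      using Legendre_mult[of 3 "- 1" d] by (simp add: Legendre_minus_1_3)
    moreover have "chi (- d) = (- 1) ^ m * chi d"
      unfolding chi kronecker_minus_right[OF that(1)] using M_sgn by simp
    ultimately show ?thesis
      using that by (simp add: chi'_power w_def power_add power_minus[of "Legendre d 3"])
  qed
  have chi'_1: "chi' 1 = 1"
    by (simp add: chi'_def chi Legendre_1_3)
  have chi'_mult: "chi' (x * y) = chi' x * chi' y" if "coprime x (int L)" "coprime y (int L)" for x y
    using cop2[OF that(1)] cop2[OF that(2)] by (simp add: chi'_def chi kronecker_mult_right Legendre_mult)
  have copD: "coprime D (int L)" if "A * D - B * C = 1" "int L dvd C" for A B C D :: int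
  proof (rule coprimeI)
    fix y assume "y dvd D" "y dvd int L"
    then have "y dvd A * D - B * C" using that(2) by (meson dvd_diff dvd_mult dvd_trans)
    then show "is_unit y" using that(1) by simp
  qed
  have trans_pos: "f ((of_int A * \<tau> + of_int B) / (of_int C * \<tau> + of_int D)) =
      of_int (chi' D) * (of_int C * \<tau> + of_int D) ^ w * f \<tau>"
    if det: "A * D - B * C = 1" and dvd: "int L dvd C" and D: "D > 0" and \<tau>: "Im \<tau> > 0" for A B C D :: int and \<tau>
  proof -
    let ?\<gamma> = "(of_int A * \<tau> + of_int B) / (of_int C * \<tau> + of_int D)"
    let ?w = "of_int C * \<tau> + of_int D"
    have "(\<Prod>i\<in>{1..u}. F_theta (of_nat (a i) * ?\<gamma>)) = (\<Prod>i\<in>{1..u}. of_int (Legendre D 3) * ?w * F_theta (of_nat (a i) * \<tau>))"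
    proof (rule prod.cong[OF refl])
      fix i assume i: "i \<in> {1..u}"
      have "3 * int (a i) dvd C" using aL[OF i] dvd dvd_trans by blast
      from F_theta_Gamma0[OF det _ this \<tau>] a[OF i]
      show "F_theta (of_nat (a i) * ?\<gamma>) = of_int (Legendre D 3) * ?w * F_theta (of_nat (a i) * \<tau>)"
        by (simp only: of_int_of_nat_eq of_nat_0_less_iff)
    qed
    also have "\<dots> = of_int (Legendre D 3) ^ u * ?w ^ u * (\<Prod>i\<in>{1..u}. F_theta (of_nat (a i) * \<tau>))"
      by (simp add: prod.distrib power_mult_distrib)
    finally have F: "(\<Prod>i\<in>{1..u}. F_theta (of_nat (a i) * ?\<gamma>)) =
      of_int (Legendre D 3) ^ u * ?w ^ u * (\<Prod>i\<in>{1..u}. F_theta (of_nat (a i) * \<tau>))" .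
    have "2 * int (c j) dvd C" if "j \<in> {1..k}" for j
      using cL[OF that] dvd dvd_trans by blast
    note P = prod_theta_half_Gamma0[OF det \<open>k > 0\<close> \<open>even k\<close> c this h D \<tau>]
    have "chi' D = Legendre D 3 ^ u * chi D"
      by (intro chi'_power cop3 copD[OF det dvd])
    moreover have "f ?\<gamma> = (of_int (Legendre D 3) ^ u * ?w ^ u * (\<Prod>i\<in>{1..u}. F_theta (of_nat (a i) * \<tau>))) *
        ((1/2) ^ k * (of_int (chi D) * ?w ^ m * (\<Prod>j\<in>{1..k}. theta (1/2) (of_nat (c j) * \<tau>))))"
      by (simp only: f_eq[OF Im_moebius_pos[OF det \<tau>]] F P chi_def m_def)
    ultimately show ?thesis
      unfolding f_eq[OF \<tau>] by (simp add: w_def power_add)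
  qed
  have trans: "f ((of_int A * \<tau> + of_int B) / (of_int C * \<tau> + of_int D)) =
      of_int (chi' D) * (of_int C * \<tau> + of_int D) ^ w * f \<tau>"
    if det: "A * D - B * C = 1" and dvd: "int L dvd C" and \<tau>: "Im \<tau> > 0" for A B C D :: int and \<tau>
  proof (cases "D > 0")
    case True
    then show ?thesis by (rule trans_pos[OF det dvd _ \<tau>])
  next
    case False
    have D: "\<not> 3 dvd D" "D \<noteq> 0" using cop3 cop2 copD[OF det dvd] by auto
    \<comment> \<open>The negated matrix induces the same map and has a positive lower right entry;
      the parity of the character absorbs the sign of the automorphy factor.\<close>
    have "f ((of_int (- A) * \<tau> + of_int (- B)) / (of_int (- C) * \<tau> + of_int (- D))) =
      of_int (chi' (- D)) * (of_int (- C) * \<tau> + of_int (- D)) ^ w * f \<tau>"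
      using det dvd False D \<tau> by (intro trans_pos) auto
    moreover have "(of_int (- A) * \<tau> + of_int (- B)) / (of_int (- C) * \<tau> + of_int (- D)) =
        (of_int A * \<tau> + of_int B) / (of_int C * \<tau> + of_int D)"
    proof -
      have "of_int (- A) * \<tau> + of_int (- B) = - (of_int A * \<tau> + of_int B)"
        "of_int (- C) * \<tau> + of_int (- D) = - (of_int C * \<tau> + of_int D)" by simp_all
      then show ?thesis by (simp only: minus_divide_divide)
    qed
    moreover have "of_int (chi' (- D)) * (of_int (- C) * \<tau> + of_int (- D)) ^ w =
        of_int (chi' D) * (of_int C * \<tau> + of_int D) ^ w"
    proof -
      have "of_int (- C) * \<tau> + of_int (- D) = - (of_int C * \<tau> + of_int D)" by simp
      then have "(of_int (- C) * \<tau> + of_int (- D)) ^ w = (- 1) ^ w * (of_int C * \<tau> + of_int D) ^ w"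
        by (simp only: power_minus[of "of_int C * \<tau> + of_int D"])
      moreover have "chi' D = (- 1) ^ w * chi' (- D)"
        using chi'_minus[of "- D"] False D by simp
      ultimately show ?thesis by simp
    qed
    ultimately show ?thesis by simp
  qed
  \<comment> \<open>Allows \<open>f \<i>\<close> to be cancelled when two transformation formulas
    are compared below.\<close>
  have f_nonzero: "f \<i> \<noteq> 0"
  proof -
    have "F_theta (of_nat (a i) * \<i>) \<noteq> 0" if "i \<in> {1..u}" for i
      using F_theta_imaginary_nonzero[of "of_nat (a i)"] a[OF that] by (simp add: mult.commute)
    moreover have "theta (1/2) (of_nat (c j) * \<i>) \<noteq> 0" if "j \<in> {1..k}" for j
    proof -
      have "real (c j) > 0" using c[OF that] by simp
      then obtain p where "p > 0" "theta (1/2) (\<i> * of_real (real (c j))) = of_real p"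
        by (rule theta_imaginary_pos)
      then show ?thesis by (simp add: mult.commute)
    qed
    ultimately show ?thesis
      by (subst f_eq) auto
  qed
  \<comment> \<open>Reciprocity is not needed here: since \<open>f\<close> is invariant under \<open>\<tau> \<mapsto> \<tau> + 1\<close>, comparing the
    transformations of \<open>f\<close> under \<open>(A B; L d)\<close> and \<open>(A (A+B); L (d+L))\<close> gives the periodicity.\<close>
  have chi'_period: "chi' (d + int L) = chi' d" if cop: "coprime d (int L)" for d
  proof -
    obtain x y where "x * d + y * int L = 1"
      using cop by (metis bezout_int coprime_iff_gcd_eq_1)
    then have det: "x * d - (- y) * int L = 1" by simp
    have det': "x * (d + int L) - (x - y) * int L = 1" using det by (simp add: algebra_simps)
    define W where "W = of_int (int L) * \<i> + of_int (d + int L)"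
    have W: "W \<noteq> 0" unfolding W_def by (rule moebius_denominator_nonzero[OF det']) simp
    have "f (\<i> + 1) = f \<i>"
      using trans[of 1 1 1 0 \<i>] by (simp add: chi'_1)
    then have "f ((of_int x * (\<i> + 1) + of_int (- y)) / (of_int (int L) * (\<i> + 1) + of_int d)) =
        of_int (chi' d) * (of_int (int L) * (\<i> + 1) + of_int d) ^ w * f \<i>"
      using trans[OF det dvd_refl, of "\<i> + 1"] by simp
    moreover have "of_int (int L) * (\<i> + 1) + of_int d = W" "of_int x * (\<i> + 1) + of_int (- y) = of_int x * \<i> + of_int (x - y)"
      by (simp_all add: W_def algebra_simps)
    moreover have "f ((of_int x * \<i> + of_int (x - y)) / W) = of_int (chi' (d + int L)) * W ^ w * f \<i>"
      unfolding W_def by (rule trans[OF det' dvd_refl]) simp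
    ultimately have "of_int (chi' (d + int L)) * W ^ w * f \<i> = of_int (chi' d) * W ^ w * f \<i>"
      by (simp only:)
    then show ?thesis using W f_nonzero by simp
  qed
  have char: "character_mod L (\<lambda>d. of_int (chi' d))"
    unfolding character_mod_def
  proof (intro conjI allI impI)
    fix d n assume cop: "coprime d (int L)" and "[d = n] (mod int L)"
    then obtain t where n: "n = d + int L * t"
      by (metis cong_iff_lin mult.commute)
    have "chi' (d + int L * t) = chi' d"
    proof (induction t rule: int_induct[where k = 0])
      case (step1 i)
      have "coprime (d + int L * i) (int L)"
        using cop by (metis coprime_iff_gcd_eq_1 gcd_add_mult gcd.commute add.commute mult.commute)
      from chi'_period[OF this] step1 show ?case by (simp add: algebra_simps)
    next
      case (step2 i)
      have "coprime (d + int L * (i - 1)) (int L)"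
        using cop by (metis coprime_iff_gcd_eq_1 gcd_add_mult gcd.commute add.commute mult.commute)
      from chi'_period[OF this] step2 show ?case by (simp add: algebra_simps)
    qed simp
    then show "complex_of_int (chi' d) = of_int (chi' n)" by (simp add: n)
  qed (simp_all add: chi'_1 chi'_mult)
  have poly: "theta_poly (2 * w) f"
  proof -
    have "theta_poly (card {1..u} * 2) (\<lambda>\<tau>. \<Prod>i\<in>{1..u}. F_theta (of_nat (a i) * \<tau>))"
      using a by (intro theta_poly_prod theta_poly_F_theta) auto
    moreover have "theta_poly (card {1..k} * 1) (\<lambda>\<tau>. \<Prod>j\<in>{1..k}. theta (1/2) (of_real (of_nat (c j)) * \<tau>))"
      using c by (intro theta_poly_prod theta_poly_theta) auto
    ultimately have "theta_poly (card {1..u} * 2 + card {1..k} * 1) (\<lambda>\<tau>. (\<Prod>i\<in>{1..u}. F_theta (of_nat (a i) * \<tau>)) *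
        ((1/2) ^ k * (\<Prod>j\<in>{1..k}. theta (1/2) (of_real (of_nat (c j)) * \<tau>))))"
      by (intro theta_poly_times theta_poly_cmult)
    \<comment> \<open>Each F contributes two theta factors and each Psi one, so the degree 2u + k is
      twice the weight.\<close>
    moreover have "card {1..u} * 2 + card {1..k} * 1 = 2 * w"
      using \<open>even k\<close> by (simp add: w_def m_def)
    ultimately have "theta_poly (2 * w) (\<lambda>\<tau>. (\<Prod>i\<in>{1..u}. F_theta (of_nat (a i) * \<tau>)) *
        ((1/2) ^ k * (\<Prod>j\<in>{1..k}. theta (1/2) (of_real (of_nat (c j)) * \<tau>))))"
      by simp
    then show ?thesis
      by (rule theta_poly.cong) (simp add: f_eq upper_half_plane_def)
  qed
  have "f \<in> modular_forms (int w) L (\<lambda>d. of_int (chi' d))"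
    unfolding modular_forms_def
  proof (intro CollectI conjI allI impI ballI char)
    show "f holomorphic_on upper_half_plane"
      by (intro holomorphic_at_infinity_imp_holomorphic theta_poly_holomorphic_at_infinity[OF poly])
    fix A B C D :: int assume det: "A * D - B * C = 1"
    show "holomorphic_at_infinity (slash (int w) A B C D f)"
      by (intro theta_poly_holomorphic_at_infinity[OF theta_poly_slash] poly det)
    fix \<tau> assume "int L dvd C" "\<tau> \<in> upper_half_plane"
    then show "slash (int w) A B C D f \<tau> = of_int (chi' D) * f \<tau>"
      using trans[OF det] moebius_denominator_nonzero[OF det, of \<tau>]
      by (simp add: slash_def upper_half_plane_def power_int_minus)
  qed
  then show ?thesis by (simp add: f_def w_def m_def)
qed

end
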